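(* Let $k$ be an algebraically closed field of characteristic $p \ge 3$, let $q \ge 5$ be a power of $p$ with $q+1>6$, and let $\mathbb{F}_q \subset k$ be the subfield with $q$ elements. Let $\gamma \in \mathbb{F}_q \setminus \{1, -1\}$ satisfy $\gamma^{\frac{q-1}{2}}=1$, and let $C_4 \subset \mathbb{P}^2$ be the plane curve of degree $q+1$ over $k$ which is the image of the morphism $$\varphi_4: \mathbb{P}^1 \rightarrow \mathbb{P}^2; \quad (s:t) \mapsto \left(s^{\frac{q+1}{2}}t^{\frac{q+1}{2}} : (s+t)^{\frac{q+1}{2}}(s+\gamma t)^{\frac{q+1}{2}} : s^{q+1}-\gamma t^{q+1}\right).$$ Then: (a) The point $P_1:=(0:1:0)$ is an outer Galois point for $C_4$ with $G_{P_1} \cong D_{q+1}$. (b) The point $P_2:=(1:0:0)$ is an outer Galois point for $C_4$ with $G_{P_2} \cong D_{q+1}$.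
   Context: Let $C \subset \mathbb{P}^2$ be an irreducible plane curve over an algebraically closed field $k$, with function field $k(C)$. For a point $P \in \mathbb{P}^2$, let $\pi_P: C \dashrightarrow \mathbb{P}^1$ denote the projection from $P$ (the restriction to $C$ of the linear projection $\mathbb{P}^2 \dashrightarrow \mathbb{P}^1$ with center $P$). The point $P$ is called a Galois point for $C$ if the function field extension $k(C)/\pi_P^*k(\mathbb{P}^1)$ induced by $\pi_P$ is Galois; in that case $G_P$ denotes the Galois group of this extension. A Galois point $P$ is called inner if $P$ is a smooth point of $C$, and outer if $P \in \mathbb{P}^2 \setminus C$. For an even integer $2m$, $D_{2m}$ denotes the dihedral group of order $2m$, i.e. $\langle a,b \mid a^m=b^2=(ab)^2=1\rangle$. *)

theory Defs
  imports "HOL-Computational_Algebra.Computational_Algebra" "HOL-Algebra.Algebra"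
    "HOL-Algebra.Algebraic_Closure_Type"
begin

hide_const (open) Divisibility.irreducible UnivPoly.coeff

text \<open>A point of the projective plane is the set of all its homogeneous coordinate vectors.\<close>

definition proj_point :: "'k::field \<Rightarrow> 'k \<Rightarrow> 'k \<Rightarrow> ('k \<times> 'k \<times> 'k) set" where
  "proj_point x y z = {(c * x, c * y, c * z) | c. c \<noteq> 0}"

definition proj_plane :: "('k::field \<times> 'k \<times> 'k) set set" where
  "proj_plane = {proj_point x y z | x y z. (x, y, z) \<noteq> (0, 0, 0)}"

text \<open>
  Polynomials in \<open>X, Y, Z\<close> are represented as \<open>k[Z][Y][X]\<close>: the outermost variable is \<open>X\<close>, the
  innermost one is \<open>Z\<close>.
\<close>

type_synonym 'k poly3 = "'k poly poly poly"

definition eval3 :: "'k::field poly3 \<Rightarrow> 'k \<times> 'k \<times> 'k \<Rightarrow> 'k" where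
  "eval3 F = (\<lambda>(x, y, z). poly (poly (poly F [:[:x:]:]) [:y:]) z)"

definition const3 :: "'k::field \<Rightarrow> 'k poly3" where
  "const3 c = [:[:[:c:]:]:]"

text \<open>The zero polynomial is homogeneous of every degree.\<close>

definition homogeneous3 :: "nat \<Rightarrow> 'k::field poly3 \<Rightarrow> bool" where
  "homogeneous3 d F \<longleftrightarrow>
     (\<forall>i j l. coeff (coeff (coeff F i) j) l \<noteq> 0 \<longrightarrow> i + j + l = d)"

definition vanishes_on :: "'k::field poly3 \<Rightarrow> ('k \<times> 'k \<times> 'k) set set \<Rightarrow> bool" where
  "vanishes_on F C \<longleftrightarrow> (\<forall>P\<in>C. \<forall>v\<in>P. eval3 F v = 0)"

definition zero_locus :: "'k::field poly3 \<Rightarrow> ('k \<times> 'k \<times> 'k) set set" where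
  "zero_locus F = {P \<in> proj_plane. \<forall>v\<in>P. eval3 F v = 0}"

text \<open>
  Over an algebraically closed field the irreducible equation \<open>F\<close> below is determined by \<open>C\<close> up
  to a nonzero constant, so that \<open>d\<close> is the degree of \<open>C\<close>.
\<close>

definition irreducible_plane_curve :: "nat \<Rightarrow> ('k::field \<times> 'k \<times> 'k) set set \<Rightarrow> bool" where
  "irreducible_plane_curve d C \<longleftrightarrow>
     (\<exists>F. homogeneous3 d F \<and> irreducible F \<and> C = zero_locus F)"

text \<open>
  A rational function on \<open>C\<close> is a quotient \<open>A/B\<close> of homogeneous polynomials of the same degree
  with \<open>B\<close> not vanishing identically on \<open>C\<close>; two quotients \<open>A/B\<close> and \<open>A'/B'\<close> are identified if
  \<open>AB' - A'B\<close> vanishes on \<open>C\<close>.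
\<close>

definition fractions_on :: "('k::field \<times> 'k \<times> 'k) set set \<Rightarrow> ('k poly3 \<times> 'k poly3) set" where
  "fractions_on C =
     {(A, B). \<exists>d. homogeneous3 d A \<and> homogeneous3 d B \<and> \<not> vanishes_on B C}"

definition fraction_rel ::
    "('k::field \<times> 'k \<times> 'k) set set \<Rightarrow> (('k poly3 \<times> 'k poly3) \<times> ('k poly3 \<times> 'k poly3)) set" where
  "fraction_rel C =
     {((A, B), (A', B')). (A, B) \<in> fractions_on C \<and> (A', B') \<in> fractions_on C \<and>
        vanishes_on (A * B' - A' * B) C}"

definition fraction_class ::
    "('k::field \<times> 'k \<times> 'k) set set \<Rightarrow> 'k poly3 \<Rightarrow> 'k poly3 \<Rightarrow> ('k poly3 \<times> 'k poly3) set" where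
  "fraction_class C A B = fraction_rel C `` {(A, B)}"

definition function_field ::
    "('k::field \<times> 'k \<times> 'k) set set \<Rightarrow> ('k poly3 \<times> 'k poly3) set ring" where
  "function_field C =
     \<lparr>carrier = fractions_on C // fraction_rel C,
      monoid.mult = (\<lambda>x y. \<Union>(A, B)\<in>x. \<Union>(A', B')\<in>y. fraction_class C (A * A') (B * B')),
      monoid.one = fraction_class C 1 1,
      ring.zero = fraction_class C 0 1,
      ring.add = (\<lambda>x y. \<Union>(A, B)\<in>x. \<Union>(A', B')\<in>y. fraction_class C (A * B' + A' * B) (B * B'))\<rparr>"

text \<open>
  The projection from \<open>P\<close> is \<open>Q \<mapsto> (L(Q) : M(Q))\<close> for a basis \<open>L, M\<close> of the space of linear forms
  vanishing at \<open>P\<close>; it is determined by \<open>P\<close> up to an automorphism of the projective line.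
\<close>

definition projection_forms ::
    "('k::field \<times> 'k \<times> 'k) set \<Rightarrow> 'k poly3 \<Rightarrow> 'k poly3 \<Rightarrow> bool" where
  "projection_forms P L M \<longleftrightarrow>
     homogeneous3 1 L \<and> homogeneous3 1 M \<and>
     (\<forall>v\<in>P. eval3 L v = 0) \<and> (\<forall>v\<in>P. eval3 M v = 0) \<and>
     (\<forall>a b. const3 a * L + const3 b * M = 0 \<longrightarrow> a = 0 \<and> b = 0)"

text \<open>
  The value at \<open>(L, M)\<close> of the binary form of degree \<open>d\<close> in \<open>S, T\<close> whose coefficient
  at \<open>S^i * T^(d - i)\<close> is \<open>a i\<close>.
\<close>

definition binary_form_at ::
    "nat \<Rightarrow> (nat \<Rightarrow> 'k::field) \<Rightarrow> 'k poly3 \<Rightarrow> 'k poly3 \<Rightarrow> 'k poly3" where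
  "binary_form_at d a L M = (\<Sum>i\<le>d. const3 (a i) * L ^ i * M ^ (d - i))"

text \<open>
  The image of the function field of the projective line under pullback along the projection
  from \<open>P\<close>. It does not depend on the basis \<open>L, M\<close>, so all bases are admitted.
\<close>

definition projection_field ::
    "('k::field \<times> 'k \<times> 'k) set set \<Rightarrow> ('k \<times> 'k \<times> 'k) set \<Rightarrow> ('k poly3 \<times> 'k poly3) set set" where
  "projection_field C P =
     {fraction_class C (binary_form_at d a L M) (binary_form_at d b L M) | L M d a b.
        projection_forms P L M \<and> \<not> vanishes_on (binary_form_at d b L M) C}"

definition galois_group :: "('a, 'm) ring_scheme \<Rightarrow> 'a set \<Rightarrow> ('a \<Rightarrow> 'a) monoid" where
  "galois_group L K = BijGroup (carrier L)
     \<lparr>carrier := {\<sigma> \<in> Bij (carrier L). \<sigma> \<in> ring_hom L L \<and> (\<forall>x\<in>K. \<sigma> x = x)}\<rparr>"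

definition galois_extension :: "('a, 'm) ring_scheme \<Rightarrow> 'a set \<Rightarrow> bool" where
  "galois_extension L K \<longleftrightarrow>
     field L \<and> subfield K L \<and> (\<forall>x\<in>carrier L. ring.algebraic L K x) \<and>
     {x \<in> carrier L. \<forall>\<sigma>\<in>carrier (galois_group L K). \<sigma> x = x} = K"

definition galois_point ::
    "('k::field \<times> 'k \<times> 'k) set set \<Rightarrow> ('k \<times> 'k \<times> 'k) set \<Rightarrow> bool" where
  "galois_point C P \<longleftrightarrow>
     P \<in> proj_plane \<and> galois_extension (function_field C) (projection_field C P)"

definition outer_galois_point ::
    "('k::field \<times> 'k \<times> 'k) set set \<Rightarrow> ('k \<times> 'k \<times> 'k) set \<Rightarrow> bool" where
  "outer_galois_point C P \<longleftrightarrow> galois_point C P \<and> P \<in> proj_plane - C"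

definition galois_point_group ::
    "('k::field \<times> 'k \<times> 'k) set set \<Rightarrow> ('k \<times> 'k \<times> 'k) set \<Rightarrow>
     (('k poly3 \<times> 'k poly3) set \<Rightarrow> ('k poly3 \<times> 'k poly3) set) monoid" where
  "galois_point_group C P = galois_group (function_field C) (projection_field C P)"

text \<open>
  Words are lists of letters \<open>(g, e)\<close>, where \<open>(g, True)\<close> stands for the generator \<open>g\<close> and
  \<open>(g, False)\<close> for its formal inverse. \<open>word_equiv R\<close> is the least congruence on words that
  cancels inverse pairs and trivialises the relators in \<open>R\<close>.
\<close>

type_synonym 'g word = "('g \<times> bool) list"

inductive word_equiv :: "'g word set \<Rightarrow> 'g word \<Rightarrow> 'g word \<Rightarrow> bool" for R :: "'g word set" where
  refl: "word_equiv R u u"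
| sym: "word_equiv R u v \<Longrightarrow> word_equiv R v u"
| trans: "word_equiv R u v \<Longrightarrow> word_equiv R v w \<Longrightarrow> word_equiv R u w"
| cancel: "word_equiv R (u @ [(g, e), (g, \<not> e)] @ v) (u @ v)"
| relator: "r \<in> R \<Longrightarrow> word_equiv R (u @ r @ v) (u @ v)"

definition presented_group :: "'g word set \<Rightarrow> 'g word set monoid" where
  "presented_group R =
     \<lparr>carrier = UNIV // {(u, v). word_equiv R u v},
      monoid.mult = (\<lambda>x y. \<Union>u\<in>x. \<Union>v\<in>y. {w. word_equiv R (u @ v) w}),
      monoid.one = {w. word_equiv R [] w}\<rparr>"

datatype dihedral_generator = gen_a | gen_b

text \<open>For \<open>n = 2m\<close> this is \<open>\<langle>a, b | a\<^sup>m = b\<^sup>2 = (ab)\<^sup>2 = 1\<rangle>\<close>; the index is the order of the group.\<close>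

definition dihedral_group :: "nat \<Rightarrow> dihedral_generator word set monoid" where
  "dihedral_group n = presented_group
     {replicate (n div 2) (gen_a, True),
      [(gen_b, True), (gen_b, True)],
      [(gen_a, True), (gen_b, True), (gen_a, True), (gen_b, True)]}"

definition curve_C4 :: "nat \<Rightarrow> 'k::field \<Rightarrow> ('k \<times> 'k \<times> 'k) set set" where
  "curve_C4 q \<gamma> =
     {proj_point (s ^ ((q + 1) div 2) * t ^ ((q + 1) div 2))
                 ((s + t) ^ ((q + 1) div 2) * (s + \<gamma> * t) ^ ((q + 1) div 2))
                 (s ^ (q + 1) - \<gamma> * t ^ (q + 1)) | s t. (s, t) \<noteq> (0, 0)}"

end

theory Submission
  imports Defs
begin

hide_const (open) Polynomials.degree Polynomials.lead_coeff Divisibility.prime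

text \<open>
  Put \<open>n = (q + 1) / 2\<close>. The projection of \<open>C\<^sub>4\<close> from \<open>(0 : 1 : 0)\<close> is
  \<open>(s : t) \<mapsto> (s\<^sup>n t\<^sup>n : s\<^sup>2\<^sup>n - \<gamma> t\<^sup>2\<^sup>n)\<close>. Rescaling \<open>t\<close> by a \<open>2n\<close>-th root of \<open>-\<gamma>\<close> turns it into
  \<open>(u : v) \<mapsto> (u\<^sup>n v\<^sup>n : u\<^sup>2\<^sup>n + v\<^sup>2\<^sup>n)\<close>, the quotient of the projective line by the dihedral group that is
  generated by \<open>v \<mapsto> \<zeta> v\<close> with \<open>\<zeta>\<^sup>n = 1\<close> and by the exchange of \<open>u\<close> and \<open>v\<close>. Because \<open>\<gamma>\<^sup>q = \<gamma>\<close>, the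
  third coordinate has the same shape in the coordinates \<open>s + t\<close> and \<open>s + \<gamma> t\<close> (\<open>third_coordinate\<close>), so
  that the projection from \<open>(1 : 0 : 0)\<close> is, in other coordinates, the same quotient map.

  The rest is to show that the parametrisation is birational. Let \<open>f = s\<^sup>n t\<^sup>n\<close> be the first coordinate and
  consider its conjugates under the dihedral group that belongs to \<open>(1 : 0 : 0)\<close>. The form \<open>f\<close> vanishes
  exactly at \<open>s = 0\<close> and \<open>t = 0\<close>, and no element of the group except the identity preserves this pair of
  points: this is where \<open>\<gamma> \<noteq> \<plusminus>1\<close> and \<open>\<gamma> ^ ((q - 1) / 2) = 1\<close> enter (\<open>inj_first_form\<close>). So \<open>f\<close> has \<open>2n\<close>
  distinct conjugates \<open>f\<^sub>i\<close>. Invariant forms are forms in \<open>u\<^sup>n v\<^sup>n\<close> and \<open>u\<^sup>2\<^sup>n + v\<^sup>2\<^sup>n\<close>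
  (\<open>dihedral_invariant_poly\<close>). Hence the norm \<open>\<Prod>\<^sub>i (x - f\<^sub>i)\<close> descends to a form of degree \<open>2n = q + 1\<close> in
  the plane, which is the irreducible equation of the curve (\<open>irreducible_equation\<close>,
  \<open>zero_locus_equation\<close>), and Lagrange interpolation between the \<open>f\<^sub>i\<close> writes the parameter \<open>v/u\<close> as a
  quotient of two forms in the plane (\<open>coordinate_is_quotient\<close>).

  Consequently the function field of \<open>C\<^sub>4\<close> is the rational function field \<open>k(y)\<close> (\<open>fraction_fiber_iso\<close>),
  and for both centres the subfield that comes from the projection is the fixed field of the dihedral group
  acting on \<open>k(y)\<close> (\<open>projection_field_eq\<close>). The extension is Galois by Artin's theorem
  (\<open>galois_extension_fixed_field\<close>), and an automorphism over the fixed field sends \<open>y\<close> to a solution \<open>z\<close> of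
  \<open>z\<^sup>n + z\<^sup>-\<^sup>n = y\<^sup>n + y\<^sup>-\<^sup>n\<close>, hence belongs to the dihedral group (\<open>galois_group_ratfun_dihedral\<close>). Normal
  forms of words identify that group with the presented one (\<open>iso_dihedral_groupI\<close>).
\<close>

section \<open>Recognising a presented dihedral group\<close>

abbreviation (input) dihedral_relators :: "nat \<Rightarrow> dihedral_generator word set" where
  "dihedral_relators m \<equiv>
     {replicate m (gen_a, True),
      [(gen_b, True), (gen_b, True)],
      [(gen_a, True), (gen_b, True), (gen_a, True), (gen_b, True)]}"

lemma word_equiv_append:
  assumes "word_equiv R u v"
  shows "word_equiv R (x @ u @ y) (x @ v @ y)"
  using assms
proof (induction rule: word_equiv.induct)
  case (cancel u g e v)
  show ?case using word_equiv.cancel[of R "x @ u" g e "v @ y"] by simp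
next
  case (relator r u v)
  show ?case using word_equiv.relator[OF relator, of "x @ u" "v @ y"] by simp
qed (blast intro: word_equiv.intros)+

lemma word_equiv_append2:
  assumes "word_equiv R u u'" "word_equiv R v v'"
  shows "word_equiv R (u @ v) (u' @ v')"
  using word_equiv_append[OF assms(1), of "[]" v] word_equiv_append[OF assms(2), of u' "[]"]
  by (auto intro: word_equiv.trans)

definition dihedral_normal_form :: "nat \<Rightarrow> nat \<Rightarrow> dihedral_generator word" where
  "dihedral_normal_form i j = replicate i (gen_a, True) @ replicate j (gen_b, True)"

text \<open>
  Inverse letters are positive powers of the generators, and \<open>abab = 1\<close> moves every \<open>b\<close> to the right of
  every \<open>a\<close>; then \<open>a\<^sup>m = b\<^sup>2 = 1\<close> reduces the exponents.
\<close>

lemma word_equiv_normal_form_exists: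
  assumes m: "m > 0"
  defines "R \<equiv> dihedral_relators m"
  shows "\<exists>i<m. \<exists>j<2. word_equiv R w (dihedral_normal_form i j)"
proof -
  let ?a = "(gen_a, True)" and ?b = "(gen_b, True)"
  let ?N = dihedral_normal_form
  note T [trans] = word_equiv.trans[of R] and S = word_equiv.sym[of R]
  have Ra: "word_equiv R (replicate m ?a) []" using word_equiv.relator[of "replicate m ?a" R "[]" "[]"]
    by (simp add: R_def)
  have Rb: "word_equiv R [?b, ?b] []" using word_equiv.relator[of "[?b,?b]" R "[]" "[]"]
    by (simp add: R_def)
  have Rab: "word_equiv R [?a,?b,?a,?b] []" using word_equiv.relator[of "[?a,?b,?a,?b]" R "[]" "[]"]
    by (simp add: R_def)
  have inv_a: "word_equiv R [(gen_a, False)] (replicate (m - 1) ?a)"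
  proof -
    have "word_equiv R ([(gen_a, False)] @ [] @ []) ([(gen_a, False)] @ replicate m ?a @ [])"
      by (rule word_equiv_append[OF S[OF Ra]])
    also have "[(gen_a, False)] @ replicate m ?a @ [] = [] @ [(gen_a, False), (gen_a, \<not> False)] @ replicate (m - 1) ?a"
      using m by (cases m) auto
    finally have "word_equiv R [(gen_a, False)] ([] @ [(gen_a, False), (gen_a, \<not> False)] @ replicate (m - 1) ?a)" by simp
    from T[OF this word_equiv.cancel] show ?thesis by simp
  qed
  have inv_b: "word_equiv R [(gen_b, False)] [?b]"
  proof -
    have "word_equiv R ([(gen_b, False)] @ [] @ []) ([(gen_b, False)] @ [?b, ?b] @ [])"
      by (rule word_equiv_append[OF S[OF Rb]])
    also have "[(gen_b, False)] @ [?b, ?b] @ [] = [] @ [(gen_b, False), (gen_b, \<not> False)] @ [?b]"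
      by auto
    finally have "word_equiv R [(gen_b, False)] ([] @ [(gen_b, False), (gen_b, \<not> False)] @ [?b])" by simp
    from T[OF this word_equiv.cancel] show ?thesis by simp
  qed
  \<comment> \<open>The relation \<open>abab = 1\<close> moves \<open>b\<close> to the right of \<open>a\<close> at the cost of inverting \<open>a\<close>.\<close>
  have ba: "word_equiv R [?b, ?a] (replicate (m - 1) ?a @ [?b])"
  proof -
    have "word_equiv R [?b, ?a] [?b, ?a, ?b, ?b]"
      using word_equiv_append[OF S[OF Rb], of "[?b, ?a]" "[]"] by simp
    also have "word_equiv R \<dots> [(gen_a, False), ?a, ?b, ?a, ?b, ?b]"
      using S[OF word_equiv.cancel[of R "[]" gen_a False "[?b, ?a, ?b, ?b]"]] by simp
    also have "word_equiv R \<dots> [(gen_a, False), ?b]"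
      using word_equiv_append[OF Rab, of "[(gen_a, False)]" "[?b]"] by simp
    also have "word_equiv R \<dots> (replicate (m - 1) ?a @ [?b])"
      using word_equiv_append[OF inv_a, of "[]" "[?b]"] by simp
    finally show ?thesis .
  qed
  have red_a: "\<exists>i'<m. word_equiv R (replicate i ?a) (replicate i' ?a)" for i
  proof (induction i rule: less_induct)
    case (less i)
    show ?case
    proof (cases "i < m")
      case True thus ?thesis using word_equiv.refl by blast
    next
      case False
      then have "replicate i ?a = [] @ replicate m ?a @ replicate (i - m) ?a"
        by (simp flip: replicate_add)
      then have "word_equiv R (replicate i ?a) (replicate (i - m) ?a)"
        using word_equiv_append[OF Ra, of "[]" "replicate (i - m) ?a"] by simp
      moreover obtain i' where "i' < m" "word_equiv R (replicate (i - m) ?a) (replicate i' ?a)"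
        using less.IH[of "i - m"] False m by auto
      ultimately show ?thesis using T by blast
    qed
  qed
  have red_b: "\<exists>j'<2. word_equiv R (replicate j ?b) (replicate j' ?b)" for j
  proof (induction j rule: less_induct)
    case (less j)
    show ?case
    proof (cases "j < 2")
      case True thus ?thesis using word_equiv.refl by blast
    next
      case False
      then have "replicate j ?b = [] @ [?b,?b] @ replicate (j - 2) ?b"
        by (simp add: numeral_2_eq_2 flip: replicate_Suc)
      then have "word_equiv R (replicate j ?b) (replicate (j - 2) ?b)"
        using word_equiv_append[OF Rb, of "[]" "replicate (j - 2) ?b"] by simp
      moreover obtain j' where "j' < 2" "word_equiv R (replicate (j - 2) ?b) (replicate j' ?b)"
        using less.IH[of "j - 2"] False by auto
      ultimately show ?thesis using T by blast
    qed
  qed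
  have ba_i: "\<exists>k. word_equiv R (?b # replicate i ?a) (replicate k ?a @ [?b])" for i
  proof (induction i)
    case 0
    show ?case using word_equiv.refl[of R "[?b]"] by (intro exI[of _ 0]) auto
  next
    case (Suc i)
    then obtain k where k: "word_equiv R (?b # replicate i ?a) (replicate k ?a @ [?b])" by blast
    have "word_equiv R ([] @ [?b, ?a] @ replicate i ?a) ([] @ (replicate (m - 1) ?a @ [?b]) @ replicate i ?a)"
      by (rule word_equiv_append[OF ba])
    moreover have "word_equiv R (replicate (m - 1) ?a @ (?b # replicate i ?a) @ [])
        (replicate (m - 1) ?a @ (replicate k ?a @ [?b]) @ [])"
      by (rule word_equiv_append[OF k])
    ultimately have "word_equiv R (?b # replicate (Suc i) ?a) (replicate (m - 1 + k) ?a @ [?b])"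
      by (simp add: replicate_add T)
    then show ?case by blast
  qed
  have *: "\<exists>i j. word_equiv R w (?N i j)"
  proof (induction w)
    case Nil
    show ?case using word_equiv.refl[of R "[]"]
      by (intro exI[of _ 0]) (auto simp: dihedral_normal_form_def)
  next
    case (Cons x w)
    then obtain i j where ij: "word_equiv R w (?N i j)" by blast
    have xw: "word_equiv R (x # w) (x # ?N i j)"
      using word_equiv_append[OF ij, of "[x]" "[]"] by simp
    have b: "\<exists>k l. word_equiv R (?b # ?N i j) (?N k l)"
    proof -
      obtain k where k: "word_equiv R (?b # replicate i ?a) (replicate k ?a @ [?b])"
        using ba_i by blast
      have "word_equiv R (?b # ?N i j) (?N k (Suc j))"
        using word_equiv_append[OF k, of "[]" "replicate j ?b"] by (simp add: dihedral_normal_form_def)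
      then show ?thesis by blast
    qed
    obtain g e where x: "x = (g, e)" by force
    consider "x = ?a" | "x = (gen_a, False)" | "x = ?b" | "x = (gen_b, False)"
      using x by (cases g; cases e) auto
    then have "\<exists>k l. word_equiv R (x # ?N i j) (?N k l)"
    proof cases
      case 1
      show ?thesis using word_equiv.refl[of R "?N (Suc i) j"]
        by (intro exI[of _ "Suc i"] exI[of _ j]) (auto simp: 1 dihedral_normal_form_def)
    next
      case 2
      show ?thesis using word_equiv_append[OF inv_a, of "[]" "?N i j"]
        by (intro exI[of _ "m - 1 + i"] exI[of _ j]) (auto simp: 2 dihedral_normal_form_def replicate_add)
    next
      case 3
      show ?thesis unfolding 3 by (rule b)
    next
      case 4
      have "word_equiv R (x # ?N i j) (?b # ?N i j)"
        using word_equiv_append[OF inv_b, of "[]" "?N i j"] by (simp add: 4)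
      with b T show ?thesis by blast
    qed
    then show ?case using T[OF xw] by blast
  qed
  then obtain i j where ij: "word_equiv R w (?N i j)" by blast
  obtain i' where i': "i' < m" "word_equiv R (replicate i ?a) (replicate i' ?a)" using red_a by blast
  obtain j' where j': "j' < 2" "word_equiv R (replicate j ?b) (replicate j' ?b)" using red_b by blast
  have "word_equiv R (?N i j) (?N i' j')"
    unfolding dihedral_normal_form_def by (rule word_equiv_append2[OF i'(2) j'(2)])
  then show ?thesis using i'(1) j'(1) T[OF ij] by blast
qed

text \<open>
  The isomorphism sends \<open>g\<close> to the set of all words with value \<open>g\<close>. Two words with the same value have the
  same normal form, hence are equivalent, so that these sets are the elements of the presented group. In the
  evaluation of words, the inverse letters take the values \<open>a\<^sup>m\<^sup>-\<^sup>1\<close> and \<open>b\<close>.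
\<close>

lemma iso_dihedral_groupI:
  fixes G (structure)
  assumes "monoid G" and a: "a \<in> carrier G" and b: "b \<in> carrier G" and m: "m > 0"
    and am: "a [^] m = \<one>" and bb: "b \<otimes> b = \<one>" and abab: "(a \<otimes> b) \<otimes> (a \<otimes> b) = \<one>"
    and gen: "\<And>g. g \<in> carrier G \<Longrightarrow> \<exists>(i::nat) (j::nat). g = a [^] i \<otimes> b [^] j"
    and inj: "\<And>i i' j j'::nat. i < m \<Longrightarrow> i' < m \<Longrightarrow> j < 2 \<Longrightarrow> j' < 2 \<Longrightarrow>
      a [^] i \<otimes> b [^] j = a [^] i' \<otimes> b [^] j' \<Longrightarrow> i = i' \<and> j = j'"
  shows "G \<cong> dihedral_group (2 * m)"
proof -
  interpret monoid G by fact
  let ?R = "dihedral_relators m"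
  define letter where "letter = (\<lambda>(g, e). if g = gen_b then b else if e then a else a [^] (m - 1))"
  define val where "val = (\<lambda>w. foldr (\<lambda>x g. letter x \<otimes> g) w \<one>)"
  have letter: "letter x \<in> carrier G" for x using a b by (auto simp: letter_def split: prod.splits)
  have val_simps [simp]: "val [] = \<one>" "val (x # w) = letter x \<otimes> val w" for x w by (auto simp: val_def)
  have valc [simp]: "val w \<in> carrier G" for w by (induction w) (auto simp: letter)
  have val_append: "val (u @ v) = val u \<otimes> val v" for u v
    by (induction u) (auto simp: m_assoc letter)
  have val_a: "val (replicate i (gen_a, True)) = a [^] i" for i
    by (induction i) (auto simp: letter_def a simp flip: nat_pow_Suc2)
  have val_b: "val (replicate i (gen_b, True)) = b [^] i" for i
    by (induction i) (auto simp: letter_def b simp flip: nat_pow_Suc2)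
  have val_N: "val (dihedral_normal_form i j) = a [^] i \<otimes> b [^] j" for i j
    by (simp add: dihedral_normal_form_def val_append val_a val_b)
  have canc: "letter (g, e) \<otimes> letter (g, \<not> e) = \<one>" for g e
  proof (cases "g = gen_b")
    case True thus ?thesis by (simp add: letter_def bb)
  next
    case False
    have "a \<otimes> a [^] (m - 1) = \<one>" "a [^] (m - 1) \<otimes> a = \<one>"
      using am m a nat_pow_Suc2[of a "m - 1"] nat_pow_Suc[of a "m - 1"] by auto
    with False show ?thesis by (auto simp: letter_def)
  qed
  have sound: "val u = val v" if "word_equiv ?R u v" for u v
    using that
  proof (induction rule: word_equiv.induct)
    case (cancel u g e v)
    have "val ([(g, e), (g, \<not> e)]) = \<one>" using canc[of g e] letter by simp
    then have "val ([(g, e), (g, \<not> e)] @ v) = val v" by (simp only: val_append) simp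
    then show ?case by (simp only: val_append)
  next
    case (relator r u v)
    then have "val r = \<one>"
      using am bb abab a b val_a[of m] by (auto simp: letter_def m_assoc)
    then show ?case by (simp add: val_append)
  qed auto
  have complete: "word_equiv ?R u v" if "val u = val v" for u v
  proof -
    obtain i j where u: "i < m" "j < 2" "word_equiv ?R u (dihedral_normal_form i j)"
      using word_equiv_normal_form_exists[OF m] by blast
    obtain i' j' where v: "i' < m" "j' < 2" "word_equiv ?R v (dihedral_normal_form i' j')"
      using word_equiv_normal_form_exists[OF m] by blast
    have "i = i' \<and> j = j'"
      using inj[OF u(1) v(1) u(2) v(2)] that sound[OF u(3)] sound[OF v(3)] by (simp add: val_N)
    then show ?thesis using word_equiv.trans[OF u(3)] word_equiv.sym[OF v(3)] by blast
  qed
  have we: "word_equiv ?R u v \<longleftrightarrow> val u = val v" for u v using sound complete by blast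
  define h where "h = (\<lambda>g. {w. val w = g})"
  have ex: "\<exists>w. val w = g" if "g \<in> carrier G" for g
    using gen[OF that] val_N by metis
  have D: "dihedral_group (2 * m) = presented_group ?R" by (simp add: dihedral_group_def)
  have carr: "carrier (dihedral_group (2 * m)) = h ` carrier G"
  proof -
    have "{(u, v). word_equiv ?R u v} `` {w} = h (val w)" for w by (auto simp: h_def we)
    then show ?thesis unfolding D using ex
      by (auto simp: presented_group_def quotient_def we) (metis imageI valc)
  qed
  have "h \<in> hom G (dihedral_group (2 * m))"
  proof (rule homI)
    fix x y assume x: "x \<in> carrier G" and y: "y \<in> carrier G"
    obtain u where u: "val u = x" using ex[OF x] by blast
    obtain v where v: "val v = y" using ex[OF y] by blast
    have "(\<Union>u\<in>h x. \<Union>v\<in>h y. {w. word_equiv ?R (u @ v) w}) = h (x \<otimes> y)"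
      using u v by (auto simp: h_def we val_append)
    then show "h (x \<otimes> y) = h x \<otimes>\<^bsub>dihedral_group (2 * m)\<^esub> h y"
      by (simp add: D presented_group_def)
  qed (auto simp: carr)
  moreover have "inj_on h (carrier G)"
    by (rule inj_onI) (use ex in \<open>fastforce simp: h_def\<close>)
  ultimately show ?thesis
    unfolding is_iso_def iso_iff using carr by (auto simp: iso_def bij_betw_def)
qed

section \<open>Galois extensions and their transport along isomorphisms\<close>

definition field_automorphism :: "('m::field \<Rightarrow> 'm) \<Rightarrow> bool" where
  "field_automorphism \<sigma> \<longleftrightarrow>
     bij \<sigma> \<and> (\<forall>x y. \<sigma> (x + y) = \<sigma> x + \<sigma> y) \<and> (\<forall>x y. \<sigma> (x * y) = \<sigma> x * \<sigma> y)"

lemma field_automorphismD: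
  assumes "field_automorphism \<sigma>"
  shows "bij \<sigma>" "\<sigma> (x + y) = \<sigma> x + \<sigma> y" "\<sigma> (x * y) = \<sigma> x * \<sigma> y" "\<sigma> 0 = 0" "\<sigma> 1 = 1"
    "\<sigma> (- x) = - \<sigma> x" "\<sigma> (inverse x) = inverse (\<sigma> x)" "\<sigma> (sum f A) = (\<Sum>i\<in>A. \<sigma> (f i))"
    "\<sigma> (prod f A) = (\<Prod>i\<in>A. \<sigma> (f i))" "\<sigma> x = 0 \<longleftrightarrow> x = 0" "\<sigma> (x / y) = \<sigma> x / \<sigma> y"
    "\<sigma> (x ^ k) = \<sigma> x ^ k"
proof -
  show b: "bij \<sigma>" and a: "\<sigma> (x + y) = \<sigma> x + \<sigma> y" and m: "\<sigma> (x * y) = \<sigma> x * \<sigma> y" for x y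
    using assms by (auto simp: field_automorphism_def)
  show z: "\<sigma> 0 = 0" using a[of 0 0] add_cancel_left_left[of "\<sigma> 0" "\<sigma> 0"] by simp
  show nz: "\<sigma> x = 0 \<longleftrightarrow> x = 0" for x using b z by (metis bij_pointE)
  show one: "\<sigma> 1 = 1" using m[of 1 1] nz[of 1] by simp
  show "\<sigma> (- x) = - \<sigma> x" using a[of x "- x"] z by (simp add: eq_neg_iff_add_eq_0 add.commute)
  show i: "\<sigma> (inverse x) = inverse (\<sigma> x)" for x
  proof (cases "x = 0")
    case False
    then have "\<sigma> x * \<sigma> (inverse x) = 1" using m[of x "inverse x"] one by simp
    then show ?thesis by (metis inverse_unique)
  qed (simp add: z)
  show "\<sigma> (x / y) = \<sigma> x / \<sigma> y" using m i by (simp add: divide_inverse)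
  show "\<sigma> (sum f A) = (\<Sum>i\<in>A. \<sigma> (f i))"
    by (induction A rule: infinite_finite_induct) (auto simp: z a)
  show "\<sigma> (prod f A) = (\<Prod>i\<in>A. \<sigma> (f i))"
    by (induction A rule: infinite_finite_induct) (auto simp: one m)
  show "\<sigma> (x ^ k) = \<sigma> x ^ k" by (induction k) (auto simp: one m)
qed

lemma map_poly_automorphism_mult:
  assumes "field_automorphism \<sigma>"
  shows "map_poly \<sigma> (p * q) = map_poly \<sigma> p * map_poly \<sigma> q"
  by (rule poly_eqI)
    (auto simp: coeff_map_poly field_automorphismD[OF assms] coeff_mult)

lemma map_poly_automorphism_prod:
  assumes "field_automorphism \<sigma>"
  shows "map_poly \<sigma> (prod f A) = (\<Prod>i\<in>A. map_poly \<sigma> (f i))"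
  by (induction A rule: infinite_finite_induct)
    (auto simp: map_poly_automorphism_mult[OF assms] field_automorphismD(5)[OF assms] map_poly_1')

lemma ring_of_type_algebra_simps [simp]:
  "carrier ring_of_type_algebra = UNIV" "x \<otimes>\<^bsub>ring_of_type_algebra\<^esub> y = x * y"
  "x \<oplus>\<^bsub>ring_of_type_algebra\<^esub> y = x + y" "\<one>\<^bsub>ring_of_type_algebra\<^esub> = 1"
  "\<zero>\<^bsub>ring_of_type_algebra\<^esub> = 0"
  by (simp_all add: ring_of_type_algebra_def)

lemma ring_of_type_algebra_minus:
  "\<ominus>\<^bsub>ring_of_type_algebra\<^esub> (x::'m::field) = - x"
proof -
  interpret field "ring_of_type_algebra :: 'm ring" by (rule field_from_type_algebra)
  show ?thesis using minus_equality[of "- x" x] by simp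
qed

lemma ring_of_type_algebra_inv:
  "x \<noteq> 0 \<Longrightarrow> inv\<^bsub>ring_of_type_algebra\<^esub> (x::'m::field) = inverse x"
proof -
  assume x: "x \<noteq> 0"
  interpret field "ring_of_type_algebra :: 'm ring" by (rule field_from_type_algebra)
  show ?thesis using inv_unique'[of x "inverse x"] x by simp
qed

lemma ring_of_type_algebra_pow:
  "(x::'m::field) [^]\<^bsub>ring_of_type_algebra\<^esub> (k::nat) = x ^ k"
  by (induction k) (auto simp: nat_pow_def mult.commute)

lemma subfield_of_type_algebraI:
  fixes K :: "'m::field set"
  assumes "1 \<in> K" "\<And>x y. x \<in> K \<Longrightarrow> y \<in> K \<Longrightarrow> x + y \<in> K" "\<And>x y. x \<in> K \<Longrightarrow> y \<in> K \<Longrightarrow> x * y \<in> K"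
    "\<And>x. x \<in> K \<Longrightarrow> - x \<in> K" "\<And>x. x \<in> K \<Longrightarrow> inverse x \<in> K"
  shows "subfield K ring_of_type_algebra"
proof -
  interpret field "ring_of_type_algebra :: 'm ring" by (rule field_from_type_algebra)
  show ?thesis
  proof (rule subfieldI')
    show "subring K ring_of_type_algebra"
      by (rule subringI) (use assms in \<open>auto simp: ring_of_type_algebra_minus\<close>)
  qed (use assms in \<open>auto simp: ring_of_type_algebra_inv\<close>)
qed

text \<open>
  Polynomials over a ring structure are coefficient lists that begin with the leading coefficient, so the
  reversed list of the coefficients of \<open>P\<close> is a witness.
\<close>

lemma algebraic_of_type_algebraI:
  fixes P :: "'m::field poly"
  assumes "P \<noteq> 0" "\<And>i. coeff P i \<in> K" "poly P x = 0"
  shows "ring.algebraic ring_of_type_algebra K x"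
proof -
  interpret field "ring_of_type_algebra :: 'm ring" by (rule field_from_type_algebra)
  have eval: "eval (xs @ [a]) x = eval xs x * x + a" for xs a
  proof (induction xs)
    case (Cons b xs)
    then show ?case by (simp add: ring_of_type_algebra_pow algebra_simps)
  qed (simp add: ring_of_type_algebra_pow)
  have "eval (rev (coeffs p)) x = poly p x" for p
    by (induction p) (auto simp: cCons_def eval)
  then have "eval (rev (coeffs P)) x = eval [] x" using assms(3) by simp
  moreover have "rev (coeffs P) \<in> carrier (univ_poly ring_of_type_algebra K)"
  proof -
    have "hd (rev (coeffs P)) \<noteq> 0"
      using assms(1) by (simp add: hd_rev last_coeffs_eq_coeff_degree)
    moreover have "set (coeffs P) \<subseteq> K" using assms(2) by (auto simp: coeffs_def)
    ultimately show ?thesis by (auto simp: univ_poly_def polynomial_def)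
  qed
  moreover have "[] \<in> carrier (univ_poly ring_of_type_algebra K)"
    by (auto simp: univ_poly_def polynomial_def)
  ultimately show ?thesis
    unfolding transcendental_def inj_on_def using assms(1) by fastforce
qed

lemma galois_group_of_type_algebra:
  fixes K :: "'m::field set"
  shows "carrier (galois_group ring_of_type_algebra K) = {\<sigma>. field_automorphism \<sigma> \<and> (\<forall>x\<in>K. \<sigma> x = x)}"
proof -
  have "\<sigma> \<in> Bij UNIV \<longleftrightarrow> bij \<sigma>" for \<sigma> :: "'m \<Rightarrow> 'm"
    by (auto simp: Bij_def extensional_def)
  then show ?thesis
    by (auto simp: galois_group_def ring_hom_def field_automorphism_def
        intro: field_automorphismD(5)[unfolded field_automorphism_def])
qed

lemma galois_group_of_type_algebra_mult:
  fixes K :: "'m::field set"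
  assumes "bij \<sigma>" "bij \<tau>"
  shows "\<sigma> \<otimes>\<^bsub>galois_group ring_of_type_algebra K\<^esub> \<tau> = \<sigma> \<circ> \<tau>"
proof -
  have "\<sigma> \<in> Bij UNIV \<longleftrightarrow> bij \<sigma>" for \<sigma> :: "'m \<Rightarrow> 'm"
    by (auto simp: Bij_def extensional_def)
  then show ?thesis using assms
    by (auto simp: galois_group_def BijGroup_def compose_def)
qed

lemma galois_group_of_type_algebra_one:
  "\<one>\<^bsub>galois_group (ring_of_type_algebra :: 'm::field ring) K\<^esub> = id"
  by (auto simp: galois_group_def BijGroup_def)

text \<open>
  Artin's argument: every \<open>x\<close> is a root of the polynomial \<open>\<Prod>\<tau>\<in>G. (T - \<tau> x)\<close>, whose coefficients
  are fixed by \<open>G\<close> because composition with an element of \<open>G\<close> permutes the factors.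
\<close>

lemma galois_extension_fixed_field:
  fixes G :: "('m::field \<Rightarrow> 'm) set"
  assumes fin: "finite G" and id: "id \<in> G" and comp: "\<And>\<sigma> \<tau>. \<sigma> \<in> G \<Longrightarrow> \<tau> \<in> G \<Longrightarrow> \<sigma> \<circ> \<tau> \<in> G"
    and aut: "\<And>\<sigma>. \<sigma> \<in> G \<Longrightarrow> field_automorphism \<sigma>"
  defines "K \<equiv> {x. \<forall>\<sigma>\<in>G. \<sigma> x = x}"
  shows "galois_extension ring_of_type_algebra K"
  unfolding galois_extension_def
proof (intro conjI ballI)
  show "field (ring_of_type_algebra :: 'm ring)" by (rule field_from_type_algebra)
  show "subfield K ring_of_type_algebra"
    by (rule subfield_of_type_algebraI) (auto simp: K_def field_automorphismD[OF aut])
  show "{x \<in> carrier ring_of_type_algebra. \<forall>\<sigma>\<in>carrier (galois_group ring_of_type_algebra K). \<sigma> x = x} = K"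
    using aut by (auto simp: galois_group_of_type_algebra K_def)
  fix x :: 'm
  define P where "P = (\<Prod>\<tau>\<in>G. [:- \<tau> x, 1:])"
  show "ring.algebraic ring_of_type_algebra K x"
  proof (rule algebraic_of_type_algebraI)
    show "P \<noteq> 0" by (auto simp: P_def fin)
    show "poly P x = 0" using fin id by (auto simp: P_def poly_prod intro!: prod_zero bexI[of _ id])
    show "coeff P i \<in> K" for i
      unfolding K_def
    proof (safe)
      fix \<sigma> assume s: "\<sigma> \<in> G"
      have bij: "bij_betw ((\<circ>) \<sigma>) G G"
      proof -
        have "inj_on ((\<circ>) \<sigma>) G"
          using field_automorphismD(1)[OF aut[OF s]]
          by (auto simp: inj_on_def fun_eq_iff bij_def inj_def)
        moreover have "(\<circ>) \<sigma> ` G \<subseteq> G" using comp s by auto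
        ultimately show ?thesis
          using fin by (simp add: bij_betw_def endo_inj_surj)
      qed
      have "map_poly \<sigma> P = (\<Prod>\<tau>\<in>G. [:- (\<sigma> \<circ> \<tau>) x, 1:])"
        unfolding P_def map_poly_automorphism_prod[OF aut[OF s]]
        by (intro prod.cong refl) (auto simp: map_poly_pCons field_automorphismD[OF aut[OF s]] map_poly_1')
      also have "\<dots> = P" unfolding P_def by (rule prod.reindex_bij_betw[OF bij])
      finally show "\<sigma> (coeff P i) = coeff P i"
        by (metis coeff_map_poly field_automorphismD(4)[OF aut[OF s]])
    qed
  qed
qed

lemma galois_group_transport:
  assumes "ring R" "ring S" and h: "h \<in> ring_iso R S" and K: "K \<subseteq> carrier R"
  shows "galois_group S (h ` K) \<cong> galois_group R K"
    and "\<And>\<tau>. \<tau> \<in> carrier (galois_group R K) \<Longrightarrow>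
      \<exists>\<sigma>\<in>carrier (galois_group S (h ` K)). \<forall>x\<in>carrier R. \<sigma> (h x) = h (\<tau> x)"
proof -
  define k where "k = inv_into (carrier R) h"
  have hR: "h \<in> ring_hom R S" and bij: "bij_betw h (carrier R) (carrier S)"
    using h by (auto simp: ring_iso_def)
  have bijk: "bij_betw k (carrier S) (carrier R)" unfolding k_def by (rule bij_betw_inv_into[OF bij])
  have kh: "k (h x) = x" if "x \<in> carrier R" for x
    using bij that by (simp add: k_def bij_betw_inv_into_left)
  have hk: "h (k y) = y" if "y \<in> carrier S" for y
    using bij that by (simp add: k_def bij_betw_inv_into_right)
  have hc: "h x \<in> carrier S" if "x \<in> carrier R" for x using bij that by (auto simp: bij_betw_def)
  have kc: "k x \<in> carrier R" if "x \<in> carrier S" for x using bijk that by (auto simp: bij_betw_def)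
  have kR: "k \<in> ring_hom S R"
    using h ring_iso_set_sym[OF \<open>ring R\<close> h] by (simp add: k_def ring_iso_def)
  define c where "c = (\<lambda>\<tau>. restrict (h \<circ> \<tau> \<circ> k) (carrier S))"
  define d where "d = (\<lambda>\<sigma>. restrict (k \<circ> \<sigma> \<circ> h) (carrier R))"
  have GR: "\<tau> \<in> carrier (galois_group R K) \<longleftrightarrow>
      \<tau> \<in> extensional (carrier R) \<and> bij_betw \<tau> (carrier R) (carrier R) \<and> \<tau> \<in> ring_hom R R \<and> (\<forall>x\<in>K. \<tau> x = x)" for \<tau>
    by (auto simp: galois_group_def Bij_def)
  have GS: "\<tau> \<in> carrier (galois_group S (h ` K)) \<longleftrightarrow>
      \<tau> \<in> extensional (carrier S) \<and> bij_betw \<tau> (carrier S) (carrier S) \<and> \<tau> \<in> ring_hom S S \<and> (\<forall>x\<in>K. \<tau> (h x) = h x)" for \<tau>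
    by (auto simp: galois_group_def Bij_def)
  have cin: "c \<tau> \<in> carrier (galois_group S (h ` K))" if "\<tau> \<in> carrier (galois_group R K)" for \<tau>
  proof -
    note t = that[unfolded GR]
    have "bij_betw (h \<circ> \<tau> \<circ> k) (carrier S) (carrier S)"
      using bij bijk t by (meson bij_betw_trans)
    moreover have "h \<circ> \<tau> \<circ> k \<in> ring_hom S S"
      using ring_hom_trans[OF ring_hom_trans[OF kR, of \<tau> R] hR] t by (simp add: comp_assoc)
    ultimately show ?thesis
      using t K ring.ring_simprules(6)[OF \<open>ring S\<close>] ring.ring_simprules[OF \<open>ring S\<close>] unfolding GS c_def
      by (auto simp: ring_hom_def kh hc subset_iff cong: bij_betw_cong)
  qed
  have din: "d \<tau> \<in> carrier (galois_group R K)" if "\<tau> \<in> carrier (galois_group S (h ` K))" for \<tau>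
  proof -
    note t = that[unfolded GS]
    have "bij_betw (k \<circ> \<tau> \<circ> h) (carrier R) (carrier R)"
      using bij bijk t by (meson bij_betw_trans)
    moreover have "k \<circ> \<tau> \<circ> h \<in> ring_hom R R"
      using ring_hom_trans[OF ring_hom_trans[OF hR, of \<tau> S] kR] t by (simp add: comp_assoc)
    ultimately show ?thesis
      using t K ring.ring_simprules(6)[OF \<open>ring R\<close>] ring.ring_simprules[OF \<open>ring R\<close>] unfolding GR d_def
      by (auto simp: ring_hom_def kh hc subset_iff cong: bij_betw_cong)
  qed
  have in_S: "\<tau> x \<in> carrier S" if "\<tau> \<in> carrier (galois_group S (h ` K))" "x \<in> carrier S" for \<tau> x
    using that unfolding GS bij_betw_def by blast
  have in_R: "\<tau> x \<in> carrier R" if "\<tau> \<in> carrier (galois_group R K)" "x \<in> carrier R" for \<tau> x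
    using that unfolding GR bij_betw_def by blast
  have cd: "c (d \<tau>) = \<tau>" if t: "\<tau> \<in> carrier (galois_group S (h ` K))" for \<tau>
  proof (rule extensionalityI[of _ "carrier S"])
    show "\<tau> \<in> extensional (carrier S)" using t GS by blast
    show "c (d \<tau>) x = \<tau> x" if "x \<in> carrier S" for x
      using that in_S[OF t] by (simp add: c_def d_def kc hk)
  qed (simp add: c_def)
  have dc: "d (c \<tau>) = \<tau>" if t: "\<tau> \<in> carrier (galois_group R K)" for \<tau>
  proof (rule extensionalityI[of _ "carrier R"])
    show "\<tau> \<in> extensional (carrier R)" using t GR by blast
    show "d (c \<tau>) x = \<tau> x" if "x \<in> carrier R" for x
      using that in_R[OF t] by (simp add: c_def d_def hc kh)
  qed (simp add: d_def)
  have mR: "x \<otimes>\<^bsub>galois_group R K\<^esub> y = compose (carrier R) x y"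
    if "x \<in> carrier (galois_group R K)" "y \<in> carrier (galois_group R K)" for x y
    using that by (auto simp: galois_group_def BijGroup_def)
  have mS: "x \<otimes>\<^bsub>galois_group S (h ` K)\<^esub> y = compose (carrier S) x y"
    if "x \<in> carrier (galois_group S (h ` K))" "y \<in> carrier (galois_group S (h ` K))" for x y
    using that by (auto simp: galois_group_def BijGroup_def)
  have "d \<in> iso (galois_group S (h ` K)) (galois_group R K)"
  proof (rule isoI)
    show "d \<in> hom (galois_group S (h ` K)) (galois_group R K)"
    proof (rule homI)
      fix x y assume xy: "x \<in> carrier (galois_group S (h ` K))" "y \<in> carrier (galois_group S (h ` K))"
      then show "d (x \<otimes>\<^bsub>galois_group S (h ` K)\<^esub> y) = d x \<otimes>\<^bsub>galois_group R K\<^esub> d y"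
        unfolding mS[OF xy] mR[OF din[OF xy(1)] din[OF xy(2)]]
        by (auto simp: d_def compose_def fun_eq_iff kc hc hk in_S)
    qed (rule din)
    show "bij_betw d (carrier (galois_group S (h ` K))) (carrier (galois_group R K))"
      by (rule bij_betw_byWitness[where f' = c]) (auto simp: cd dc cin din)
  qed
  then show "galois_group S (h ` K) \<cong> galois_group R K" by (auto simp: is_iso_def)
  show "\<exists>\<sigma>\<in>carrier (galois_group S (h ` K)). \<forall>x\<in>carrier R. \<sigma> (h x) = h (\<tau> x)"
    if "\<tau> \<in> carrier (galois_group R K)" for \<tau>
    using cin[OF that] by (auto intro!: bexI[of _ "c \<tau>"] simp: c_def hc kh)
qed

text \<open>
  The structure \<open>S\<close> inherits the field axioms from \<open>R\<close>, so they need not be checked for quotients of sets of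
  fractions.
\<close>

lemma galois_extension_transport:
  assumes gal: "galois_extension R K" and h: "h \<in> ring_iso R S" and z: "h \<zero>\<^bsub>R\<^esub> = \<zero>\<^bsub>S\<^esub>"
  shows "galois_extension S (h ` K)" "galois_group S (h ` K) \<cong> galois_group R K"
proof -
  have R: "field R" and K: "subfield K R" and alg: "\<And>x. x \<in> carrier R \<Longrightarrow> ring.algebraic R K x"
    and fixd: "{x \<in> carrier R. \<forall>\<sigma>\<in>carrier (galois_group R K). \<sigma> x = x} = K"
    using gal unfolding galois_extension_def by blast+
  have Kc: "K \<subseteq> carrier R" by (rule subfieldE(3)[OF K])
  interpret R: field R by fact
  have S: "field S"
  proof -
    have "field (S\<lparr>zero := h \<zero>\<^bsub>R\<^esub>\<rparr>)" by (rule R.ring_iso_imp_img_field[OF h])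
    then show ?thesis by (simp add: z)
  qed
  interpret S: field S by fact
  have hR: "h \<in> ring_hom R S" and bij: "bij_betw h (carrier R) (carrier S)"
    using h by (auto simp: ring_iso_def)
  interpret h: ring_hom_ring R S h by (rule ring_hom_ringI2[OF R.ring_axioms S.ring_axioms hR])
  show "galois_group S (h ` K) \<cong> galois_group R K"
    by (rule galois_group_transport[OF R.ring_axioms S.ring_axioms h Kc])
  have inj: "inj_on h (carrier R)" using bij by (auto simp: bij_betw_def)
  show "galois_extension S (h ` K)"
    unfolding galois_extension_def
  proof (intro conjI ballI)
    show "field S" by fact
    show "subfield (h ` K) S"
      by (rule h.img_is_subfield(2)[OF K]) simp
    show "{x \<in> carrier S. \<forall>\<sigma>\<in>carrier (galois_group S (h ` K)). \<sigma> x = x} = h ` K" (is "?F = _")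
    proof
      show "?F \<subseteq> h ` K"
      proof safe
        fix y assume y: "y \<in> carrier S" "\<forall>\<sigma>\<in>carrier (galois_group S (h ` K)). \<sigma> y = y"
        obtain x where x: "x \<in> carrier R" "y = h x" using y(1) bij by (auto simp: bij_betw_def)
        have "\<tau> x = x" if t: "\<tau> \<in> carrier (galois_group R K)" for \<tau>
        proof -
          obtain \<sigma> where "\<sigma> \<in> carrier (galois_group S (h ` K))" "\<sigma> (h x) = h (\<tau> x)"
            using galois_group_transport(2)[OF R.ring_axioms S.ring_axioms h Kc t] x(1) by blast
          then have "h (\<tau> x) = h x" using y(2) x(2) by auto
          moreover have "\<tau> x \<in> carrier R"
            using t x(1) by (auto simp: galois_group_def Bij_def bij_betw_def)
          ultimately show ?thesis using inj x(1) by (auto simp: inj_on_def)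
        qed
        then show "y \<in> h ` K" using fixd x by blast
      qed
      show "h ` K \<subseteq> ?F" using Kc by (auto simp: galois_group_def)
    qed
    fix y assume "y \<in> carrier S"
    then obtain x where x: "x \<in> carrier R" "y = h x" using bij by (auto simp: bij_betw_def)
    obtain p q where pq: "p \<in> carrier (univ_poly R K)" "q \<in> carrier (univ_poly R K)" "p \<noteq> q"
      "R.eval p x = R.eval q x"
      using alg[OF x(1)] by (auto simp: R.transcendental_def inj_on_def)
    have c: "set p \<subseteq> K" if "p \<in> carrier (univ_poly R K)" for p
      using that by (auto simp: univ_poly_def polynomial_def)
    have m: "map h p \<in> carrier (univ_poly S (h ` K))" if "p \<in> carrier (univ_poly R K)" for p
    proof -
      have "h a = \<zero>\<^bsub>S\<^esub> \<longleftrightarrow> a = \<zero>\<^bsub>R\<^esub>" if "a \<in> K" for a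
        using inj that Kc z by (metis R.zero_closed inj_on_eq_iff subsetD)
      then show ?thesis
        using that by (cases p) (auto simp: univ_poly_def polynomial_def)
    qed
    have pow: "h (x [^]\<^bsub>R\<^esub> k) = h x [^]\<^bsub>S\<^esub> k" for k :: nat
      using x(1) by (induction k) auto
    have e: "S.eval (map h p) y = h (R.eval p x)" if "set p \<subseteq> K" for p
      using that x Kc
    proof (induction p)
      case (Cons a p)
      then have "a \<in> carrier R" "set p \<subseteq> carrier R" by auto
      then show ?case using Cons by (simp add: R.eval_in_carrier pow)
    qed (simp add: z)
    have "map h p \<noteq> map h q"
      using inj_on_map_eq_map[of h p q] inj c[OF pq(1)] c[OF pq(2)] Kc pq(3)
      by (meson inj_on_subset le_sup_iff subset_trans)
    then show "S.algebraic (h ` K) y"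
      unfolding S.transcendental_def inj_on_def
      using m[OF pq(1)] m[OF pq(2)] e[OF c[OF pq(1)]] e[OF c[OF pq(2)]] pq(4) by metis
  qed
qed

section \<open>Roots of unity and polynomials over an algebraically closed field\<close>

text \<open>
  If there were only finitely many elements, then \<open>1 + \<Prod>a. (x - a)\<close> would have no root.
\<close>

lemma infinite_UNIV_alg_closed: "infinite (UNIV :: 'k::alg_closed_field set)"
proof
  assume fin: "finite (UNIV :: 'k set)"
  define p :: "'k poly" where "p = 1 + (\<Prod>a\<in>UNIV. [:- a, 1:])"
  have "degree (\<Prod>a\<in>(UNIV::'k set). [:- a, 1:]) = card (UNIV :: 'k set)"
    by (subst degree_prod_eq_sum_degree) auto
  then have "degree p = card (UNIV :: 'k set)"
    unfolding p_def using fin by (subst degree_add_eq_right) (auto simp: card_gt_0_iff)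
  then have "degree p > 0" using fin by (simp add: card_gt_0_iff)
  then obtain x where "poly p x = 0" using alg_closed_imp_poly_has_root by blast
  moreover have "poly p x = 1" using fin by (auto simp: p_def poly_prod intro!: prod_zero bexI[of _ x])
  ultimately show False by simp
qed

lemma poly_eqI_cofinite:
  fixes p q :: "'k::alg_closed_field poly"
  assumes "finite E" "\<And>x. x \<notin> E \<Longrightarrow> poly p x = poly q x"
  shows "p = q"
proof (rule ccontr)
  assume "p \<noteq> q"
  then have "finite {x. poly (p - q) x = 0}" by (intro poly_roots_finite) simp
  moreover have "- E \<subseteq> {x. poly (p - q) x = 0}" using assms(2) by auto
  ultimately have "finite (- E)" using finite_subset by blast
  then show False using assms(1) infinite_UNIV_alg_closed finite_compl by blast
qed

lemma card_roots_separable: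
  fixes p :: "'k::alg_closed_field poly"
  assumes "p \<noteq> 0" "\<And>x. poly p x = 0 \<Longrightarrow> poly (pderiv p) x \<noteq> 0"
  shows "card {x. poly p x = 0} = degree p"
  using assms
proof (induction "degree p" arbitrary: p)
  case 0
  then obtain c where "p = [:c:]" "c \<noteq> 0" by (metis degree_eq_zeroE pCons_0_0)
  then show ?case by simp
next
  case (Suc n)
  then obtain a where a: "poly p a = 0" using alg_closed_imp_poly_has_root[of p] by auto
  then obtain q where q: "p = [:-a, 1:] * q" by (auto simp: poly_eq_0_iff_dvd)
  have q0: "q \<noteq> 0" using q Suc.prems(1) by auto
  have pd: "pderiv p = q + [:-a, 1:] * pderiv q"
  proof -
    have "pderiv [:-a, 1:] = 1" by (simp add: pderiv_pCons one_pCons)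
    then show ?thesis unfolding q pderiv_mult by simp
  qed
  have qa: "poly q a \<noteq> 0" using Suc.prems(2)[OF a] by (simp add: pd)
  have deg: "degree p = Suc (degree q)" unfolding q using q0 by (subst degree_mult_eq) auto
  have "poly (pderiv q) x \<noteq> 0" if "poly q x = 0" for x
  proof -
    have "poly p x = 0" using that by (simp add: q)
    then have "poly (pderiv p) x \<noteq> 0" by (rule Suc.prems(2))
    then show ?thesis using that unfolding pd by auto
  qed
  then have c: "card {x. poly q x = 0} = degree q" using Suc.hyps(1)[of q] Suc.hyps(2) deg q0 by auto
  have "{x. poly p x = 0} = insert a {x. poly q x = 0}" by (auto simp: q)
  then show ?case using qa c deg poly_roots_finite[OF q0] by simp
qed

definition unit_roots :: "nat \<Rightarrow> 'k::field set" where
  "unit_roots n = {z. z ^ n = 1}"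

lemma unit_rootsD: "z \<in> unit_roots n \<Longrightarrow> z ^ n = 1" by (simp add: unit_roots_def)

lemma unit_roots_poly: "n > 0 \<Longrightarrow> unit_roots n = {z. poly (monom 1 n - 1) z = 0}"
  by (simp add: unit_roots_def poly_monom)

lemma monom_minus_one_nz: "n > 0 \<Longrightarrow> monom 1 n - 1 \<noteq> (0 :: 'k::field poly)"
  by (metis degree_1 degree_monom_eq eq_iff_diff_eq_0 nat_neq_iff zero_neq_one)

lemma degree_monom_minus_one: "n > 0 \<Longrightarrow> degree (monom 1 n - 1 :: 'k::field poly) = n"
  by (subst diff_conv_add_uminus, subst degree_add_eq_left) (auto simp: degree_monom_eq)

lemma finite_unit_roots: "n > 0 \<Longrightarrow> finite (unit_roots n)"
  unfolding unit_roots_poly using monom_minus_one_nz by (rule poly_roots_finite)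

lemma card_unit_roots_le: "n > 0 \<Longrightarrow> card (unit_roots n :: 'k::field set) \<le> n"
  unfolding unit_roots_poly
  using card_poly_roots_bound[OF monom_minus_one_nz, of n] degree_monom_minus_one by metis

lemma card_unit_roots:
  assumes "of_nat n \<noteq> (0 :: 'k::alg_closed_field)"
  shows "card (unit_roots n :: 'k set) = n"
proof -
  have n: "n > 0" using assms by (cases n) auto
  have "poly (pderiv (monom 1 n - 1)) x \<noteq> 0" if "poly (monom 1 n - 1) x = 0" for x :: 'k
    using that assms n by (auto simp: poly_monom pderiv_diff pderiv_monom power_0_left)
  from card_roots_separable[OF monom_minus_one_nz[OF n] this] show ?thesis
    using n by (simp add: unit_roots_poly degree_monom_minus_one)
qed

lemma unit_roots_closed:
  assumes "z \<in> unit_roots n" "w \<in> unit_roots n"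
  shows "z * w \<in> unit_roots n" "inverse z \<in> unit_roots n" "z / w \<in> unit_roots n" "z ^ i \<in> unit_roots n"
proof -
  have "(z ^ i) ^ n = (z ^ n) ^ i" by (simp flip: power_mult add: mult.commute)
  then show "z ^ i \<in> unit_roots n" using assms by (simp add: unit_roots_def)
qed (use assms in \<open>auto simp: unit_roots_def power_mult_distrib power_divide power_inverse\<close>)

lemma unit_roots_one [simp]: "1 \<in> unit_roots n" by (simp add: unit_roots_def)

lemma unit_roots_nz: "n > 0 \<Longrightarrow> z \<in> unit_roots n \<Longrightarrow> z \<noteq> 0"
  by (auto simp: unit_roots_def power_0_left)

lemma bij_unit_roots_mult:
  assumes "z \<in> unit_roots n" "n > 0"
  shows "bij_betw ((*) z) (unit_roots n) (unit_roots n)"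
  by (rule bij_betw_byWitness[where f' = "(*) (inverse z)"])
    (use assms unit_roots_nz[OF assms(2,1)] in \<open>auto simp: unit_roots_closed\<close>)

lemma bij_unit_roots_inverse: "bij_betw inverse (unit_roots n) (unit_roots n :: 'k::field set)"
  by (rule bij_betw_byWitness[where f' = inverse]) (auto simp: unit_roots_closed)

text \<open>
  The solutions of \<open>x ^ Q = x\<close> form a finite field, whose multiplicative group is cyclic of order
  \<open>Q - 1\<close>. Hence the \<open>n\<close>-th roots of unity form a cyclic group for each \<open>n\<close> that divides \<open>Q - 1\<close>.
\<close>

lemma primitive_unit_root_exists:
  assumes p: "prime CHAR('k::alg_closed_field)" and Q: "Q = CHAR('k::alg_closed_field) ^ e" "e > 0" and n: "n dvd Q - 1"
  obtains z :: "'k::alg_closed_field" where "z ^ n = 1" "inj_on (\<lambda>i. z ^ i) {..<n}" "unit_roots n = (\<lambda>i. z ^ i) ` {..<n}"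
proof -
  define S where "S = {x::'k. x ^ Q = x}"
  have Q1: "Q > 1" unfolding Q(1) using p Q(2) by (intro one_less_power prime_gt_1_nat)
  have Qc: "of_nat Q = (0::'k)" unfolding of_nat_eq_0_iff_char_dvd using Q by simp
  have cardS: "card S = Q" and finS: "finite S"
  proof -
    define f :: "'k poly" where "f = monom 1 Q - [:0, 1:]"
    have S: "S = {x. poly f x = 0}" by (simp add: S_def f_def poly_monom)
    have deg: "degree f = Q" unfolding f_def using Q1
      by (subst diff_conv_add_uminus, subst degree_add_eq_left) (auto simp: degree_monom_eq)
    then have f0: "f \<noteq> 0" using Q1 by auto
    have "poly (pderiv f) x \<noteq> 0" for x
      by (simp add: f_def pderiv_diff pderiv_monom pderiv_pCons poly_monom Qc)
    then show "card S = Q" using card_roots_separable[OF f0] S deg by auto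
    show "finite S" unfolding S using f0 by (rule poly_roots_finite)
  qed
  have sum: "(x + y) ^ Q = x ^ Q + y ^ Q" for x y :: 'k
    by (rule freshmans_dream'[OF p Q(1)])
  have minus: "(- x) ^ Q = - (x ^ Q)" for x :: 'k
    using sum[of x "- x"] Q1 by (simp add: power_0_left eq_neg_iff_add_eq_0 add.commute)
  have sf: "subfield S (ring_of_type_algebra :: 'k ring)"
    by (rule subfield_of_type_algebraI) (auto simp: S_def sum minus power_mult_distrib power_inverse)
  interpret K: field "ring_of_type_algebra :: 'k ring" by (rule field_from_type_algebra)
  let ?R = "ring_of_type_algebra\<lparr>carrier := S\<rparr> :: 'k ring"
  interpret R: field ?R using K.subfield_iff(2)[OF sf] .
  obtain a where a: "a \<in> carrier (mult_of ?R)" "carrier (mult_of ?R) = {a [^]\<^bsub>?R\<^esub> i | i::nat. i \<in> UNIV}"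
    using R.finite_field_mult_group_has_gen finS by auto
  have pow: "a [^]\<^bsub>?R\<^esub> (i::nat) = a ^ i" for i
    by (induction i) (auto simp: nat_pow_def mult.commute)
  have S0: "S - {0} = range (\<lambda>i. a ^ i)" and aS: "a ^ Q = a" "a \<noteq> 0"
    using a unfolding pow full_SetCompr_eq by (auto simp: S_def)
  have a1: "a ^ (Q - 1) = 1" using aS Q1 by (metis One_nat_def Suc_pred less_trans mult_cancel_left2 power_Suc zero_less_one)
  have a_mod: "a ^ i = a ^ (i mod (Q - 1))" for i
  proof -
    have "a ^ i = a ^ ((Q - 1) * (i div (Q - 1)) + i mod (Q - 1))" by simp
    also have "\<dots> = a ^ (i mod (Q - 1))" by (simp only: power_add power_mult a1) simp
    finally show ?thesis .
  qed
  have "S - {0} = (\<lambda>i. a ^ i) ` {..<Q - 1}"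
    unfolding S0 using a_mod Q1 by (auto simp: image_iff) (metis lessThan_iff mod_less_divisor zero_less_diff)
  moreover have "card (S - {0}) = Q - 1"
    using cardS finS Q1 by (subst card_Diff_singleton) (auto simp: S_def power_0_left)
  ultimately have inj: "inj_on (\<lambda>i. a ^ i) {..<Q - 1}"
    by (intro eq_card_imp_inj_on) auto
  obtain m where m: "Q - 1 = n * m" using n by blast
  have n0: "n > 0" and m0: "m > 0" using m Q1 by (auto intro!: Nat.gr0I)
  define z where "z = a ^ m"
  have z1: "z ^ n = 1" unfolding z_def using a1 m by (simp flip: power_mult add: mult.commute)
  have zinj: "inj_on (\<lambda>i. z ^ i) {..<n}"
  proof (rule inj_onI)
    fix i j assume ij: "i \<in> {..<n}" "j \<in> {..<n}" "z ^ i = z ^ j"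
    have "a ^ (m * i) = a ^ (m * j)" using ij(3) by (simp add: z_def power_mult)
    moreover have "m * i < Q - 1" "m * j < Q - 1"
      using ij m0 unfolding m by (simp_all add: mult.commute[of n])
    ultimately have "m * i = m * j" using inj_onD[OF inj] by (metis lessThan_iff)
    then show "i = j" using m0 by simp
  qed
  have "(\<lambda>i. z ^ i) ` {..<n} = unit_roots n"
  proof (rule card_seteq)
    show "finite (unit_roots n :: 'k set)" using n0 by (rule finite_unit_roots)
    show "(\<lambda>i. z ^ i) ` {..<n} \<subseteq> unit_roots n"
      using z1 unit_roots_closed(4)[of z n z] by (auto simp: unit_roots_def)
    show "card (unit_roots n :: 'k set) \<le> card ((\<lambda>i. z ^ i) ` {..<n})"
      using card_unit_roots_le[OF n0] zinj by (simp add: card_image)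
  qed
  then show ?thesis using that z1 zinj by blast
qed

section \<open>Substitutions in the rational function field\<close>

abbreviation ratfun_const :: "'k::field \<Rightarrow> 'k poly fract" where
  "ratfun_const c \<equiv> Fract [:c:] 1"

abbreviation ratfun_X :: "'k::field poly fract" where
  "ratfun_X \<equiv> Fract [:0, 1:] 1"

definition ratfun_eval :: "'k::field poly fract \<Rightarrow> 'k poly \<Rightarrow> 'k poly fract" where
  "ratfun_eval r p = poly (map_poly ratfun_const p) r"

lemma Fract_0 [simp]: "Fract 0 b = 0"
  by (cases "b = 0") (auto simp: Zero_fract_def eq_fract)

lemma ratfun_const_eq [simp]: "ratfun_const a = ratfun_const b \<longleftrightarrow> a = b" by (simp add: eq_fract)

lemma Fract_eq_0_iff: "b \<noteq> 0 \<Longrightarrow> Fract a b = 0 \<longleftrightarrow> a = 0"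
  using eq_fract(1)[of b 1 a 0] by (simp add: fract_collapse)

lemma ratfun_eval_0 [simp]: "ratfun_eval r 0 = 0" by (simp add: ratfun_eval_def)

lemma ratfun_eval_pCons [simp]: "ratfun_eval r (pCons a p) = ratfun_const a + r * ratfun_eval r p"
  by (simp add: ratfun_eval_def map_poly_pCons)

lemma ratfun_eval_1 [simp]: "ratfun_eval r 1 = 1"
  using ratfun_eval_pCons[of r 1 0] by (simp add: One_fract_def flip: one_pCons)

lemma ratfun_eval_add [simp]: "ratfun_eval r (p + q) = ratfun_eval r p + ratfun_eval r q"
proof (induction p q rule: poly_induct2)
  case (pCons a p b q)
  have "ratfun_const (a + b) = ratfun_const a + ratfun_const b" by simp
  then show ?case using pCons by (simp add: algebra_simps del: add_fract)
qed simp

lemma ratfun_eval_smult [simp]: "ratfun_eval r (smult a q) = ratfun_const a * ratfun_eval r q"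
proof (induction q)
  case (pCons b q)
  have "ratfun_const (a * b) = ratfun_const a * ratfun_const b" by simp
  then show ?case using pCons by (simp add: algebra_simps del: mult_fract add_fract)
qed simp

lemma ratfun_eval_mult [simp]: "ratfun_eval r (p * q) = ratfun_eval r p * ratfun_eval r q"
  by (induction p) (auto simp: algebra_simps)

lemma ratfun_eval_X: "ratfun_eval ratfun_X p = Fract p 1"
proof (induction p)
  case (pCons a p)
  then show ?case by simp
qed simp

text \<open>
  Over an algebraically closed field, an element algebraic over the constants is a constant: it is a root of
  a product of linear factors.
\<close>

lemma ratfun_eval_nonzero:
  fixes r :: "'k::alg_closed_field poly fract"
  assumes "r \<notin> range ratfun_const" "p \<noteq> 0"
  shows "ratfun_eval r p \<noteq> 0"
  using assms(2)
proof (induction "degree p" arbitrary: p)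
  case 0
  then obtain c where "p = [:c:]" "c \<noteq> 0" by (metis degree_eq_zeroE pCons_0_0)
  then show ?case by (simp add: Fract_eq_0_iff)
next
  case (Suc n)
  then obtain a where "poly p a = 0" using alg_closed_imp_poly_has_root[of p] by auto
  then obtain q where q: "p = [:-a, 1:] * q" by (auto simp: poly_eq_0_iff_dvd)
  then have q0: "q \<noteq> 0" using Suc.prems by auto
  have "degree p = Suc (degree q)" unfolding q using q0 by (subst degree_mult_eq) auto
  then have "ratfun_eval r q \<noteq> 0" using Suc q0 by auto
  moreover have "ratfun_const (- a) + r \<noteq> 0"
  proof
    assume "ratfun_const (- a) + r = 0"
    then have "r = ratfun_const a" by (simp add: eq_neg_iff_add_eq_0[symmetric] add.commute)
    then show False using assms(1) by blast
  qed
  ultimately show ?case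
    by (simp add: q One_fract_def[symmetric] one_pCons[symmetric] del: mult_pCons_left mult_pCons_right)
qed

text \<open>
  The choice of the fraction that represents the argument does not matter as long as \<open>r\<close> is not a constant
  (\<open>ratfun_subst_Fract\<close>).
\<close>

definition ratfun_subst :: "'k::alg_closed_field poly fract \<Rightarrow> 'k poly fract \<Rightarrow> 'k poly fract" where
  "ratfun_subst r z = (SOME w. \<exists>a b. b \<noteq> 0 \<and> z = Fract a b \<and> w = ratfun_eval r a / ratfun_eval r b)"

lemma ratfun_subst_Fract:
  fixes r :: "'k::alg_closed_field poly fract"
  assumes r: "r \<notin> range ratfun_const" and b: "b \<noteq> 0"
  shows "ratfun_subst r (Fract a b) = ratfun_eval r a / ratfun_eval r b"
proof -
  have "\<exists>a' b'. b' \<noteq> 0 \<and> Fract a b = Fract a' b' \<and> ratfun_subst r (Fract a b) = ratfun_eval r a' / ratfun_eval r b'"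
    unfolding ratfun_subst_def by (rule someI_ex) (use b in blast)
  then obtain a' b' where ab: "b' \<noteq> 0" "Fract a b = Fract a' b'"
    "ratfun_subst r (Fract a b) = ratfun_eval r a' / ratfun_eval r b'" by blast
  have "a * b' = a' * b" using ab(1,2) b by (simp add: eq_fract)
  then have "ratfun_eval r a * ratfun_eval r b' = ratfun_eval r a' * ratfun_eval r b"
    by (metis ratfun_eval_mult)
  then show ?thesis using ab(3) ratfun_eval_nonzero[OF r] b ab(1) by (simp add: frac_eq_eq)
qed

lemma ratfun_subst_hom:
  fixes r :: "'k::alg_closed_field poly fract"
  assumes r: "r \<notin> range ratfun_const"
  shows "ratfun_subst r (x + y) = ratfun_subst r x + ratfun_subst r y"
    "ratfun_subst r (x * y) = ratfun_subst r x * ratfun_subst r y"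
    "ratfun_subst r (ratfun_const c) = ratfun_const c" "ratfun_subst r ratfun_X = r"
proof -
  obtain a b where x: "x = Fract a b" "b \<noteq> 0" by (cases x)
  obtain c d where y: "y = Fract c d" "d \<noteq> 0" by (cases y)
  note nz = ratfun_eval_nonzero[OF r]
  show "ratfun_subst r (x + y) = ratfun_subst r x + ratfun_subst r y"
    using x(2) y(2) nz[of b] nz[of d] by (simp add: x(1) y(1) ratfun_subst_Fract[OF r] add_frac_eq)
  show "ratfun_subst r (x * y) = ratfun_subst r x * ratfun_subst r y"
    using x(2) y(2) by (simp add: x(1) y(1) ratfun_subst_Fract[OF r])
qed (simp_all add: ratfun_subst_Fract[OF r] One_fract_def[symmetric] one_pCons[symmetric])

lemma ratfun_hom_eq_subst:
  fixes \<phi> :: "'k::alg_closed_field poly fract \<Rightarrow> 'k poly fract"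
  assumes add: "\<And>x y. \<phi> (x + y) = \<phi> x + \<phi> y" and mult: "\<And>x y. \<phi> (x * y) = \<phi> x * \<phi> y"
    and const: "\<And>c. \<phi> (ratfun_const c) = ratfun_const c" and r: "\<phi> ratfun_X = r" "r \<notin> range ratfun_const"
  shows "\<phi> = ratfun_subst r"
proof
  fix z :: "'k poly fract"
  obtain a b where z: "z = Fract a b" "b \<noteq> 0" by (cases z)
  have *: "\<phi> (Fract p 1) = ratfun_eval r p" for p
  proof -
    have "\<phi> (ratfun_eval ratfun_X p) = ratfun_eval r p"
    proof (induction p)
      case 0
      show ?case using const[of 0] by simp
    next
      case (pCons a p)
      then show ?case by (simp add: add mult const r del: mult_fract add_fract)
    qed
    then show ?thesis by (simp add: ratfun_eval_X)
  qed
  have "z * Fract b 1 = Fract a 1" using z by (simp add: eq_fract)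
  then have "\<phi> (z * Fract b 1) = \<phi> (Fract a 1)" by (rule arg_cong)
  then have "\<phi> z * ratfun_eval r b = ratfun_eval r a" by (simp add: mult *)
  then show "\<phi> z = ratfun_subst r z"
    using ratfun_eval_nonzero[OF r(2) z(2)] unfolding z(1)
    by (simp add: ratfun_subst_Fract[OF r(2) z(2)] field_simps)
qed

lemma ratfun_subst_X: "ratfun_subst ratfun_X = (id :: 'k::alg_closed_field poly fract \<Rightarrow> _)"
  by (rule ratfun_hom_eq_subst[symmetric]) (auto simp: eq_fract)

lemma ratfun_subst_comp:
  fixes r s :: "'k::alg_closed_field poly fract"
  assumes "r \<notin> range ratfun_const" "s \<notin> range ratfun_const" "ratfun_subst r s \<notin> range ratfun_const"
  shows "ratfun_subst r \<circ> ratfun_subst s = ratfun_subst (ratfun_subst r s)"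
  by (rule ratfun_hom_eq_subst) (use assms in \<open>auto simp: ratfun_subst_hom simp del: mult_fract add_fract\<close>)

section \<open>Polynomials invariant under a dihedral group\<close>

definition poly_reverse :: "nat \<Rightarrow> 'k::field poly \<Rightarrow> 'k poly" where
  "poly_reverse w p = (\<Sum>i\<le>w. monom (coeff p i) (w - i))"

lemma poly_extend_sum:
  fixes p :: "'k::comm_semiring_1 poly"
  assumes "degree p \<le> w" shows "poly p y = (\<Sum>i\<le>w. coeff p i * y ^ i)"
  unfolding poly_altdef
  by (rule sum.mono_neutral_left) (use assms in \<open>auto simp: coeff_eq_0\<close>)

lemma poly_poly_reverse:
  fixes p :: "'k::field poly"
  assumes "degree p \<le> w" "y \<noteq> 0"
  shows "poly (poly_reverse w p) y = y ^ w * poly p (1 / y)"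
proof -
  have "y ^ (w - i) = y ^ w * (1 / y) ^ i" if "i \<le> w" for i
    using assms(2) that by (simp add: power_diff power_divide)
  then show ?thesis
    unfolding poly_reverse_def poly_extend_sum[OF assms(1), of "1 / y"]
    by (simp add: poly_sum poly_monom sum_distrib_left mult_ac)
qed

text \<open>
  The polynomial \<open>y ^ deg g * g (1/y)\<close> has degree at most \<open>deg g\<close>, while \<open>y ^ deg g * g y\<close> has degree
  \<open>2 * deg g\<close>.
\<close>

lemma degree_zero_if_reciprocal:
  fixes g :: "'k::alg_closed_field poly"
  assumes "\<And>y. y \<noteq> 0 \<Longrightarrow> poly g (1 / y) = poly g y"
  shows "degree g = 0"
proof (cases "g = 0")
  case False
  have "poly_reverse (degree g) g = monom 1 (degree g) * g"
    by (rule poly_eqI_cofinite[of "{0}"]) (auto simp: poly_poly_reverse poly_monom assms)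
  moreover have "degree (poly_reverse (degree g) g) \<le> degree g"
    unfolding poly_reverse_def
    by (rule degree_sum_le) (auto intro: order.trans[OF degree_monom_le])
  moreover have "degree (monom 1 (degree g) * g) = degree g + degree g"
    using False by (subst degree_mult_eq) (auto simp: degree_monom_eq)
  ultimately show ?thesis by simp
qed simp

text \<open>
  The lowest exponent \<open>r\<close> of \<open>g\<close> satisfies \<open>\<zeta> ^ r = 1\<close> for all \<open>n\<close>-th roots of unity, which forces
  \<open>n \<le> r\<close> when there are \<open>n\<close> of them.
\<close>

lemma rotation_invariant_root_zero:
  fixes g :: "'k::alg_closed_field poly"
  assumes card: "card (unit_roots n :: 'k set) = n"
    and rot: "\<And>\<zeta> y. \<zeta> \<in> unit_roots n \<Longrightarrow> poly g (\<zeta> * y) = poly g y" and g0: "poly g 0 = 0"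
  shows "\<exists>h. g = monom 1 n * h"
proof (cases "g = 0")
  case False
  define r where "r = order 0 g"
  have r: "r > 0" using g0 False by (simp add: r_def order_gt_0_iff)
  obtain h where h: "g = [:- 0, 1:] ^ r * h" "\<not> [:- 0, 1:] dvd h"
    using order_decomp[OF False, of 0] unfolding r_def by blast
  have gm: "g = monom 1 r * h" using h(1) by (simp add: monom_altdef)
  have h0: "poly h 0 \<noteq> 0" using h(2) by (simp add: poly_eq_0_iff_dvd)
  have "unit_roots n \<subseteq> (unit_roots r :: 'k set)"
  proof
    fix \<zeta> :: 'k assume z: "\<zeta> \<in> unit_roots n"
    have "smult (\<zeta> ^ r) (pcompose h [:0, \<zeta>:]) = h"
    proof (rule poly_eqI_cofinite[of "{0}"])
      fix y :: 'k assume "y \<notin> {0}"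
      then show "poly (smult (\<zeta> ^ r) (pcompose h [:0, \<zeta>:])) y = poly h y"
        using rot[OF z, of y] by (simp add: gm poly_monom poly_pcompose power_mult_distrib mult_ac)
    qed simp
    then have "\<zeta> ^ r * poly h 0 = poly h 0"
      by (metis mult_zero_right poly_0_coeff_0 poly_pCons poly_pcompose poly_smult add_0 mult_zero_left)
    then show "\<zeta> \<in> unit_roots r" using h0 by (simp add: unit_roots_def)
  qed
  then have "card (unit_roots n :: 'k set) \<le> card (unit_roots r :: 'k set)"
    by (intro card_mono finite_unit_roots r)
  then have "n \<le> r" using card card_unit_roots_le[OF r, where 'k = 'k] by linarith
  then have "g = monom 1 n * (monom 1 (r - n) * h)"
    by (simp add: gm mult_monom flip: mult.assoc)
  then show ?thesis by blast
qed auto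

abbreviation dihedral_form :: "nat \<Rightarrow> (nat \<Rightarrow> 'k::field) \<Rightarrow> nat \<Rightarrow> 'k \<Rightarrow> 'k" where
  "dihedral_form n c j y \<equiv> (\<Sum>l\<le>j. c l * (y ^ n) ^ l * (1 + y ^ (2 * n)) ^ (j - l))"

text \<open>
  A form of degree \<open>2nj\<close> in \<open>u, v\<close> that is invariant under \<open>(u, v) \<mapsto> (u, \<zeta> v)\<close> and \<open>(u, v) \<mapsto> (v, u)\<close>
  is a form of degree \<open>j\<close> in \<open>u\<^sup>n v\<^sup>n\<close> and \<open>u\<^sup>2\<^sup>n + v\<^sup>2\<^sup>n\<close>; here \<open>u = 1\<close>. Subtracting a multiple of
  \<open>(u\<^sup>2\<^sup>n + v\<^sup>2\<^sup>n) ^ j\<close> makes the form divisible by \<open>u\<^sup>n v\<^sup>n\<close>.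
\<close>

lemma dihedral_invariant_poly:
  fixes g :: "'k::alg_closed_field poly"
  assumes n: "n > 0" and card: "card (unit_roots n :: 'k set) = n"
    and "\<And>\<zeta> y. \<zeta> \<in> unit_roots n \<Longrightarrow> poly g (\<zeta> * y) = poly g y"
    and "\<And>y. y \<noteq> 0 \<Longrightarrow> y ^ (2 * n * j) * poly g (1 / y) = poly g y"
  shows "\<exists>c. \<forall>y. poly g y = dihedral_form n c j y"
  using assms(3,4)
proof (induction j arbitrary: g)
  case 0
  then have "degree g = 0" by (intro degree_zero_if_reciprocal) auto
  then obtain c where "g = [:c:]" by (auto elim: degree_eq_zeroE)
  then show ?case by (intro exI[of _ "\<lambda>_. c"]) auto
next
  case (Suc j)
  define c where "c = poly g 0"
  define h where "h = g - smult c ((1 + monom 1 (2 * n)) ^ Suc j)"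
  have ph: "poly h y = poly g y - c * (1 + y ^ (2 * n)) ^ Suc j" for y
    by (simp add: h_def poly_monom poly_power)
  have zn: "\<zeta> ^ n = 1" "\<zeta> ^ (2 * n) = 1" if "\<zeta> \<in> unit_roots n" for \<zeta> :: 'k
    using unit_rootsD[OF that] by (auto simp: power_mult mult.commute[of 2])
  have "poly h 0 = 0" using n by (simp add: ph c_def power_0_left)
  moreover have "poly h (\<zeta> * y) = poly h y" if "\<zeta> \<in> unit_roots n" for \<zeta> y
    using Suc.prems(1)[OF that] zn[OF that] by (simp add: ph power_mult_distrib)
  ultimately obtain h' where h': "h = monom 1 n * h'"
    using rotation_invariant_root_zero[OF card, of h] by blast
  have ph': "poly h y = y ^ n * poly h' y" for y by (simp add: h' poly_monom)
  have hr: "y ^ (2 * n * Suc j) * poly h (1 / y) = poly h y" if "y \<noteq> 0" for y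
  proof -
    have "y ^ (2 * n * Suc j) * (1 + (1 / y) ^ (2 * n)) ^ Suc j = (y ^ (2 * n) * (1 + (1 / y) ^ (2 * n))) ^ Suc j"
      by (simp only: power_mult power_mult_distrib)
    also have "\<dots> = (1 + y ^ (2 * n)) ^ Suc j" using that by (simp add: algebra_simps power_divide)
    finally show ?thesis
      using Suc.prems(2)[OF that] unfolding ph by (simp only: right_diff_distrib mult.left_commute[of _ c])
  qed
  obtain d where d: "\<And>y. poly h' y = dihedral_form n d j y"
  proof -
    have "poly h' (\<zeta> * y) = poly h' y" if z: "\<zeta> \<in> unit_roots n" for \<zeta> y
    proof (cases "y = 0")
      case False
      have "poly h (\<zeta> * y) = poly h y"
        using Suc.prems(1)[OF z] zn[OF z] by (simp add: ph power_mult_distrib)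
      then show ?thesis using False by (simp add: ph' power_mult_distrib zn[OF z])
    qed simp
    moreover have "y ^ (2 * n * j) * poly h' (1 / y) = poly h' y" if "y \<noteq> 0" for y
    proof -
      have "y ^ (2 * n * Suc j) = y ^ n * y ^ n * y ^ (2 * n * j)"
        by (simp add: mult_2 flip: power_add)
      then show ?thesis using hr[OF that] that by (simp add: ph' power_divide field_simps)
    qed
    ultimately show ?thesis using Suc.IH[of h'] that by blast
  qed
  have "poly g y = (\<Sum>l\<le>Suc j. (case l of 0 \<Rightarrow> c | Suc l' \<Rightarrow> d l') * (y ^ n) ^ l * (1 + y ^ (2 * n)) ^ (Suc j - l))" for y
  proof -
    have "poly g y = c * (1 + y ^ (2 * n)) ^ Suc j + y ^ n * poly h' y"
      using ph[of y] ph'[of y] by (simp add: algebra_simps)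
    also have "\<dots> = (\<Sum>l\<le>Suc j. (case l of 0 \<Rightarrow> c | Suc l' \<Rightarrow> d l') * (y ^ n) ^ l * (1 + y ^ (2 * n)) ^ (Suc j - l))"
      unfolding sum.atMost_Suc_shift by (simp add: d sum_distrib_left mult_ac)
    finally show ?thesis .
  qed
  then show ?case by blast
qed

section \<open>The dihedral group acting on the rational function field\<close>

abbreviation ratfun_rot :: "'k::alg_closed_field \<Rightarrow> 'k poly fract \<Rightarrow> 'k poly fract" where
  "ratfun_rot \<zeta> \<equiv> ratfun_subst (ratfun_const \<zeta> * ratfun_X)"

abbreviation ratfun_refl :: "'k::alg_closed_field \<Rightarrow> 'k poly fract \<Rightarrow> 'k poly fract" where
  "ratfun_refl \<zeta> \<equiv> ratfun_subst (ratfun_const \<zeta> / ratfun_X)"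

definition ratfun_dihedral :: "nat \<Rightarrow> ('k::alg_closed_field poly fract \<Rightarrow> 'k poly fract) set" where
  "ratfun_dihedral n = ratfun_rot ` unit_roots n \<union> ratfun_refl ` unit_roots n"

lemma ratfun_X_nz [simp]: "ratfun_X \<noteq> 0"
  by (simp add: Fract_eq_0_iff)

lemma ratfun_const_eq_0_iff: "ratfun_const c = 0 \<longleftrightarrow> c = 0"
  by (simp add: Fract_eq_0_iff)

lemma ratfun_const_ops:
  "ratfun_const (a * b) = ratfun_const a * ratfun_const b"
  "ratfun_const (a / b) = ratfun_const a / ratfun_const (b::'k::field)"
  "ratfun_const 1 = (1 :: 'k poly fract)"
  "ratfun_const (a ^ i) = ratfun_const a ^ i"
proof -
  show *: "ratfun_const (a * b) = ratfun_const a * ratfun_const b" for a b :: 'k by simp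
  show o: "ratfun_const 1 = (1 :: 'k poly fract)" by (simp add: One_fract_def one_pCons)
  show "ratfun_const (a ^ i) = ratfun_const a ^ i"
    by (induction i) (auto simp only: * o power.simps)
  show "ratfun_const (a / b) = ratfun_const a / ratfun_const b"
  proof (cases "b = 0")
    case False
    then have "ratfun_const (a / b) * ratfun_const b = ratfun_const a" by simp
    then show ?thesis using False by (simp add: ratfun_const_eq_0_iff nonzero_eq_divide_eq del: mult_fract divide_fract)
  qed simp
qed

lemma ratfun_rot_nonconst: "\<zeta> \<noteq> 0 \<Longrightarrow> ratfun_const \<zeta> * ratfun_X \<notin> range ratfun_const"
  by (auto simp: eq_fract)

lemma ratfun_refl_nonconst: "\<zeta> \<noteq> 0 \<Longrightarrow> ratfun_const \<zeta> / ratfun_X \<notin> range ratfun_const"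
  by (auto simp: eq_fract)

lemma ratfun_rot_refl_apply:
  assumes "\<zeta> \<noteq> 0"
  shows "ratfun_rot \<zeta> (ratfun_const \<xi> * ratfun_X) = ratfun_const (\<zeta> * \<xi>) * ratfun_X"
    "ratfun_rot \<zeta> (ratfun_const \<xi> / ratfun_X) = ratfun_const (\<xi> / \<zeta>) / ratfun_X"
    "ratfun_refl \<zeta> (ratfun_const \<xi> * ratfun_X) = ratfun_const (\<xi> * \<zeta>) / ratfun_X"
    "ratfun_refl \<zeta> (ratfun_const \<xi> / ratfun_X) = ratfun_const (\<xi> / \<zeta>) * ratfun_X"
proof -
  have dv: "ratfun_subst r (x / y) = ratfun_subst r x / ratfun_subst r y"
    if "r \<notin> range ratfun_const" "y \<noteq> 0" "ratfun_subst r y \<noteq> 0" for r x y :: "'a poly fract"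
    using ratfun_subst_hom(2)[OF that(1), of "x / y" y] that(2,3)
    by (simp add: nonzero_eq_divide_eq)
  note rt = ratfun_rot_nonconst[OF assms] and rf = ratfun_refl_nonconst[OF assms]
  have nz: "ratfun_const \<zeta> \<noteq> 0" using assms by (simp add: ratfun_const_eq_0_iff)
  note [simp del] = mult_fract divide_fract
  show "ratfun_rot \<zeta> (ratfun_const \<xi> * ratfun_X) = ratfun_const (\<zeta> * \<xi>) * ratfun_X"
    by (simp add: ratfun_subst_hom[OF rt] ratfun_const_ops mult_ac)
  show "ratfun_rot \<zeta> (ratfun_const \<xi> / ratfun_X) = ratfun_const (\<xi> / \<zeta>) / ratfun_X"
    using nz by (subst dv[OF rt]) (auto simp add: ratfun_subst_hom[OF rt] ratfun_const_ops)
  show "ratfun_refl \<zeta> (ratfun_const \<xi> * ratfun_X) = ratfun_const (\<xi> * \<zeta>) / ratfun_X"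
    by (simp add: ratfun_subst_hom[OF rf] ratfun_const_ops)
  show "ratfun_refl \<zeta> (ratfun_const \<xi> / ratfun_X) = ratfun_const (\<xi> / \<zeta>) * ratfun_X"
    using nz by (subst dv[OF rf]) (auto simp add: ratfun_subst_hom[OF rf] ratfun_const_ops)
qed

lemma ratfun_dihedral_comp:
  fixes \<zeta> \<xi> :: "'k::alg_closed_field"
  assumes "\<zeta> \<noteq> 0" "\<xi> \<noteq> 0"
  shows "ratfun_rot \<zeta> \<circ> ratfun_rot \<xi> = ratfun_rot (\<zeta> * \<xi>)"
    "ratfun_rot \<zeta> \<circ> ratfun_refl \<xi> = ratfun_refl (\<xi> / \<zeta>)"
    "ratfun_refl \<zeta> \<circ> ratfun_rot \<xi> = ratfun_refl (\<xi> * \<zeta>)"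
    "ratfun_refl \<zeta> \<circ> ratfun_refl \<xi> = ratfun_rot (\<xi> / \<zeta>)"
proof -
  note nc = ratfun_rot_nonconst ratfun_refl_nonconst
  have p: "\<xi> / \<zeta> \<noteq> 0" "\<xi> * \<zeta> \<noteq> 0" "\<zeta> * \<xi> \<noteq> 0" using assms by auto
  note [simp del] = mult_fract divide_fract
  show "ratfun_rot \<zeta> \<circ> ratfun_rot \<xi> = ratfun_rot (\<zeta> * \<xi>)"
    using ratfun_subst_comp[OF nc(1)[OF assms(1)] nc(1)[OF assms(2)]] nc(1)[OF p(3)]
    unfolding ratfun_rot_refl_apply[OF assms(1)] by blast
  show "ratfun_rot \<zeta> \<circ> ratfun_refl \<xi> = ratfun_refl (\<xi> / \<zeta>)"
    using ratfun_subst_comp[OF nc(1)[OF assms(1)] nc(2)[OF assms(2)]] nc(2)[OF p(1)]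
    unfolding ratfun_rot_refl_apply[OF assms(1)] by blast
  show "ratfun_refl \<zeta> \<circ> ratfun_rot \<xi> = ratfun_refl (\<xi> * \<zeta>)"
    using ratfun_subst_comp[OF nc(2)[OF assms(1)] nc(1)[OF assms(2)]] nc(2)[OF p(2)]
    unfolding ratfun_rot_refl_apply[OF assms(1)] by blast
  show "ratfun_refl \<zeta> \<circ> ratfun_refl \<xi> = ratfun_rot (\<xi> / \<zeta>)"
    using ratfun_subst_comp[OF nc(2)[OF assms(1)] nc(2)[OF assms(2)]] nc(1)[OF p(1)]
    unfolding ratfun_rot_refl_apply[OF assms(1)] by blast
qed

lemma ratfun_rot_1: "ratfun_rot 1 = (id :: 'k::alg_closed_field poly fract \<Rightarrow> _)"
  using ratfun_subst_X by simp

lemma ratfun_dihedral_automorphism: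
  assumes n: "n > 0" and s: "\<sigma> \<in> ratfun_dihedral n"
  shows "field_automorphism \<sigma>"
proof -
  have inv: "field_automorphism (ratfun_subst r)"
    if "r \<notin> range ratfun_const" "ratfun_subst r \<circ> \<tau> = id" "\<tau> \<circ> ratfun_subst r = id"
    for r and \<tau> :: "'a poly fract \<Rightarrow> 'a poly fract"
    unfolding field_automorphism_def using that ratfun_subst_hom[OF that(1)] o_bij by blast
  consider \<zeta> where "\<zeta> \<in> unit_roots n" "\<sigma> = ratfun_rot \<zeta>"
    | \<zeta> where "\<zeta> \<in> unit_roots n" "\<sigma> = ratfun_refl \<zeta>"
    using s by (auto simp: ratfun_dihedral_def)
  then show ?thesis
  proof cases
    case 1
    then have z: "\<zeta> \<noteq> 0" using n unit_roots_nz by blast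
    have "ratfun_rot \<zeta> \<circ> ratfun_rot (inverse \<zeta>) = id" "ratfun_rot (inverse \<zeta>) \<circ> ratfun_rot \<zeta> = id"
      using z ratfun_dihedral_comp(1)[of \<zeta> "inverse \<zeta>"] ratfun_dihedral_comp(1)[of "inverse \<zeta>" \<zeta>] ratfun_rot_1
      by (auto simp del: mult_fract)
    then show ?thesis unfolding 1(2) by (rule inv[OF ratfun_rot_nonconst[OF z]])
  next
    case 2
    then have z: "\<zeta> \<noteq> 0" using n unit_roots_nz by blast
    have "ratfun_refl \<zeta> \<circ> ratfun_refl \<zeta> = id"
      using z ratfun_dihedral_comp(4)[of \<zeta> \<zeta>] ratfun_rot_1 by (simp del: mult_fract divide_fract)
    then show ?thesis unfolding 2(2) using inv[OF ratfun_refl_nonconst[OF z]] by blast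
  qed
qed

lemma ratfun_dihedral_closed:
  assumes "n > 0" "\<sigma> \<in> ratfun_dihedral n" "\<tau> \<in> ratfun_dihedral n"
  shows "\<sigma> \<circ> \<tau> \<in> ratfun_dihedral n"
proof -
  have i: "ratfun_rot \<zeta> \<in> ratfun_dihedral n" "ratfun_refl \<zeta> \<in> ratfun_dihedral n"
    if "\<zeta> \<in> unit_roots n" for \<zeta> :: 'a using that by (auto simp only: ratfun_dihedral_def)
  have *: "ratfun_rot \<zeta> \<circ> ratfun_rot \<xi> \<in> ratfun_dihedral n" "ratfun_rot \<zeta> \<circ> ratfun_refl \<xi> \<in> ratfun_dihedral n"
    "ratfun_refl \<zeta> \<circ> ratfun_rot \<xi> \<in> ratfun_dihedral n" "ratfun_refl \<zeta> \<circ> ratfun_refl \<xi> \<in> ratfun_dihedral n"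
    if z: "\<zeta> \<in> unit_roots n" "\<xi> \<in> unit_roots n" for \<zeta> \<xi> :: 'a
    unfolding ratfun_dihedral_comp[OF z[THEN unit_roots_nz[OF assms(1)]]]
    by (intro i unit_roots_closed z)+
  have ex: "\<exists>\<zeta>\<in>unit_roots n. \<rho> = ratfun_rot \<zeta> \<or> \<rho> = ratfun_refl \<zeta>"
    if "\<rho> \<in> ratfun_dihedral n" for \<rho> :: "'a poly fract \<Rightarrow> 'a poly fract"
    using that unfolding ratfun_dihedral_def by blast
  obtain \<zeta> where z: "\<zeta> \<in> unit_roots n" "\<sigma> = ratfun_rot \<zeta> \<or> \<sigma> = ratfun_refl \<zeta>"
    using ex[OF assms(2)] by blast
  obtain \<xi> where x: "\<xi> \<in> unit_roots n" "\<tau> = ratfun_rot \<xi> \<or> \<tau> = ratfun_refl \<xi>"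
    using ex[OF assms(3)] by blast
  show ?thesis using *[OF z(1) x(1)] z(2) x(2) by (elim disjE) (simp_all only:)
qed

definition ratfun_dihedral_fixed :: "nat \<Rightarrow> 'k::alg_closed_field poly fract set" where
  "ratfun_dihedral_fixed n = {z. \<forall>\<sigma>\<in>ratfun_dihedral n. \<sigma> z = z}"

lemma galois_extension_ratfun_dihedral:
  assumes "n > 0"
  shows "galois_extension ring_of_type_algebra (ratfun_dihedral_fixed n :: 'k::alg_closed_field poly fract set)"
  unfolding ratfun_dihedral_fixed_def
proof (rule galois_extension_fixed_field)
  show "finite (ratfun_dihedral n :: ('k poly fract \<Rightarrow> _) set)"
    unfolding ratfun_dihedral_def by (intro finite_UnI finite_imageI finite_unit_roots assms)
  show "id \<in> (ratfun_dihedral n :: ('k poly fract \<Rightarrow> _) set)"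
    unfolding ratfun_dihedral_def
    by (rule UnI1, rule image_eqI[where x = 1], rule ratfun_rot_1[symmetric], rule unit_roots_one)
qed (rule ratfun_dihedral_closed[OF assms], assumption, assumption,
    rule ratfun_dihedral_automorphism[OF assms], assumption)

lemma ratfun_dihedral_fixed_const:
  assumes n: "n > 0"
  shows "ratfun_const c \<in> ratfun_dihedral_fixed n"
  using unit_roots_nz[OF n] ratfun_subst_hom(3)[OF ratfun_rot_nonconst] ratfun_subst_hom(3)[OF ratfun_refl_nonconst]
  unfolding ratfun_dihedral_fixed_def ratfun_dihedral_def by blast

lemma ratfun_dihedral_fixed_generator:
  assumes n: "n > 0"
  shows "ratfun_X ^ n + 1 / ratfun_X ^ n \<in> ratfun_dihedral_fixed n"
  unfolding ratfun_dihedral_fixed_def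
proof safe
  fix \<sigma> :: "'a poly fract \<Rightarrow> 'a poly fract" assume s: "\<sigma> \<in> ratfun_dihedral n"
  note h = field_automorphismD[OF ratfun_dihedral_automorphism[OF n s]]
  have "\<sigma> (ratfun_X ^ n + 1 / ratfun_X ^ n) = \<sigma> ratfun_X ^ n + 1 / \<sigma> ratfun_X ^ n"
    by (simp add: h del: divide_fract)
  moreover have "\<exists>\<zeta>\<in>unit_roots n. \<sigma> ratfun_X = ratfun_const \<zeta> * ratfun_X \<or> \<sigma> ratfun_X = ratfun_const \<zeta> / ratfun_X"
    using s unit_roots_nz[OF n] ratfun_subst_hom(4)[OF ratfun_rot_nonconst] ratfun_subst_hom(4)[OF ratfun_refl_nonconst]
    unfolding ratfun_dihedral_def by blast
  moreover have "ratfun_const \<zeta> ^ n = 1" if "\<zeta> \<in> unit_roots n" for \<zeta> :: 'a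
    using unit_rootsD[OF that] by (metis ratfun_const_ops(3,4))
  ultimately show "\<sigma> (ratfun_X ^ n + 1 / ratfun_X ^ n) = ratfun_X ^ n + 1 / ratfun_X ^ n"
    by (auto simp: power_mult_distrib power_divide simp del: mult_fract divide_fract)
qed

lemma ratfun_dihedral_fixed_ops:
  assumes n: "n > 0"
  shows "x \<in> ratfun_dihedral_fixed n \<Longrightarrow> y \<in> ratfun_dihedral_fixed n \<Longrightarrow> x + y \<in> ratfun_dihedral_fixed n"
    "x \<in> ratfun_dihedral_fixed n \<Longrightarrow> y \<in> ratfun_dihedral_fixed n \<Longrightarrow> x * y \<in> ratfun_dihedral_fixed n"
    "x \<in> ratfun_dihedral_fixed n \<Longrightarrow> y \<in> ratfun_dihedral_fixed n \<Longrightarrow> x / y \<in> ratfun_dihedral_fixed n"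
    "x \<in> ratfun_dihedral_fixed n \<Longrightarrow> x ^ i \<in> ratfun_dihedral_fixed n"
    "(\<And>i. i \<in> I \<Longrightarrow> f i \<in> ratfun_dihedral_fixed n) \<Longrightarrow> sum f I \<in> ratfun_dihedral_fixed n"
  by (auto simp: ratfun_dihedral_fixed_def field_automorphismD[OF ratfun_dihedral_automorphism[OF n]]
      intro!: sum.cong)

lemma ratfun_subst_scale:
  fixes p :: "'k::alg_closed_field poly"
  shows "ratfun_eval (ratfun_const \<zeta> * ratfun_X) p = Fract (pcompose p [:0, \<zeta>:]) 1"
proof (induction p)
  case (pCons a p)
  then show ?case by (simp add: pcompose_pCons)
qed simp

lemma ratfun_subst_reciprocal:
  fixes p :: "'k::alg_closed_field poly"
  assumes "degree p \<le> w"
  shows "ratfun_X ^ w * ratfun_eval (ratfun_const 1 / ratfun_X) p = Fract (poly_reverse w p) 1"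
proof -
  note [simp del] = mult_fract divide_fract
  let ?m = "map_poly ratfun_const p"
  have ev: "ratfun_eval r q = (\<Sum>i\<le>w. ratfun_const (coeff q i) * r ^ i)" if "degree q \<le> w" for r and q :: "'k poly"
    unfolding ratfun_eval_def
    by (subst poly_extend_sum) (use that in \<open>auto simp: coeff_map_poly coeff_eq_0 intro!: degree_le\<close>)
  have F: "Fract (monom c i) 1 = ratfun_const c * ratfun_X ^ i" for c :: 'k and i
    by (subst ratfun_eval_X[symmetric], induction i)
       (auto simp: monom_0 monom_Suc mult_ac)
  have S: "Fract (sum f I) 1 = (\<Sum>i\<in>I. Fract (f i) 1)" for f :: "nat \<Rightarrow> 'k poly" and I
  proof -
    have "Fract (a + b) 1 = Fract a 1 + Fract b 1" for a b :: "'k poly" by simp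
    then show ?thesis by (induction I rule: infinite_finite_induct) (simp_all del: add_fract)
  qed
  have "ratfun_X ^ w * (ratfun_const 1 / ratfun_X) ^ i = (ratfun_X ^ (w - i) :: 'k poly fract)" if "i \<le> w" for i
    using that by (simp add: power_diff power_divide ratfun_const_ops)
  then show ?thesis
    unfolding ev[OF assms] poly_reverse_def S F sum_distrib_left
    by (intro sum.cong refl) (auto simp: mult.left_commute)
qed

lemma prod_unit_roots_rotate:
  fixes h :: "'k::field \<Rightarrow> 'k"
  assumes "\<xi> \<in> unit_roots n" "n > 0"
  shows "(\<Prod>\<zeta>\<in>unit_roots n. h (\<zeta> * (\<xi> * y))) = (\<Prod>\<zeta>\<in>unit_roots n. h (\<zeta> * y))"
  using prod.reindex_bij_betw[OF bij_unit_roots_mult[OF assms], of "\<lambda>\<zeta>. h (\<zeta> * y)"]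
  by (simp add: mult_ac)

text \<open>
  Multiplying a denominator by its conjugates makes it invariant; the numerator then becomes invariant
  as well, and \<open>dihedral_invariant_poly\<close> applies to both.
\<close>

lemma ratfun_dihedral_fixedE:
  fixes z :: "'k::alg_closed_field poly fract"
  assumes n: "n > 0" and card: "card (unit_roots n :: 'k set) = n" and z: "z \<in> ratfun_dihedral_fixed n"
  obtains P Q j c d where "z = Fract P Q" "Q \<noteq> 0"
    "\<And>y. poly P y = dihedral_form n c j y"
    "\<And>y. poly Q y = dihedral_form n d j y"
proof -
  obtain A B where AB: "z = Fract A B" "B \<noteq> 0" by (cases z)
  note rt = ratfun_rot_nonconst and rf = ratfun_refl_nonconst[of 1, OF one_neq_zero]
  have nz: "\<zeta> \<noteq> 0" if "\<zeta> \<in> unit_roots n" for \<zeta> :: 'k using unit_roots_nz[OF n that] .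
  have fin: "finite (unit_roots n :: 'k set)" by (rule finite_unit_roots[OF n])
  have rot: "poly A (\<zeta> * y) * poly B y = poly A y * poly B (\<zeta> * y)" if "\<zeta> \<in> unit_roots n" for \<zeta> y
  proof -
    have "ratfun_rot \<zeta> z = z" using z that unfolding ratfun_dihedral_fixed_def ratfun_dihedral_def by blast
    moreover have "pcompose B [:0, \<zeta>:] \<noteq> 0"
      using AB(2) nz[OF that] by (simp add: pcompose_eq_0_iff)
    ultimately have "pcompose A [:0, \<zeta>:] * B = A * pcompose B [:0, \<zeta>:]"
      using AB(2) unfolding AB(1) ratfun_subst_Fract[OF rt[OF nz[OF that]] AB(2)] ratfun_subst_scale
      by (simp add: eq_fract)
    then have "poly (pcompose A [:0, \<zeta>:] * B) y = poly (A * pcompose B [:0, \<zeta>:]) y" by simp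
    then show ?thesis by (simp add: poly_pcompose mult_ac)
  qed
  define W where "W = degree A + degree B"
  have ref: "poly A (1 / y) * poly B y = poly A y * poly B (1 / y)" if "y \<noteq> 0" for y
  proof -
    have "ratfun_refl 1 z = z" using z unit_roots_one unfolding ratfun_dihedral_fixed_def ratfun_dihedral_def by blast
    then have "ratfun_eval (ratfun_const 1 / ratfun_X) A / ratfun_eval (ratfun_const 1 / ratfun_X) B = Fract A B"
      by (simp only: AB(1) ratfun_subst_Fract[OF rf AB(2)])
    then have "ratfun_X ^ W * ratfun_eval (ratfun_const 1 / ratfun_X) A /
        (ratfun_X ^ W * ratfun_eval (ratfun_const 1 / ratfun_X) B) = Fract A B"
      by (subst mult_divide_mult_cancel_left) (auto simp del: divide_fract)
    then have "Fract (poly_reverse W A) 1 / Fract (poly_reverse W B) 1 = Fract A B"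
      using ratfun_subst_reciprocal[of A W] ratfun_subst_reciprocal[of B W] by (simp only: W_def le_add1 le_add2)
    then have "Fract (poly_reverse W A) (poly_reverse W B) = Fract A B" by simp
    moreover have "poly_reverse W B \<noteq> 0"
    proof
      assume *: "poly_reverse W B = 0"
      have "B = 0"
      proof (rule poly_eqI_cofinite[of "{0}"])
        fix y :: 'k assume "y \<notin> {0}"
        then show "poly B y = poly 0 y"
          using poly_poly_reverse[of B W "1 / y"] * by (simp add: W_def)
      qed simp
      then show False using AB(2) by simp
    qed
    ultimately have "poly_reverse W A * B = A * poly_reverse W B" using AB(2) by (simp add: eq_fract)
    then have "poly (poly_reverse W A * B) y = poly (A * poly_reverse W B) y" by simp
    then show ?thesis using that by (simp add: poly_poly_reverse W_def)
  qed
  \<comment> \<open>The weight is taken to be a multiple of \<open>n\<close>, so that the factors \<open>\<zeta>\<close> disappear.\<close>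
  define w where "w = n * degree B"
  define rB where "rB = poly_reverse w B"
  have rB: "poly rB y = y ^ w * poly B (1 / y)" if "y \<noteq> 0" for y
    unfolding rB_def using that n by (intro poly_poly_reverse) (auto simp: w_def)
  have zw: "\<zeta> ^ w = 1" if "\<zeta> \<in> unit_roots n" for \<zeta> :: 'k
    using unit_rootsD[OF that] by (simp add: w_def power_mult)
  define C where "C = (\<Prod>\<zeta>\<in>unit_roots n - {1}. pcompose B [:0, \<zeta>:]) * (\<Prod>\<zeta>\<in>unit_roots n. pcompose rB [:0, \<zeta>:])"
  define Q where "Q = B * C"
  define P where "P = A * C"
  have Qy: "poly Q y = (\<Prod>\<zeta>\<in>unit_roots n. poly B (\<zeta> * y)) * (\<Prod>\<zeta>\<in>unit_roots n. poly rB (\<zeta> * y))" for y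
    unfolding Q_def C_def using prod.remove[OF finite_unit_roots[OF n] unit_roots_one, of "\<lambda>\<zeta>. poly B (\<zeta> * y)"]
    by (simp add: poly_prod poly_pcompose mult_ac)
  have rB0: "rB \<noteq> 0"
  proof
    assume *: "rB = 0"
    have "B = 0"
    proof (rule poly_eqI_cofinite[of "{0}"])
      fix y :: 'k assume "y \<notin> {0}"
      then show "poly B y = poly 0 y" using rB[of "1 / y"] * by simp
    qed simp
    then show False using AB(2) by simp
  qed
  have C0: "C \<noteq> 0"
    unfolding C_def using AB(2) rB0 nz fin
    by (auto simp: pcompose_eq_0_iff)
  have Qrot: "poly Q (\<xi> * y) = poly Q y" if "\<xi> \<in> unit_roots n" for \<xi> y
    unfolding Qy using prod_unit_roots_rotate[OF that n, of "poly B" y]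
      prod_unit_roots_rotate[OF that n, of "poly rB" y] by (simp only:)
  have Qref: "y ^ (2 * n * w) * poly Q (1 / y) = poly Q y" if y: "y \<noteq> 0" for y
  proof -
    have 1: "y ^ w * poly B (\<zeta> * (1 / y)) = poly rB (inverse \<zeta> * y)" if "\<zeta> \<in> unit_roots n" for \<zeta>
    proof -
      have e: "1 / (inverse \<zeta> * y) = \<zeta> * (1 / y)" by (simp add: divide_inverse)
      have "poly rB (inverse \<zeta> * y) = (inverse \<zeta> * y) ^ w * poly B (\<zeta> * (1 / y))"
        using rB[of "inverse \<zeta> * y"] y nz[OF that] unfolding e by simp
      then show ?thesis using zw[OF unit_roots_closed(2)[OF that that]]
        by (simp only: power_mult_distrib mult_1_left)
    qed
    have 2: "y ^ w * poly rB (\<zeta> * (1 / y)) = poly B (inverse \<zeta> * y)" if "\<zeta> \<in> unit_roots n" for \<zeta>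
    proof -
      have e: "1 / (\<zeta> * (1 / y)) = inverse \<zeta> * y" using y by (simp add: divide_inverse)
      have "poly rB (\<zeta> * (1 / y)) = (\<zeta> * (1 / y)) ^ w * poly B (inverse \<zeta> * y)"
        using rB[of "\<zeta> * (1 / y)"] y nz[OF that] unfolding e by simp
      also have "(\<zeta> * (1 / y)) ^ w = 1 / y ^ w" unfolding power_mult_distrib zw[OF that] by (simp add: power_divide)
      finally show ?thesis using y by simp
    qed
    have "y ^ (2 * n * w) = (\<Prod>\<zeta>\<in>(unit_roots n :: 'k set). y ^ w) * (\<Prod>\<zeta>\<in>(unit_roots n :: 'k set). y ^ w)"
    proof -
      have "2 * n * w = w * n + w * n" using mult_2[of "w * n"] by (simp only: mult.assoc mult.commute[of w])
      then have "y ^ (2 * n * w) = (y ^ w) ^ n * (y ^ w) ^ n" by (simp only: power_mult power_add)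
      then show ?thesis by (simp add: card)
    qed
    then have "y ^ (2 * n * w) * poly Q (1 / y) =
      (\<Prod>\<zeta>\<in>unit_roots n. y ^ w * poly B (\<zeta> * (1 / y))) * (\<Prod>\<zeta>\<in>unit_roots n. y ^ w * poly rB (\<zeta> * (1 / y)))"
      unfolding Qy prod.distrib by (simp only: mult_ac)
    also have "\<dots> = (\<Prod>\<zeta>\<in>unit_roots n. poly rB (inverse \<zeta> * y)) * (\<Prod>\<zeta>\<in>unit_roots n. poly B (inverse \<zeta> * y))"
      using 1 2 by simp
    also have "\<dots> = poly Q y"
      unfolding Qy
      using prod.reindex_bij_betw[OF bij_unit_roots_inverse, of "\<lambda>\<zeta>. poly rB (\<zeta> * y)" n]
        prod.reindex_bij_betw[OF bij_unit_roots_inverse, of "\<lambda>\<zeta>. poly B (\<zeta> * y)" n] by simp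
    finally show ?thesis .
  qed
  have Prot: "poly P (\<xi> * y) = poly P y" if x: "\<xi> \<in> unit_roots n" for \<xi> y
  proof -
    have "pcompose P [:0, \<xi>:] = P"
    proof (rule poly_eqI_cofinite)
      show "finite {y. poly (pcompose B [:0, \<xi>:]) y = 0}"
        using AB(2) nz[OF x] by (intro poly_roots_finite) (simp add: pcompose_eq_0_iff)
      fix y assume y: "y \<notin> {y. poly (pcompose B [:0, \<xi>:]) y = 0}"
      have "poly P (\<xi> * y) * poly B (\<xi> * y) = poly A (\<xi> * y) * poly Q (\<xi> * y)"
        by (simp add: P_def Q_def)
      also have "\<dots> = poly P y * poly B (\<xi> * y)"
        using rot[OF x, of y] Qrot[OF x] by (simp add: P_def Q_def)
      finally show "poly (pcompose P [:0, \<xi>:]) y = poly P y"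
        using y by (simp add: poly_pcompose mult.commute)
    qed
    then have "poly (pcompose P [:0, \<xi>:]) y = poly P y" by (rule arg_cong)
    then show ?thesis by (simp add: poly_pcompose mult.commute)
  qed
  have Pref: "y ^ (2 * n * w) * poly P (1 / y) = poly P y" if y: "y \<noteq> 0" for y
  proof -
    have "monom 1 (2 * n * w) * poly_reverse (degree P) P = monom 1 (degree P) * P"
    proof (rule poly_eqI_cofinite)
      show "finite (insert 0 {y. poly rB y = 0})" using poly_roots_finite[OF rB0] by simp
      fix y assume "y \<notin> insert 0 {y. poly rB y = 0}"
      then have y: "y \<noteq> 0" "poly B (1 / y) \<noteq> 0" using rB by auto
      have "y ^ (2 * n * w) * poly P (1 / y) * poly B (1 / y) = poly A (1 / y) * (y ^ (2 * n * w) * poly Q (1 / y))"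
        by (simp add: P_def Q_def)
      also have "\<dots> = poly P y * poly B (1 / y)"
        unfolding Qref[OF y(1)] using ref[OF y(1)] by (simp add: P_def Q_def)
      finally have "y ^ (2 * n * w) * poly P (1 / y) = poly P y" using y(2) by simp
      then show "poly (monom 1 (2 * n * w) * poly_reverse (degree P) P) y = poly (monom 1 (degree P) * P) y"
        using y(1) by (simp add: poly_monom poly_poly_reverse)
    qed
    then have "poly (monom 1 (2 * n * w) * poly_reverse (degree P) P) y = poly (monom 1 (degree P) * P) y" by simp
    then show ?thesis using y by (simp add: poly_monom poly_poly_reverse)
  qed
  have "z = Fract P Q" using AB C0 by (simp add: P_def Q_def eq_fract)
  moreover have "Q \<noteq> 0" using AB(2) C0 by (simp add: Q_def)
  moreover obtain c where "\<And>y. poly P y = dihedral_form n c w y"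
    using dihedral_invariant_poly[OF n card Prot Pref] by blast
  moreover obtain d where "\<And>y. poly Q y = dihedral_form n d w y"
    using dihedral_invariant_poly[OF n card Qrot Qref] by blast
  ultimately show ?thesis by (rule that)
qed

lemma ratfun_unit_root:
  fixes w :: "'k::alg_closed_field poly fract"
  assumes n: "n > 0" and card: "card (unit_roots n :: 'k set) = n" and w: "w ^ n = 1"
  shows "\<exists>\<zeta>\<in>unit_roots n. w = ratfun_const \<zeta>"
proof -
  have "ratfun_const ` unit_roots n = (unit_roots n :: 'k poly fract set)"
  proof (rule card_seteq)
    show "finite (unit_roots n :: 'k poly fract set)" by (rule finite_unit_roots[OF n])
    show "ratfun_const ` unit_roots n \<subseteq> (unit_roots n :: 'k poly fract set)"
    proof safe
      fix \<zeta> :: 'k assume "\<zeta> \<in> unit_roots n"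
      then show "ratfun_const \<zeta> \<in> unit_roots n"
        unfolding unit_roots_def mem_Collect_eq by (metis ratfun_const_ops(3,4))
    qed
    have "inj_on ratfun_const (unit_roots n :: 'k set)" by (simp add: inj_on_def)
    then show "card (unit_roots n :: 'k poly fract set) \<le> card (ratfun_const ` (unit_roots n :: 'k set))"
      using card card_unit_roots_le[OF n, where 'k = "'k poly fract"] by (simp add: card_image)
  qed
  then show ?thesis using w unfolding unit_roots_def by blast
qed

text \<open>
  An automorphism over the fixed field maps the variable \<open>X\<close> to a solution \<open>Z\<close> of
  \<open>Z\<^sup>n + Z\<^sup>-\<^sup>n = X\<^sup>n + X\<^sup>-\<^sup>n\<close>, that is, of \<open>(Z\<^sup>n - X\<^sup>n) (Z\<^sup>n X\<^sup>n - 1) = 0\<close>.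
\<close>

lemma galois_group_ratfun_dihedral:
  assumes n: "n > 0" and card: "card (unit_roots n :: 'k::alg_closed_field set) = n"
  shows "carrier (galois_group ring_of_type_algebra (ratfun_dihedral_fixed n :: 'k::alg_closed_field poly fract set)) =
    ratfun_dihedral n" (is "carrier ?G = _")
proof
  show "ratfun_dihedral n \<subseteq> carrier ?G"
    using ratfun_dihedral_automorphism[OF n]
    by (auto simp: galois_group_of_type_algebra ratfun_dihedral_fixed_def)
  show "carrier ?G \<subseteq> ratfun_dihedral n"
  proof
    fix \<sigma> :: "'k poly fract \<Rightarrow> 'k poly fract" assume "\<sigma> \<in> carrier ?G"
    then have s: "field_automorphism \<sigma>" and fixd: "\<And>x. x \<in> ratfun_dihedral_fixed n \<Longrightarrow> \<sigma> x = x"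
      by (auto simp: galois_group_of_type_algebra)
    note h = field_automorphismD[OF s]
    note [simp del] = mult_fract divide_fract
    let ?X = "ratfun_X :: 'k poly fract"
    define Z where "Z = \<sigma> ?X"
    have Z0: "Z \<noteq> 0" by (simp add: Z_def h)
    have "Z ^ n + 1 / Z ^ n = ?X ^ n + 1 / ?X ^ n"
      using fixd[OF ratfun_dihedral_fixed_generator[OF n]] by (simp add: h Z_def)
    then have "(Z ^ n - ?X ^ n) * (Z ^ n * ?X ^ n - 1) = 0"
      using Z0 by (simp add: field_simps)
    then consider "Z ^ n = ?X ^ n" | "Z ^ n * ?X ^ n = 1" by auto
    then have "\<exists>\<zeta>\<in>unit_roots n. Z = ratfun_const \<zeta> * ?X \<or> Z = ratfun_const \<zeta> / ?X"
    proof cases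
      case 1
      then have "(Z / ?X) ^ n = 1" by (simp add: power_divide)
      then obtain \<zeta> where "\<zeta> \<in> unit_roots n" "Z / ?X = ratfun_const \<zeta>"
        using ratfun_unit_root[OF n card] by blast
      then show ?thesis by (auto simp: divide_eq_eq intro!: bexI[of _ \<zeta>])
    next
      case 2
      then have "(Z * ?X) ^ n = 1" by (simp add: power_mult_distrib)
      then obtain \<zeta> where "\<zeta> \<in> unit_roots n" "Z * ?X = ratfun_const \<zeta>"
        using ratfun_unit_root[OF n card] by blast
      then show ?thesis by (auto simp: eq_divide_eq intro!: bexI[of _ \<zeta>])
    qed
    then obtain \<zeta> where z: "\<zeta> \<in> unit_roots n" "Z = ratfun_const \<zeta> * ?X \<or> Z = ratfun_const \<zeta> / ?X" by blast
    have "Z \<notin> range ratfun_const"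
      using z(2) ratfun_rot_nonconst[OF unit_roots_nz[OF n z(1)]] ratfun_refl_nonconst[OF unit_roots_nz[OF n z(1)]]
      by (elim disjE) (simp_all only: not_False_eq_True)
    then have "\<sigma> = ratfun_subst Z"
      by (intro ratfun_hom_eq_subst h(2,3) fixd ratfun_dihedral_fixed_const n) (simp_all add: Z_def)
    then show "\<sigma> \<in> ratfun_dihedral n" using z unfolding ratfun_dihedral_def by blast
  qed
qed

text \<open>
  The rotation by a primitive root of unity and \<open>y \<mapsto> 1/y\<close> generate. Products of them are told apart by
  their values at the variable.
\<close>

lemma galois_group_ratfun_dihedral_iso:
  fixes z :: "'k::alg_closed_field"
  assumes n: "n > 0" and z: "z ^ n = 1" and inj: "inj_on (\<lambda>i. z ^ i) {..<n}"
    and gen: "unit_roots n = (\<lambda>i. z ^ i) ` {..<n}"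
  shows "galois_group ring_of_type_algebra (ratfun_dihedral_fixed n :: 'k poly fract set) \<cong> dihedral_group (2 * n)"
    (is "?G \<cong> _")
proof -
  have card: "card (unit_roots n :: 'k set) = n" unfolding gen using inj by (simp add: card_image)
  note C = galois_group_ratfun_dihedral[OF n card]
  have bij: "bij \<sigma>" if "\<sigma> \<in> ratfun_dihedral n" for \<sigma> :: "'k poly fract \<Rightarrow> _"
    using field_automorphismD(1)[OF ratfun_dihedral_automorphism[OF n that]] .
  have mult: "\<sigma> \<otimes>\<^bsub>?G\<^esub> \<tau> = \<sigma> \<circ> \<tau>" if "\<sigma> \<in> ratfun_dihedral n" "\<tau> \<in> ratfun_dihedral n" for \<sigma> \<tau>
    using galois_group_of_type_algebra_mult bij that by blast
  have one: "\<one>\<^bsub>?G\<^esub> = ratfun_rot 1" by (simp only: galois_group_of_type_algebra_one ratfun_rot_1)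
  have rot_in: "ratfun_rot \<zeta> \<in> ratfun_dihedral n" and refl_in: "ratfun_refl \<zeta> \<in> ratfun_dihedral n"
    if "\<zeta> \<in> unit_roots n" for \<zeta> :: 'k using that unfolding ratfun_dihedral_def by blast+
  note cl = unit_roots_closed[where n = n] and nz = unit_roots_nz[OF n]
  have zn: "z \<in> unit_roots n" "z ^ i \<in> unit_roots n" for i
    using z by (auto simp: unit_roots_def) (metis mult.commute power_mult power_one)
  have m: "monoid ?G"
  proof (rule monoidI)
    show "\<one>\<^bsub>?G\<^esub> \<in> carrier ?G" unfolding C one by (rule rot_in) simp
    fix x y w assume a: "x \<in> carrier ?G" "y \<in> carrier ?G" "w \<in> carrier ?G"
    show "x \<otimes>\<^bsub>?G\<^esub> y \<otimes>\<^bsub>?G\<^esub> w = x \<otimes>\<^bsub>?G\<^esub> (y \<otimes>\<^bsub>?G\<^esub> w)"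
      using a unfolding C by (simp add: mult ratfun_dihedral_closed[OF n] comp_assoc)
  next
    fix x y assume a: "x \<in> carrier ?G" "y \<in> carrier ?G"
    show "x \<otimes>\<^bsub>?G\<^esub> y \<in> carrier ?G"
      using a unfolding C by (simp add: mult ratfun_dihedral_closed[OF n])
  next
    fix x assume a: "x \<in> carrier ?G"
    show "\<one>\<^bsub>?G\<^esub> \<otimes>\<^bsub>?G\<^esub> x = x" using a rot_in[of 1] unfolding C one by (simp only: mult unit_roots_one ratfun_rot_1) simp
    show "x \<otimes>\<^bsub>?G\<^esub> \<one>\<^bsub>?G\<^esub> = x" using a rot_in[of 1] unfolding C one by (simp only: mult unit_roots_one ratfun_rot_1) simp
  qed
  interpret monoid ?G by (rule m)
  let ?a = "ratfun_rot z" and ?b = "ratfun_refl 1"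
  have pa: "?a [^]\<^bsub>?G\<^esub> (i::nat) = ratfun_rot (z ^ i)" for i
  proof (induction i)
    case 0
    show ?case by (simp only: nat_pow_0 one power_0)
  next
    case (Suc i)
    have "?a [^]\<^bsub>?G\<^esub> Suc i = ratfun_rot (z ^ i) \<circ> ratfun_rot z"
      unfolding nat_pow_Suc Suc by (rule mult[OF rot_in[OF zn(2)] rot_in[OF zn(1)]])
    also have "\<dots> = ratfun_rot (z ^ Suc i)"
      using ratfun_dihedral_comp(1)[OF nz[OF zn(2)] nz[OF zn(1)]] by (simp only: power_Suc2)
    finally show ?case .
  qed
  have bb: "?b \<otimes>\<^bsub>?G\<^esub> ?b = \<one>\<^bsub>?G\<^esub>"
    using mult[OF refl_in[OF unit_roots_one] refl_in[OF unit_roots_one]]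
      ratfun_dihedral_comp(4)[OF one_neq_zero one_neq_zero]
    by (simp only: one div_by_1)
  have b_in: "?b \<in> carrier ?G" unfolding C by (rule refl_in) simp
  have a_in: "?a \<in> carrier ?G" unfolding C by (rule rot_in[OF zn(1)])
  have ab: "ratfun_rot \<zeta> \<otimes>\<^bsub>?G\<^esub> ?b = ratfun_refl (1 / \<zeta>)" if "\<zeta> \<in> unit_roots n" for \<zeta>
    using mult[OF rot_in[OF that] refl_in[OF unit_roots_one]] ratfun_dihedral_comp(2)[OF nz[OF that] one_neq_zero]
    by (simp only:)
  have iz: "1 / z \<in> unit_roots n" using cl(3)[OF unit_roots_one zn(1)] .
  have abab: "(?a \<otimes>\<^bsub>?G\<^esub> ?b) \<otimes>\<^bsub>?G\<^esub> (?a \<otimes>\<^bsub>?G\<^esub> ?b) = \<one>\<^bsub>?G\<^esub>"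
    using mult[OF refl_in[OF iz] refl_in[OF iz]] ratfun_dihedral_comp(4)[OF nz[OF iz] nz[OF iz]]
    by (simp only: ab[OF zn(1)] one divide_self[OF nz[OF iz]])
  have b0: "?b [^]\<^bsub>?G\<^esub> (0::nat) = \<one>\<^bsub>?G\<^esub>" and b1: "?b [^]\<^bsub>?G\<^esub> (1::nat) = ?b"
    using b_in by (auto simp del: divide_fract)
  have r1: "ratfun_rot (z ^ i) \<otimes>\<^bsub>?G\<^esub> \<one>\<^bsub>?G\<^esub> = ratfun_rot (z ^ i)" for i
    using r_one[OF nat_pow_closed[OF a_in]] unfolding pa .
  show ?thesis
  proof (rule iso_dihedral_groupI[OF m a_in b_in n _ bb abab])
    show "?a [^]\<^bsub>?G\<^esub> n = \<one>\<^bsub>?G\<^esub>" by (simp only: pa z one)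
  next
    fix g assume "g \<in> carrier ?G"
    then consider \<zeta> where "\<zeta> \<in> unit_roots n" "g = ratfun_rot \<zeta>" | \<zeta> where "\<zeta> \<in> unit_roots n" "g = ratfun_refl \<zeta>"
      unfolding C ratfun_dihedral_def by blast
    then show "\<exists>(i::nat) (j::nat). g = ?a [^]\<^bsub>?G\<^esub> i \<otimes>\<^bsub>?G\<^esub> ?b [^]\<^bsub>?G\<^esub> j"
    proof cases
      case 1
      then obtain i where i: "\<zeta> = z ^ i" using gen by auto
      have "g = ?a [^]\<^bsub>?G\<^esub> i \<otimes>\<^bsub>?G\<^esub> ?b [^]\<^bsub>?G\<^esub> (0::nat)"
        unfolding b0 pa r1 1(2) i ..
      then show ?thesis by blast
    next
      case 2
      then obtain i where i: "1 / \<zeta> = z ^ i" using gen cl(3)[OF unit_roots_one 2(1)] by auto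
      have "\<zeta> = 1 / z ^ i" using nz[OF 2(1)] by (simp flip: i)
      then have "g = ?a [^]\<^bsub>?G\<^esub> i \<otimes>\<^bsub>?G\<^esub> ?b [^]\<^bsub>?G\<^esub> (1::nat)"
        unfolding b1 pa ab[OF zn(2)] 2(2) by (simp only:)
      then show ?thesis by blast
    qed
  next
    fix i i' j j' :: nat
    assume ij: "i < n" "i' < n" "j < 2" "j' < 2"
      and eq: "?a [^]\<^bsub>?G\<^esub> i \<otimes>\<^bsub>?G\<^esub> ?b [^]\<^bsub>?G\<^esub> j = ?a [^]\<^bsub>?G\<^esub> i' \<otimes>\<^bsub>?G\<^esub> ?b [^]\<^bsub>?G\<^esub> j'"
    have val: "(?a [^]\<^bsub>?G\<^esub> i \<otimes>\<^bsub>?G\<^esub> ?b [^]\<^bsub>?G\<^esub> j) ratfun_X =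
        (if j = 0 then ratfun_const (z ^ i) * ratfun_X else ratfun_const (1 / z ^ i) / ratfun_X)" if "j < 2" for i j :: nat
    proof -
      note jl = that
      have nzi: "z ^ i \<noteq> 0" "1 / z ^ i \<noteq> 0" using nz[OF zn(2)] by auto
      consider "j = 0" | "j = 1" using jl by linarith
      then show ?thesis
      proof cases
        case 1
        show ?thesis unfolding 1 b0 pa r1
          using ratfun_subst_hom(4)[OF ratfun_rot_nonconst[OF nzi(1)]] by (simp only: simp_thms if_True)
      next
        case 2
        show ?thesis unfolding 2 b1 pa ab[OF zn(2)]
          using ratfun_subst_hom(4)[OF ratfun_refl_nonconst[OF nzi(2)]] by (simp only: simp_thms if_False one_neq_zero)
      qed
    qed
    have ne: "ratfun_const x * ratfun_X \<noteq> ratfun_const y / ratfun_X" if "x \<noteq> 0" for x y :: 'k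
      using that by (simp add: eq_fract)
    have "(if j = 0 then ratfun_const (z ^ i) * ratfun_X else ratfun_const (1 / z ^ i) / ratfun_X) =
      (if j' = 0 then ratfun_const (z ^ i') * ratfun_X else ratfun_const (1 / z ^ i') / ratfun_X)"
      using val[OF ij(3), of i] val[OF ij(4), of i'] unfolding eq by (rule HOL.trans[OF HOL.sym])
    then have "(j = 0) = (j' = 0) \<and> z ^ i = z ^ i'"
      using ne[OF nz[OF zn(2)[of i]]] ne[OF nz[OF zn(2)[of i']]] nz[OF zn(2)]
      by (auto simp: eq_fract split: if_splits)
    then show "i = i' \<and> j = j'" using ij inj by (auto simp: inj_on_def)
  qed
qed

section \<open>Homogeneous polynomials in three variables\<close>

lemma eval3_add [simp]: "eval3 (A + B) v = eval3 A v + eval3 B v"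
  and eval3_diff [simp]: "eval3 (A - B) v = eval3 A v - eval3 B v"
  and eval3_mult [simp]: "eval3 (A * B) v = eval3 A v * eval3 B v"
  and eval3_const [simp]: "eval3 (const3 c) v = c"
  and eval3_0 [simp]: "eval3 0 v = 0"
  and eval3_1 [simp]: "eval3 1 v = 1"
  by (cases v; simp add: eval3_def const3_def)+

lemma eval3_power [simp]: "eval3 (A ^ i) v = eval3 A v ^ i"
  by (induction i) auto

lemma eval3_sum [simp]: "eval3 (sum F I) v = (\<Sum>i\<in>I. eval3 (F i) v)"
  by (induction I rule: infinite_finite_induct) auto

lemma eval3_altdef:
  "eval3 A (x, y, z) = (\<Sum>i\<le>degree A. \<Sum>j\<le>degree (coeff A i). \<Sum>l\<le>degree (coeff (coeff A i) j).
     coeff (coeff (coeff A i) j) l * (x ^ i * y ^ j * z ^ l))"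
proof -
  have 1: "poly (poly B [:y:]) z = (\<Sum>j\<le>degree B. \<Sum>l\<le>degree (coeff B j). coeff (coeff B j) l * (y ^ j * z ^ l))" for B
  proof -
    have "poly (poly B [:y:]) z = (\<Sum>j\<le>degree B. poly (coeff B j) z * y ^ j)"
      by (subst poly_altdef) (simp add: poly_sum)
    then show ?thesis by (simp add: poly_altdef[of "coeff B _"] sum_distrib_left mult_ac)
  qed
  have "eval3 A (x, y, z) = (\<Sum>i\<le>degree A. poly (poly (coeff A i) [:y:]) z * x ^ i)"
    unfolding eval3_def by (subst poly_altdef) (simp add: poly_sum)
  then show ?thesis by (simp add: 1 sum_distrib_left mult_ac)
qed

lemma eval3_scale:
  assumes "homogeneous3 d A"
  shows "eval3 A (c * x, c * y, c * z) = c ^ d * eval3 A (x, y, z)"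
  unfolding eval3_altdef sum_distrib_left
proof (intro sum.cong HOL.refl)
  fix i j l
  show "coeff (coeff (coeff A i) j) l * ((c * x) ^ i * (c * y) ^ j * (c * z) ^ l) =
    c ^ d * (coeff (coeff (coeff A i) j) l * (x ^ i * y ^ j * z ^ l))"
  proof (cases "coeff (coeff (coeff A i) j) l = 0")
    case False
    then have "d = i + j + l" using assms by (auto simp: homogeneous3_def)
    then show ?thesis by (simp add: power_add power_mult_distrib mult_ac)
  qed simp
qed

lemma homogeneous3_0 [simp]: "homogeneous3 d 0"
  by (simp add: homogeneous3_def)

lemma homogeneous3_const: "homogeneous3 0 (const3 c)"
  by (auto simp: homogeneous3_def const3_def coeff_pCons split: nat.splits)

lemma homogeneous3_1: "homogeneous3 0 1"
proof -
  have "1 = (const3 1 :: 'a poly3)" by (simp add: const3_def one_pCons)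
  then show ?thesis using homogeneous3_const by metis
qed

lemma homogeneous3_add: "homogeneous3 d A \<Longrightarrow> homogeneous3 d B \<Longrightarrow> homogeneous3 d (A + B)"
  unfolding homogeneous3_def by (metis add.right_neutral coeff_add)

lemma homogeneous3_diff: "homogeneous3 d A \<Longrightarrow> homogeneous3 d B \<Longrightarrow> homogeneous3 d (A - B)"
  unfolding homogeneous3_def by (metis diff_zero coeff_diff)

lemma homogeneous3_sum: "(\<And>i. i \<in> I \<Longrightarrow> homogeneous3 d (F i)) \<Longrightarrow> homogeneous3 d (sum F I)"
  by (induction I rule: infinite_finite_induct) (auto intro: homogeneous3_add)

lemma homogeneous3_mult:
  assumes "homogeneous3 d A" "homogeneous3 e B"
  shows "homogeneous3 (d + e) (A * B)"
  unfolding homogeneous3_def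
proof (intro allI impI)
  fix i j l assume "coeff (coeff (coeff (A * B) i) j) l \<noteq> 0"
  then have "(\<Sum>a\<le>i. \<Sum>b\<le>j. \<Sum>c\<le>l. coeff (coeff (coeff A a) b) c * coeff (coeff (coeff B (i - a)) (j - b)) (l - c)) \<noteq> 0"
    by (simp add: coeff_mult coeff_sum)
  then obtain a where a: "a \<le> i" "(\<Sum>b\<le>j. \<Sum>c\<le>l. coeff (coeff (coeff A a) b) c * coeff (coeff (coeff B (i - a)) (j - b)) (l - c)) \<noteq> 0"
    by (meson atMost_iff sum.not_neutral_contains_not_neutral)
  then obtain b where b: "b \<le> j" "(\<Sum>c\<le>l. coeff (coeff (coeff A a) b) c * coeff (coeff (coeff B (i - a)) (j - b)) (l - c)) \<noteq> 0"
    by (meson atMost_iff sum.not_neutral_contains_not_neutral)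
  then obtain c where c: "c \<le> l" "coeff (coeff (coeff A a) b) c * coeff (coeff (coeff B (i - a)) (j - b)) (l - c) \<noteq> 0"
    by (meson atMost_iff sum.not_neutral_contains_not_neutral)
  have "a + b + c = d" "(i - a) + (j - b) + (l - c) = e"
    using assms c(2) by (auto simp: homogeneous3_def)
  then show "i + j + l = d + e" using a(1) b(1) c(1) by linarith
qed

lemma homogeneous3_power: "homogeneous3 d A \<Longrightarrow> homogeneous3 (i * d) (A ^ i)"
  by (induction i) (auto intro: homogeneous3_1 homogeneous3_mult)

lemma homogeneous3_binary_form_at:
  assumes "homogeneous3 1 L" "homogeneous3 1 M"
  shows "homogeneous3 d (binary_form_at d a L M)"
  unfolding binary_form_at_def
proof (rule homogeneous3_sum)
  fix i assume "i \<in> {..d}"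
  then show "homogeneous3 d (const3 (a i) * L ^ i * M ^ (d - i))"
    using homogeneous3_mult[OF homogeneous3_mult[OF homogeneous3_const[of "a i"] homogeneous3_power[OF assms(1), of i]]
      homogeneous3_power[OF assms(2), of "d - i"]] by simp
qed

lemma eval3_binary_form_at:
  "eval3 (binary_form_at d a L M) v = (\<Sum>i\<le>d. a i * eval3 L v ^ i * eval3 M v ^ (d - i))"
  by (simp add: binary_form_at_def)

definition poly3_subst :: "'k::field poly3 \<Rightarrow> 'k poly \<Rightarrow> 'k poly \<Rightarrow> 'k poly \<Rightarrow> 'k poly" where
  "poly3_subst A p1 p2 p3 = (\<Sum>i\<le>degree A. \<Sum>j\<le>degree (coeff A i). \<Sum>l\<le>degree (coeff (coeff A i) j).
     smult (coeff (coeff (coeff A i) j) l) (p1 ^ i * p2 ^ j * p3 ^ l))"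

lemma poly_poly3_subst: "poly (poly3_subst A p1 p2 p3) y = eval3 A (poly p1 y, poly p2 y, poly p3 y)"
  unfolding eval3_altdef by (simp add: poly3_subst_def poly_sum)

lemma poly3_subst_hom:
  fixes p1 p2 p3 :: "'k::alg_closed_field poly"
  shows "poly3_subst (A + B) p1 p2 p3 = poly3_subst A p1 p2 p3 + poly3_subst B p1 p2 p3"
    "poly3_subst (A - B) p1 p2 p3 = poly3_subst A p1 p2 p3 - poly3_subst B p1 p2 p3"
    "poly3_subst (A * B) p1 p2 p3 = poly3_subst A p1 p2 p3 * poly3_subst B p1 p2 p3"
    "poly3_subst (const3 c) p1 p2 p3 = [:c:]" "poly3_subst 0 p1 p2 p3 = 0" "poly3_subst 1 p1 p2 p3 = 1"
  by (rule poly_eqI_cofinite[of "{}"]; simp add: poly_poly3_subst)+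

section \<open>The function field of a rational plane curve\<close>

text \<open>
  The polynomials \<open>p\<close> and \<open>r\<close> are the restrictions of the binary form \<open>f\<close> of degree \<open>N\<close> to the two
  affine charts of the projective line.
\<close>

definition binary_form :: "nat \<Rightarrow> ('k::field \<Rightarrow> 'k \<Rightarrow> 'k) \<Rightarrow> 'k poly \<Rightarrow> 'k poly \<Rightarrow> bool" where
  "binary_form N f p r \<longleftrightarrow>
     (\<forall>u v. u \<noteq> 0 \<longrightarrow> f u v = u ^ N * poly p (v / u)) \<and> (\<forall>u v. v \<noteq> 0 \<longrightarrow> f u v = v ^ N * poly r (u / v))"

locale rational_plane_curve =
  fixes N :: nat and f1 f2 f3 :: "'k::alg_closed_field \<Rightarrow> 'k \<Rightarrow> 'k" and p1 p2 p3 r1 r2 r3 :: "'k poly"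
    and C :: "('k \<times> 'k \<times> 'k) set set"
  assumes f1: "binary_form N f1 p1 r1" and f2: "binary_form N f2 p2 r2" and f3: "binary_form N f3 p3 r3"
    and C: "C = {proj_point (f1 u v) (f2 u v) (f3 u v) | u v. (u, v) \<noteq> (0, 0)}"
begin

abbreviation pullback :: "'k poly3 \<Rightarrow> 'k poly" where
  "pullback A \<equiv> poly3_subst A p1 p2 p3"

lemma poly_pullback: "poly (pullback A) y = eval3 A (f1 1 y, f2 1 y, f3 1 y)"
  using f1 f2 f3 by (simp add: poly_poly3_subst binary_form_def)

text \<open>
  The chart \<open>u \<noteq> 0\<close> misses one point of the projective line. There the form vanishes because it is a
  polynomial in the other chart that vanishes off \<open>0\<close>.
\<close>

lemma vanishes_on_iff:
  assumes A: "homogeneous3 d A"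
  shows "vanishes_on A C \<longleftrightarrow> pullback A = 0"
proof
  assume v: "vanishes_on A C"
  have "eval3 A (f1 1 y, f2 1 y, f3 1 y) = 0" for y
  proof -
    have "proj_point (f1 1 y) (f2 1 y) (f3 1 y) \<in> C" unfolding C by force
    moreover have "(f1 1 y, f2 1 y, f3 1 y) \<in> proj_point (f1 1 y) (f2 1 y) (f3 1 y)"
      unfolding proj_point_def by (auto intro!: exI[of _ 1])
    ultimately show ?thesis using v unfolding vanishes_on_def by blast
  qed
  then show "pullback A = 0" by (intro poly_eqI_cofinite[of "{}"]) (auto simp: poly_pullback)
next
  assume p: "pullback A = 0"
  have 1: "eval3 A (f1 u v, f2 u v, f3 u v) = 0" if "u \<noteq> 0" for u v
  proof -
    have "eval3 A (f1 u v, f2 u v, f3 u v) = (u ^ N) ^ d * poly (pullback A) (v / u)"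
      using f1 f2 f3 that by (simp add: poly_poly3_subst binary_form_def eval3_scale[OF A])
    then show ?thesis by (simp add: p)
  qed
  have "poly3_subst A r1 r2 r3 = 0"
  proof (rule poly_eqI_cofinite[of "{0}"])
    fix y :: 'k assume "y \<notin> {0}"
    moreover have "f1 y 1 = poly r1 y" "f2 y 1 = poly r2 y" "f3 y 1 = poly r3 y"
      using f1 f2 f3 by (auto simp: binary_form_def)
    ultimately show "poly (poly3_subst A r1 r2 r3) y = poly 0 y"
      using 1[of y 1] by (simp add: poly_poly3_subst)
  qed simp
  then have 2: "eval3 A (f1 u v, f2 u v, f3 u v) = 0" if "v \<noteq> 0" for u v
  proof -
    have "eval3 A (f1 u v, f2 u v, f3 u v) = (v ^ N) ^ d * poly (poly3_subst A r1 r2 r3) (u / v)"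
      using f1 f2 f3 that by (simp add: poly_poly3_subst binary_form_def eval3_scale[OF A])
    then show ?thesis by (simp add: \<open>poly3_subst A r1 r2 r3 = 0\<close>)
  qed
  show "vanishes_on A C"
    unfolding vanishes_on_def C proj_point_def using 1 2 by (auto simp: eval3_scale[OF A])
qed

lemma fractions_on_eq:
  "fractions_on C = {(A, B). (\<exists>d. homogeneous3 d A \<and> homogeneous3 d B) \<and> pullback B \<noteq> 0}"
  unfolding fractions_on_def using vanishes_on_iff by auto

definition ratfun_of :: "'k poly3 \<times> 'k poly3 \<Rightarrow> 'k poly fract" where
  "ratfun_of = (\<lambda>(A, B). Fract (pullback A) (pullback B))"

lemma fraction_rel_eq:
  "fraction_rel C = {(P, Q). P \<in> fractions_on C \<and> Q \<in> fractions_on C \<and> ratfun_of P = ratfun_of Q}"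
proof -
  have "vanishes_on (A * B' - A' * B) C \<longleftrightarrow> ratfun_of (A, B) = ratfun_of (A', B')"
    if "(A, B) \<in> fractions_on C" "(A', B') \<in> fractions_on C" for A B A' B'
  proof -
    obtain d e where h: "homogeneous3 d A" "homogeneous3 d B" "homogeneous3 e A'" "homogeneous3 e B'"
      "pullback B \<noteq> 0" "pullback B' \<noteq> 0"
      using \<open>(A, B) \<in> _\<close> \<open>(A', B') \<in> _\<close> by (auto simp: fractions_on_eq)
    have "homogeneous3 (d + e) (A * B' - A' * B)"
      using homogeneous3_diff[OF homogeneous3_mult[OF h(1,4)]] homogeneous3_mult[OF h(3,2)]
      by (simp add: add.commute)
    then show ?thesis using h(5,6)
      by (simp add: vanishes_on_iff poly3_subst_hom ratfun_of_def eq_fract)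
  qed
  then show ?thesis unfolding fraction_rel_def by auto
qed

text \<open>
  The isomorphism with the rational function field is given in this direction because its values, being sets
  of fractions, require no choice of representatives.
\<close>

definition fraction_fiber :: "'k poly fract \<Rightarrow> ('k poly3 \<times> 'k poly3) set" where
  "fraction_fiber z = {P \<in> fractions_on C. ratfun_of P = z}"

lemma fraction_class_eq:
  assumes "(A, B) \<in> fractions_on C"
  shows "fraction_class C A B = fraction_fiber (ratfun_of (A, B))"
  using assms unfolding fraction_class_def fraction_fiber_def fraction_rel_eq by auto

lemma fractions_on_closed:
  assumes "(A, B) \<in> fractions_on C" "(A', B') \<in> fractions_on C"
  shows "(A * A', B * B') \<in> fractions_on C" "(A * B' + A' * B, B * B') \<in> fractions_on C"
    "ratfun_of (A * A', B * B') = ratfun_of (A, B) * ratfun_of (A', B')"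
    "ratfun_of (A * B' + A' * B, B * B') = ratfun_of (A, B) + ratfun_of (A', B')"
proof -
  obtain d e where h: "homogeneous3 d A" "homogeneous3 d B" "homogeneous3 e A'" "homogeneous3 e B'"
    "pullback B \<noteq> 0" "pullback B' \<noteq> 0"
    using assms by (auto simp: fractions_on_eq)
  have "homogeneous3 (d + e) (A * B' + A' * B)"
    using homogeneous3_add[OF homogeneous3_mult[OF h(1,4)], of "A' * B"] homogeneous3_mult[OF h(3,2)]
    by (simp add: add.commute[of e])
  then show "(A * A', B * B') \<in> fractions_on C" "(A * B' + A' * B, B * B') \<in> fractions_on C"
    using homogeneous3_mult[OF h(1,3)] homogeneous3_mult[OF h(2,4)] h(5,6)
    by (auto simp: fractions_on_eq poly3_subst_hom)
  show "ratfun_of (A * A', B * B') = ratfun_of (A, B) * ratfun_of (A', B')"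
    "ratfun_of (A * B' + A' * B, B * B') = ratfun_of (A, B) + ratfun_of (A', B')"
    using h(5,6) by (auto simp: ratfun_of_def poly3_subst_hom)
qed

lemma fractions_on_const: "(const3 c, 1) \<in> fractions_on C" "ratfun_of (const3 c, 1) = ratfun_const c"
  using homogeneous3_const homogeneous3_1 by (auto simp: fractions_on_eq poly3_subst_hom ratfun_of_def)

end

text \<open>
  The additional hypothesis says that the coordinate \<open>v/u\<close> of the projective line is a quotient of two
  forms on the curve, so that the parametrisation is birational.
\<close>

locale birational_plane_curve = rational_plane_curve +
  assumes birational: "\<exists>A B d. homogeneous3 d A \<and> homogeneous3 d B \<and> \<not> vanishes_on B C \<and>
    (\<forall>u v. (u, v) \<noteq> (0, 0) \<longrightarrow> v * eval3 B (f1 u v, f2 u v, f3 u v) = u * eval3 A (f1 u v, f2 u v, f3 u v))"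
begin

text \<open>
  The quotients of forms make up a subfield, and this subfield contains the constants and the coordinate.
\<close>

lemma ratfun_of_surj: "\<exists>P\<in>fractions_on C. ratfun_of P = z"
proof -
  define S where "S = ratfun_of ` fractions_on C"
  have cl: "x + y \<in> S" "x * y \<in> S" if xy: "x \<in> S" "y \<in> S" for x y
  proof -
    obtain A B A' B' where *: "(A, B) \<in> fractions_on C" "x = ratfun_of (A, B)"
      "(A', B') \<in> fractions_on C" "y = ratfun_of (A', B')" using xy by (auto simp: S_def)
    show "x + y \<in> S" unfolding S_def *(2,4) fractions_on_closed(4)[OF *(1,3), symmetric]
      by (rule imageI[OF fractions_on_closed(2)[OF *(1,3)]])
    show "x * y \<in> S" unfolding S_def *(2,4) fractions_on_closed(3)[OF *(1,3), symmetric]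
      by (rule imageI[OF fractions_on_closed(1)[OF *(1,3)]])
  qed
  have const: "ratfun_const c \<in> S" for c
    unfolding S_def fractions_on_const(2)[symmetric] by (rule imageI[OF fractions_on_const(1)])
  have inv: "inverse x \<in> S" if x: "x \<in> S" "x \<noteq> 0" for x
  proof -
    obtain A B where AB: "(A, B) \<in> fractions_on C" "x = ratfun_of (A, B)" using x(1) by (auto simp: S_def)
    then have "pullback B \<noteq> 0" by (auto simp: fractions_on_eq)
    then have "pullback A \<noteq> 0" using x(2) AB by (auto simp: ratfun_of_def)
    then have "(B, A) \<in> fractions_on C" using AB(1) by (auto simp: fractions_on_eq)
    moreover have "inverse x = ratfun_of (B, A)" by (simp add: AB(2) ratfun_of_def)
    ultimately show ?thesis by (auto simp: S_def)
  qed
  have X: "ratfun_X \<in> S"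
  proof -
    obtain A B d where AB: "homogeneous3 d A" "homogeneous3 d B" "\<not> vanishes_on B C"
      "\<And>u v. (u, v) \<noteq> (0, 0) \<Longrightarrow> v * eval3 B (f1 u v, f2 u v, f3 u v) = u * eval3 A (f1 u v, f2 u v, f3 u v)"
      using birational by blast
    have B0: "pullback B \<noteq> 0" using AB(2,3) vanishes_on_iff by blast
    have "[:0, 1:] * pullback B = pullback A"
    proof (rule poly_eqI_cofinite[of "{}"])
      fix y show "poly ([:0, 1:] * pullback B) y = poly (pullback A) y"
        using AB(4)[of 1 y] by (simp add: poly_pullback)
    qed simp
    then have "ratfun_of (A, B) = ratfun_X"
      using B0 by (simp add: ratfun_of_def eq_fract)
    moreover have "(A, B) \<in> fractions_on C" using AB(1,2) B0 by (auto simp: fractions_on_eq)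
    ultimately show ?thesis unfolding S_def image_iff by (intro bexI[of _ "(A, B)"]) (simp_all only:)
  qed
  have pol: "Fract p 1 \<in> S" for p
  proof (induction p)
    case 0
    show ?case using const[of 0] by simp
  next
    case (pCons a p)
    have "Fract (pCons a p) 1 = ratfun_const a + ratfun_X * Fract p 1" by simp
    then show ?case using cl(1)[OF const cl(2)[OF X pCons(2)]] by (simp only:)
  qed
  obtain a b where ab: "z = Fract a b" "b \<noteq> 0" by (cases z)
  then have "z = Fract a 1 * inverse (Fract b 1)" by simp
  moreover have "Fract b 1 \<noteq> 0" using ab(2) by (simp add: Fract_eq_0_iff)
  ultimately have "z \<in> S" using cl(2)[OF pol[of a] inv[OF pol[of b]]] by (simp only: not_False_eq_True)
  then show ?thesis by (auto simp: S_def)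
qed

lemma fraction_fiber_iso: "fraction_fiber \<in> ring_iso ring_of_type_algebra (function_field C)"
  and fraction_fiber_0: "fraction_fiber 0 = \<zero>\<^bsub>function_field C\<^esub>"
proof -
  have carr: "carrier (function_field C) = range fraction_fiber"
  proof -
    have "fraction_rel C `` {P} = fraction_fiber (ratfun_of P)" if "P \<in> fractions_on C" for P
      using that unfolding fraction_fiber_def fraction_rel_eq by auto
    then have "fractions_on C // fraction_rel C = (\<lambda>P. fraction_fiber (ratfun_of P)) ` fractions_on C"
      unfolding quotient_def UNION_singleton_eq_range by (rule image_cong[OF HOL.refl])
    also have "\<dots> = fraction_fiber ` (ratfun_of ` fractions_on C)" by (simp only: image_image)
    also have "ratfun_of ` fractions_on C = UNIV"
      by (rule UNIV_eq_I[symmetric], unfold image_iff) (metis ratfun_of_surj)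
    finally show ?thesis by (simp add: function_field_def)
  qed
  have inj: "inj fraction_fiber"
  proof (rule injI)
    fix x y assume eq: "fraction_fiber x = fraction_fiber y"
    obtain P where "P \<in> fraction_fiber x" using ratfun_of_surj[of x] unfolding fraction_fiber_def by blast
    with eq show "x = y" unfolding fraction_fiber_def by blast
  qed
  have UN: "(\<Union>(A, B)\<in>fraction_fiber x. \<Union>(A', B')\<in>fraction_fiber y. F A B A' B') = Z"
    if F: "\<And>A B A' B'. (A, B) \<in> fractions_on C \<Longrightarrow> (A', B') \<in> fractions_on C \<Longrightarrow>
      ratfun_of (A, B) = x \<Longrightarrow> ratfun_of (A', B') = y \<Longrightarrow> F A B A' B' = Z" for x y F and Z :: "('a poly3 \<times> 'a poly3) set"
  proof -
    obtain p where p: "p \<in> fraction_fiber x" using ratfun_of_surj[of x] unfolding fraction_fiber_def by blast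
    obtain q where q: "q \<in> fraction_fiber y" using ratfun_of_surj[of y] unfolding fraction_fiber_def by blast
    have "F (fst p') (snd p') (fst q') (snd q') = Z"
      if "p' \<in> fraction_fiber x" "q' \<in> fraction_fiber y" for p' q'
      by (rule F) (use that in \<open>simp_all add: fraction_fiber_def\<close>)
    then have "(\<Union>q'\<in>fraction_fiber y. F (fst p') (snd p') (fst q') (snd q')) = Z"
      if "p' \<in> fraction_fiber x" for p'
      using that q by (intro UN_constant_eq[of q]) auto
    then show ?thesis unfolding case_prod_unfold using p by (intro UN_constant_eq[of p]) auto
  qed
  have mult: "fraction_fiber x \<otimes>\<^bsub>function_field C\<^esub> fraction_fiber y = fraction_fiber (x * y)" for x y
    unfolding function_field_def monoid.simps ring.simps
    by (simp, rule UN) (simp add: fraction_class_eq fractions_on_closed)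
  have add: "fraction_fiber x \<oplus>\<^bsub>function_field C\<^esub> fraction_fiber y = fraction_fiber (x + y)" for x y
    unfolding function_field_def monoid.simps ring.simps
    by (simp, rule UN) (simp add: fraction_class_eq fractions_on_closed)
  have c1: "const3 1 = (1 :: 'a poly3)" "const3 0 = (0 :: 'a poly3)" by (auto simp: const3_def one_pCons)
  have one: "fraction_fiber 1 = \<one>\<^bsub>function_field C\<^esub>"
    using fractions_on_const[of 1] by (simp add: function_field_def fraction_class_eq c1 ratfun_const_ops)
  show "fraction_fiber 0 = \<zero>\<^bsub>function_field C\<^esub>"
    using fractions_on_const[of 0] by (simp add: function_field_def fraction_class_eq c1)
  show "fraction_fiber \<in> ring_iso ring_of_type_algebra (function_field C)"
    unfolding ring_iso_def ring_hom_def using inj carr mult add one by (auto simp: bij_betw_def)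
qed

end

text \<open>
  The projection from \<open>P\<close> is \<open>y \<mapsto> (\<mu> y\<^sup>n : \<nu> (1 + y\<^sup>2\<^sup>n))\<close> in the basis \<open>L0, M0\<close>. The last hypothesis, on all
  linear forms through \<open>P\<close>, serves to compare with the projections in other bases.
\<close>

locale dihedral_projection = birational_plane_curve +
  fixes n :: nat and P L0 M0 \<mu> \<nu>
  assumes n: "n > 0" and card: "card (unit_roots n :: 'a set) = n"
    and forms: "projection_forms P L0 M0" and nz: "\<mu> \<noteq> 0" "\<nu> \<noteq> 0"
    and L0: "\<And>y. poly (pullback L0) y = \<mu> * y ^ n" and M0: "\<And>y. poly (pullback M0) y = \<nu> * (1 + y ^ (2 * n))"
    and lin: "\<And>L. homogeneous3 1 L \<Longrightarrow> \<forall>v\<in>P. eval3 L v = 0 \<Longrightarrow> \<exists>\<alpha> \<beta>. \<forall>y. poly (pullback L) y = \<alpha> * y ^ n + \<beta> * (1 + y ^ (2 * n))"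
begin

lemma poly_pullback_binary_form_at:
  "poly (pullback (binary_form_at d a L M)) y = (\<Sum>i\<le>d. a i * poly (pullback L) y ^ i * poly (pullback M) y ^ (d - i))"
  by (simp add: poly_poly3_subst eval3_binary_form_at)

text \<open>
  Linear forms through \<open>P\<close> become invariant functions when they are divided by \<open>y\<^sup>n\<close>, and this factor cancels
  in a quotient of binary forms of the same degree. Conversely, \<open>ratfun_dihedral_fixedE\<close> writes each
  invariant function as such a quotient.
\<close>

lemma projection_field_eq: "projection_field C P = fraction_fiber ` ratfun_dihedral_fixed n"
proof
  show "projection_field C P \<subseteq> fraction_fiber ` ratfun_dihedral_fixed n"
  proof
    fix x assume "x \<in> projection_field C P"
    then obtain L M d a b where x: "x = fraction_class C (binary_form_at d a L M) (binary_form_at d b L M)"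
      "projection_forms P L M" "\<not> vanishes_on (binary_form_at d b L M) C"
      unfolding projection_field_def by blast
    have hL: "homogeneous3 1 L" "homogeneous3 1 M" using x(2) by (auto simp: projection_forms_def)
    note hb = homogeneous3_binary_form_at[OF hL]
    have b0: "pullback (binary_form_at d b L M) \<noteq> 0" using x(3) vanishes_on_iff[OF hb] by blast
    have fr: "(binary_form_at d a L M, binary_form_at d b L M) \<in> fractions_on C"
      using hb b0 by (auto simp: fractions_on_eq)
    note [simp del] = mult_fract divide_fract add_fract
    let ?X = "ratfun_X :: 'a poly fract"
    have lin': "\<exists>w\<in>ratfun_dihedral_fixed n. Fract (pullback L) 1 = ?X ^ n * w"
      if L: "homogeneous3 1 L" "\<forall>v\<in>P. eval3 L v = 0" for L
    proof -
      obtain \<alpha> \<beta> where ab: "\<And>y. poly (pullback L) y = \<alpha> * y ^ n + \<beta> * (1 + y ^ (2 * n))"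
        using lin[OF L] by blast
      have "pullback L = [:\<alpha>:] * [:0, 1:] ^ n + [:\<beta>:] * (1 + [:0, 1:] ^ n * [:0, 1:] ^ n)"
        by (rule poly_eqI_cofinite[of "{}"]) (simp_all add: ab poly_power mult_2 power_add)
      then have "ratfun_eval ?X (pullback L) = ratfun_eval ?X ([:\<alpha>:] * [:0, 1:] ^ n + [:\<beta>:] * (1 + [:0, 1:] ^ n * [:0, 1:] ^ n))"
        by (rule arg_cong)
      moreover have "ratfun_eval ?X ([:0, 1:] ^ n) = ?X ^ n" by (induction n) (simp_all add: ratfun_const_ops)
      then have "ratfun_eval ?X ([:\<alpha>:] * [:0, 1:] ^ n + [:\<beta>:] * (1 + [:0, 1:] ^ n * [:0, 1:] ^ n)) =
          ?X ^ n * (ratfun_const \<alpha> + ratfun_const \<beta> * (?X ^ n + 1 / ?X ^ n))"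
      proof -
        have c: "ratfun_eval ?X [:c:] = ratfun_const c" for c :: 'a by simp
        have "?X ^ n * (ratfun_const \<alpha> + ratfun_const \<beta> * (?X ^ n + 1 / ?X ^ n)) =
            ratfun_const \<alpha> * ?X ^ n + ratfun_const \<beta> * (?X ^ n * ?X ^ n + ?X ^ n * (1 / ?X ^ n))"
          by (simp only: distrib_left mult_ac)
        also have "?X ^ n * (1 / ?X ^ n) = 1" by simp
        finally show ?thesis
          using \<open>ratfun_eval ?X ([:0, 1:] ^ n) = ?X ^ n\<close>
          by (simp only: ratfun_eval_add ratfun_eval_mult ratfun_eval_1 c add.commute)
      qed
      ultimately have "Fract (pullback L) 1 = ?X ^ n * (ratfun_const \<alpha> + ratfun_const \<beta> * (?X ^ n + 1 / ?X ^ n))"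
        by (simp add: ratfun_eval_X)
      moreover have "ratfun_const \<alpha> + ratfun_const \<beta> * (?X ^ n + 1 / ?X ^ n) \<in> ratfun_dihedral_fixed n"
        by (intro ratfun_dihedral_fixed_ops ratfun_dihedral_fixed_const ratfun_dihedral_fixed_generator n)
      ultimately show ?thesis by blast
    qed
    obtain l where l: "l \<in> ratfun_dihedral_fixed n" "Fract (pullback L) 1 = ?X ^ n * l"
      using lin'[OF hL(1)] x(2) by (auto simp: projection_forms_def)
    obtain m where m: "m \<in> ratfun_dihedral_fixed n" "Fract (pullback M) 1 = ?X ^ n * m"
      using lin'[OF hL(2)] x(2) by (auto simp: projection_forms_def)
    have F: "Fract (pullback (binary_form_at d c L M)) 1 = (?X ^ n) ^ d * (\<Sum>i\<le>d. ratfun_const (c i) * l ^ i * m ^ (d - i))" for c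
    proof -
      have "pullback (binary_form_at d c L M) = (\<Sum>i\<le>d. [:c i:] * pullback L ^ i * pullback M ^ (d - i))"
        by (rule poly_eqI_cofinite[of "{}"]) (simp_all add: poly_pullback_binary_form_at poly_sum poly_power mult.assoc)
      then have "ratfun_eval ?X (pullback (binary_form_at d c L M)) =
          ratfun_eval ?X (\<Sum>i\<le>d. [:c i:] * pullback L ^ i * pullback M ^ (d - i))" by (rule arg_cong)
      also have "\<dots> = (\<Sum>i\<le>d. ratfun_const (c i) * ratfun_eval ?X (pullback L) ^ i * ratfun_eval ?X (pullback M) ^ (d - i))"
      proof -
        have s: "ratfun_eval ?X (sum g I) = (\<Sum>i\<in>I. ratfun_eval ?X (g i))" for g and I :: "nat set"
          by (induction I rule: infinite_finite_induct) auto
        have p: "ratfun_eval ?X (g ^ i) = ratfun_eval ?X g ^ i" for g i by (induction i) auto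
        show ?thesis by (simp add: s p del: mult_pCons_left mult_pCons_right)
      qed
      also have "\<dots> = (\<Sum>i\<le>d. (?X ^ n) ^ d * (ratfun_const (c i) * l ^ i * m ^ (d - i)))"
        unfolding ratfun_eval_X l m
      proof (intro sum.cong HOL.refl)
        fix i assume "i \<in> {..d}"
        then have "(?X ^ n) ^ d = (?X ^ n) ^ i * (?X ^ n) ^ (d - i)" by (simp flip: power_add)
        then show "ratfun_const (c i) * (?X ^ n * l) ^ i * (?X ^ n * m) ^ (d - i) =
            (?X ^ n) ^ d * (ratfun_const (c i) * l ^ i * m ^ (d - i))"
          by (simp add: power_mult_distrib mult_ac)
      qed
      finally show ?thesis by (simp only: ratfun_eval_X sum_distrib_left)
    qed
    have "ratfun_of (binary_form_at d a L M, binary_form_at d b L M) =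
        Fract (pullback (binary_form_at d a L M)) 1 / Fract (pullback (binary_form_at d b L M)) 1"
      by (simp add: ratfun_of_def divide_fract)
    also have "\<dots> = (\<Sum>i\<le>d. ratfun_const (a i) * l ^ i * m ^ (d - i)) / (\<Sum>i\<le>d. ratfun_const (b i) * l ^ i * m ^ (d - i))"
      unfolding F by simp
    also have "\<dots> \<in> ratfun_dihedral_fixed n"
      by (intro ratfun_dihedral_fixed_ops ratfun_dihedral_fixed_const l m n)
    finally show "x \<in> fraction_fiber ` ratfun_dihedral_fixed n"
      unfolding x(1) fraction_class_eq[OF fr] by (rule imageI)
  qed
  show "fraction_fiber ` ratfun_dihedral_fixed n \<subseteq> projection_field C P"
  proof safe
    fix z :: "'a poly fract" assume "z \<in> ratfun_dihedral_fixed n"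
    then obtain A B j c d where AB: "z = Fract A B" "B \<noteq> 0"
      "\<And>y. poly A y = dihedral_form n c j y"
      "\<And>y. poly B y = dihedral_form n d j y"
      by (rule ratfun_dihedral_fixedE[OF n card]) (rule that)
    define s where "s = (\<lambda>c l. c l / (\<mu> ^ l * \<nu> ^ (j - l)))"
    have h: "homogeneous3 1 L0" "homogeneous3 1 M0" using forms by (auto simp: projection_forms_def)
    note hb = homogeneous3_binary_form_at[OF h]
    have s: "poly (pullback (binary_form_at j (s c) L0 M0)) y = dihedral_form n c j y" for c y
      unfolding poly_pullback_binary_form_at L0 M0 s_def using nz
      by (intro sum.cong HOL.refl) (simp add: power_mult_distrib)
    have A: "pullback (binary_form_at j (s c) L0 M0) = A"
      by (rule poly_eqI_cofinite[of "{}"]) (simp_all add: s AB)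
    have B: "pullback (binary_form_at j (s d) L0 M0) = B"
      by (rule poly_eqI_cofinite[of "{}"]) (simp_all add: s AB)
    have nv: "\<not> vanishes_on (binary_form_at j (s d) L0 M0) C"
      using vanishes_on_iff[OF hb] B AB(2) by simp
    have "(binary_form_at j (s c) L0 M0, binary_form_at j (s d) L0 M0) \<in> fractions_on C"
      using hb B AB(2) by (auto simp: fractions_on_eq)
    then have "fraction_fiber z = fraction_class C (binary_form_at j (s c) L0 M0) (binary_form_at j (s d) L0 M0)"
      by (simp add: fraction_class_eq ratfun_of_def A B AB(1))
    then show "fraction_fiber z \<in> projection_field C P"
      unfolding projection_field_def using forms nv by blast
  qed
qed

lemma galois_extension_projection: "galois_extension (function_field C) (projection_field C P)"
  unfolding projection_field_eq
  using galois_extension_transport(1)[OF galois_extension_ratfun_dihedral[OF n] fraction_fiber_iso] fraction_fiber_0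
  by simp

lemma galois_group_projection:
  fixes z :: 'a
  assumes "z ^ n = 1" "inj_on (\<lambda>i. z ^ i) {..<n}" "unit_roots n = (\<lambda>i. z ^ i) ` {..<n}"
  shows "galois_group (function_field C) (projection_field C P) \<cong> dihedral_group (2 * n)"
proof -
  have "galois_group (function_field C) (projection_field C P) \<cong>
      galois_group ring_of_type_algebra (ratfun_dihedral_fixed n :: 'a poly fract set)"
    unfolding projection_field_eq
    using galois_extension_transport(2)[OF galois_extension_ratfun_dihedral[OF n] fraction_fiber_iso] fraction_fiber_0
    by simp
  also have "\<dots> \<cong> dihedral_group (2 * n)"
    by (rule galois_group_ratfun_dihedral_iso[OF n assms])
  finally show ?thesis .
qed

end

section \<open>Descending invariant polynomials to the plane\<close>

lemma poly_poly_const: "poly (poly H [:x:]) y = poly (map_poly (\<lambda>c. poly c y) H) x"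
  by (induction H) (simp_all add: map_poly_pCons)

text \<open>
  A polynomial \<open>H\<close> in \<open>x\<close> and \<open>y\<close> that is invariant under \<open>y \<mapsto> \<zeta> y\<close> and, up to the weight, under
  \<open>y \<mapsto> 1/y\<close> is obtained from a form of degree \<open>d\<close> in the plane by substituting the two invariants of the
  dihedral group; its coefficients are covered by \<open>dihedral_invariant_poly\<close>.
\<close>

lemma dihedral_invariant_descends:
  fixes H :: "'k::alg_closed_field poly poly"
  assumes n: "n > 0" and card: "card (unit_roots n :: 'k set) = n" and nz: "\<mu> \<noteq> 0" "\<nu> \<noteq> (0::'k)"
    and deg: "degree H \<le> d"
    and rot: "\<And>\<zeta> x y. \<zeta> \<in> unit_roots n \<Longrightarrow> poly (poly H [:x:]) (\<zeta> * y) = poly (poly H [:x:]) y"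
    and ref: "\<And>x y. y \<noteq> 0 \<Longrightarrow> y ^ (2 * n * d) * poly (poly H [:x / y ^ (2 * n):]) (1 / y) = poly (poly H [:x:]) y"
  shows "\<exists>F. homogeneous3 d F \<and> degree F \<le> d \<and>
    (\<forall>x y. eval3 F (x, \<mu> * y ^ n, \<nu> * (1 + y ^ (2 * n))) = poly (poly H [:x:]) y) \<and>
    (\<forall>x. eval3 F (x, 0, 0) = poly (coeff H d) 0 * x ^ d) \<and> (coeff H d = 1 \<longrightarrow> coeff F d = 1)"
proof -
  let ?s = "\<lambda>y. map_poly (\<lambda>c. poly c y) H"
  have cs: "coeff (?s y) i = poly (coeff H i) y" for y i by (simp add: coeff_map_poly)
  have rot_i: "poly (coeff H i) (\<zeta> * y) = poly (coeff H i) y" if "\<zeta> \<in> unit_roots n" for \<zeta> y i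
  proof -
    have "?s (\<zeta> * y) = ?s y"
      by (rule poly_eqI_cofinite[of "{}"]) (use rot[OF that] in \<open>simp_all add: poly_poly_const\<close>)
    then show ?thesis using cs by metis
  qed
  have ref_i: "y ^ (2 * n * (d - i)) * poly (coeff H i) (1 / y) = poly (coeff H i) y" if y: "y \<noteq> 0" and i: "i \<le> d" for y i
  proof -
    have "smult (y ^ (2 * n * d)) (pcompose (?s (1 / y)) [:0, 1 / y ^ (2 * n):]) = ?s y"
      by (rule poly_eqI_cofinite[of "{}"]) (use ref[OF y] in \<open>simp_all add: poly_poly_const poly_pcompose\<close>)
    then have "coeff (smult (y ^ (2 * n * d)) (pcompose (?s (1 / y)) [:0, 1 / y ^ (2 * n):])) i = coeff (?s y) i"
      by (rule arg_cong)
    then have "y ^ (2 * n * d) * ((1 / y ^ (2 * n)) ^ i * poly (coeff H i) (1 / y)) = poly (coeff H i) y"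
      by (simp add: cs coeff_pcompose_linear)
    moreover have "2 * n * d = 2 * n * (d - i) + 2 * n * i" using i by (simp flip: distrib_left)
    then have "y ^ (2 * n * d) = y ^ (2 * n * (d - i)) * (y ^ (2 * n)) ^ i" by (simp only: power_add power_mult)
    ultimately show ?thesis using y by (simp add: power_divide)
  qed
  have "\<forall>i. \<exists>c. i \<le> d \<longrightarrow> (\<forall>y. poly (coeff H i) y = dihedral_form n c (d - i) y)"
  proof
    fix i show "\<exists>c. i \<le> d \<longrightarrow> (\<forall>y. poly (coeff H i) y = dihedral_form n c (d - i) y)"
      using dihedral_invariant_poly[OF n card rot_i[where i = i] ref_i[where i = i]] by (cases "i \<le> d") blast+
  qed
  then obtain c where c: "\<And>i y. i \<le> d \<Longrightarrow> poly (coeff H i) y = dihedral_form n (c i) (d - i) y"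
    by metis
  define m where "m = (\<lambda>i l. monom (monom (monom (c i l / (\<mu> ^ l * \<nu> ^ (d - i - l))) (d - i - l)) l) i)"
  define F where "F = (\<Sum>i\<le>d. \<Sum>l\<le>d - i. m i l)"
  have ev_m: "eval3 (m i l) (x, Y, Z) = c i l / (\<mu> ^ l * \<nu> ^ (d - i - l)) * Z ^ (d - i - l) * Y ^ l * x ^ i" for i l x Y Z
    by (simp add: m_def eval3_def poly_monom poly_power)
  have hom: "homogeneous3 d F"
    unfolding F_def
  proof (intro homogeneous3_sum)
    fix i l assume "i \<in> {..d}" "l \<in> {..d - i}"
    then show "homogeneous3 d (m i l)" by (auto simp: homogeneous3_def m_def coeff_monom split: if_splits)
  qed
  have degF: "degree F \<le> d"
    unfolding F_def m_def by (intro degree_sum_le) (auto intro!: degree_sum_le order.trans[OF degree_monom_le])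
  have ev: "eval3 F (x, \<mu> * y ^ n, \<nu> * (1 + y ^ (2 * n))) = poly (poly H [:x:]) y" for x y
  proof -
    have "eval3 F (x, \<mu> * y ^ n, \<nu> * (1 + y ^ (2 * n))) = (\<Sum>i\<le>d. poly (coeff H i) y * x ^ i)"
      unfolding F_def eval3_sum ev_m
    proof (intro sum.cong HOL.refl)
      fix i assume i: "i \<in> {..d}"
      have "(\<Sum>l\<le>d - i. c i l / (\<mu> ^ l * \<nu> ^ (d - i - l)) * (\<nu> * (1 + y ^ (2 * n))) ^ (d - i - l) * (\<mu> * y ^ n) ^ l * x ^ i)
        = (\<Sum>l\<le>d - i. c i l * (y ^ n) ^ l * (1 + y ^ (2 * n)) ^ (d - i - l) * x ^ i)"
        by (intro sum.cong HOL.refl) (use nz in \<open>simp add: power_mult_distrib\<close>)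
      then show "(\<Sum>l\<le>d - i. c i l / (\<mu> ^ l * \<nu> ^ (d - i - l)) * (\<nu> * (1 + y ^ (2 * n))) ^ (d - i - l) * (\<mu> * y ^ n) ^ l * x ^ i)
        = poly (coeff H i) y * x ^ i"
        using c[of i y] i by (simp add: sum_distrib_right)
    qed
    also have "\<dots> = poly (?s y) x"
      by (subst poly_extend_sum[where w = d]) (use deg in \<open>auto simp: cs coeff_eq_0 intro!: degree_le\<close>)
    finally show ?thesis by (simp add: poly_poly_const)
  qed
  have ev0: "eval3 F (x, 0, 0) = poly (coeff H d) 0 * x ^ d" for x
  proof -
    have z: "(\<Sum>l\<le>d - i. c i l / (\<mu> ^ l * \<nu> ^ (d - i - l)) * 0 ^ (d - i - l) * 0 ^ l * x ^ i) = 0" if "i < d" for i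
      using that by (intro sum.neutral) (auto simp: power_0_left)
    have "eval3 F (x, 0, 0) = (\<Sum>i\<in>insert d {..<d}. \<Sum>l\<le>d - i. c i l / (\<mu> ^ l * \<nu> ^ (d - i - l)) * 0 ^ (d - i - l) * 0 ^ l * x ^ i)"
      unfolding F_def eval3_sum ev_m by (rule sum.cong) auto
    also have "\<dots> = c d 0 * x ^ d"
    proof -
      have "(\<Sum>i<d. \<Sum>l\<le>d - i. c i l / (\<mu> ^ l * \<nu> ^ (d - i - l)) * 0 ^ (d - i - l) * 0 ^ l * x ^ i) = 0"
        by (intro sum.neutral ballI z) simp
      then show ?thesis by (subst sum.insert) (simp_all only: finite_lessThan lessThan_iff, simp_all)
    qed
    finally show ?thesis using c[of d 0] by simp
  qed
  have "coeff F d = 1" if H1: "coeff H d = 1"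
  proof -
    have "coeff F d = (\<Sum>i\<in>insert d {..<d}. \<Sum>l\<le>d - i. coeff (m i l) d)"
      unfolding F_def coeff_sum by (rule sum.cong) auto
    also have "\<dots> = coeff (m d 0) d" by (subst sum.insert) (auto simp: m_def)
    also have "\<dots> = 1" using c[of d 0] H1 by (simp add: m_def monom_0 one_pCons)
    finally show ?thesis .
  qed
  then show ?thesis using hom degF ev ev0 by blast
qed

section \<open>Plane curves with a dihedral projection\<close>

lemma sum_prod_diff_reindex:
  fixes a b :: "'i \<Rightarrow> 'b::comm_ring_1"
  assumes "bij_betw \<pi> I I" "finite I"
  shows "(\<Sum>i\<in>I. b (\<pi> i) * (\<Prod>j\<in>I - {i}. x - a (\<pi> j))) = (\<Sum>i\<in>I. b i * (\<Prod>j\<in>I - {i}. x - a j))"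
proof -
  have "(\<Prod>j\<in>I - {i}. x - a (\<pi> j)) = (\<Prod>j\<in>I - {\<pi> i}. x - a j)" if "i \<in> I" for i
  proof -
    have "bij_betw \<pi> (I - {i}) (I - {\<pi> i})"
      using assms(1) that by (auto simp: bij_betw_def inj_on_def)
    from prod.reindex_bij_betw[OF this, of "\<lambda>j. x - a j"] show ?thesis .
  qed
  then have "(\<Sum>i\<in>I. b (\<pi> i) * (\<Prod>j\<in>I - {i}. x - a (\<pi> j))) = (\<Sum>i\<in>I. b (\<pi> i) * (\<Prod>j\<in>I - {\<pi> i}. x - a j))"
    by (intro sum.cong) auto
  also have "\<dots> = (\<Sum>i\<in>I. b i * (\<Prod>j\<in>I - {i}. x - a j))"
    by (rule sum.reindex_bij_betw[OF assms(1), of "\<lambda>i. b i * (\<Prod>j\<in>I - {i}. x - a j)"])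
  finally show ?thesis .
qed

text \<open>
  For a form \<open>f\<close> with restrictions \<open>p\<close> and \<open>r\<close> to the two charts, these are the restrictions to the first chart
  of \<open>f (u, \<zeta> v)\<close> and, when \<open>e\<close> holds, of \<open>f (\<zeta> v, u)\<close>.
\<close>

definition dihedral_conj :: "'k::field poly \<Rightarrow> 'k poly \<Rightarrow> 'k \<times> bool \<Rightarrow> 'k poly" where
  "dihedral_conj p r = (\<lambda>(\<zeta>, e). pcompose (if e then r else p) [:0, \<zeta>:])"

abbreviation dihedral_index :: "nat \<Rightarrow> ('k::field \<times> bool) set" where
  "dihedral_index n \<equiv> unit_roots n \<times> UNIV"

lemma poly_dihedral_conj: "poly (dihedral_conj p r (\<zeta>, e)) y = poly (if e then r else p) (\<zeta> * y)"
  by (simp add: dihedral_conj_def poly_pcompose mult.commute)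

lemma binary_form_chart:
  assumes "binary_form N f p r" "y \<noteq> 0"
  shows "poly r y = y ^ N * poly p (1 / y)" "poly p y = y ^ N * poly r (1 / y)"
proof -
  have *: "poly r y = y ^ N * poly p (1 / y)" if "y \<noteq> 0" for y
    using assms(1) that unfolding binary_form_def by (metis div_by_1 mult_1 one_neq_zero power_one)
  show "poly r y = y ^ N * poly p (1 / y)" by (rule *[OF assms(2)])
  show "poly p y = y ^ N * poly r (1 / y)"
    using *[of "1 / y"] assms(2) by (simp add: power_divide)
qed

lemma dihedral_conj_rot:
  "poly (dihedral_conj p r i) (\<xi> * y) = poly (dihedral_conj p r (map_prod ((*) \<xi>) id i)) y"
  by (cases i) (simp add: poly_dihedral_conj mult_ac)

lemma dihedral_conj_refl:
  assumes "binary_form (2 * n) f p r" "y \<noteq> 0" "i \<in> dihedral_index n" "n > 0"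
  shows "y ^ (2 * n) * poly (dihedral_conj p r i) (1 / y) = poly (dihedral_conj p r (map_prod inverse Not i)) y"
proof -
  obtain \<zeta> e where i: "i = (\<zeta>, e)" by (cases i)
  have z: "\<zeta> \<noteq> 0" "\<zeta> \<in> unit_roots n" using assms(3,4) unit_roots_nz by (auto simp: i)
  have "\<zeta> ^ (2 * n) = 1" using unit_rootsD[OF z(2)] by (simp add: power_mult mult.commute[of 2])
  moreover have "1 / (\<zeta> / y) = inverse \<zeta> * y" by (simp add: divide_inverse)
  ultimately show ?thesis
    using binary_form_chart[OF assms(1), of "\<zeta> / y"] z(1) assms(2)
    by (simp add: i poly_dihedral_conj power_divide)
qed

lemma bij_dihedral_index:
  assumes "n > 0"
  shows "\<xi> \<in> unit_roots n \<Longrightarrow> bij_betw (map_prod ((*) \<xi>) id) (dihedral_index n) (dihedral_index n)"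
    "bij_betw (map_prod inverse Not) (dihedral_index n) (dihedral_index n :: ('k::field \<times> bool) set)"
proof -
  show "\<xi> \<in> unit_roots n \<Longrightarrow> bij_betw (map_prod ((*) \<xi>) id) (dihedral_index n) (dihedral_index n)"
    by (intro bij_betw_map_prod bij_unit_roots_mult assms) auto
  have "bij Not" by (rule involuntory_imp_bij) simp
  then show "bij_betw (map_prod inverse Not) (dihedral_index n) (dihedral_index n :: ('k::field \<times> bool) set)"
    by (intro bij_betw_map_prod bij_unit_roots_inverse)
qed

text \<open>
  With \<open>U = u\<^sup>n\<close> and \<open>V = v\<^sup>n\<close>, the equations determine \<open>(U + V)\<^sup>2 = c + 2b\<close> and \<open>(U - V)\<^sup>2 = c - 2b\<close>.
\<close>

lemma solve_product_and_square_sum: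
  fixes b c :: "'k::alg_closed_field"
  assumes n: "n > 0" and two: "(2::'k) \<noteq> 0"
  shows "\<exists>u v. u ^ n * v ^ n = b \<and> u ^ (2 * n) + v ^ (2 * n) = c"
proof -
  obtain s where s: "s ^ 2 = c + 2 * b" using nth_root_exists[of 2 "c + 2 * b"] by auto
  obtain t where t: "t ^ 2 = c - 2 * b" using nth_root_exists[of 2 "c - 2 * b"] by auto
  obtain u where u: "u ^ n = (s + t) / 2" using nth_root_exists[OF n] by blast
  obtain v where v: "v ^ n = (s - t) / 2" using nth_root_exists[OF n] by blast
  have four: "2 * 2 \<noteq> (0::'k)" by (rule no_zero_divisors[OF two two])
  have uv: "2 * u ^ n = s + t" "2 * v ^ n = s - t" using two by (simp_all add: u v)
  have "2 * 2 * (u ^ n * v ^ n) = (2 * u ^ n) * (2 * v ^ n)" by (simp only: mult_ac)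
  also have "\<dots> = s ^ 2 - t ^ 2" unfolding uv by (simp only: power2_eq_square square_diff_square_factored)
  also have "\<dots> = 2 * 2 * b" unfolding s t by (simp only: mult_2 distrib_right) simp
  finally have 1: "u ^ n * v ^ n = b" using four by (rule mult_left_cancel[THEN iffD1, rotated])
  have "2 * 2 * ((u ^ n) ^ 2 + (v ^ n) ^ 2) = (2 * u ^ n) ^ 2 + (2 * v ^ n) ^ 2"
    by (simp only: power2_eq_square distrib_left mult_ac)
  also have "\<dots> = 2 * (s ^ 2 + t ^ 2)" unfolding uv
    by (simp add: power2_eq_square algebra_simps)
  also have "\<dots> = 2 * 2 * c" unfolding s t by (simp add: algebra_simps)
  finally have "(u ^ n) ^ 2 + (v ^ n) ^ 2 = c" using four by (rule mult_left_cancel[THEN iffD1, rotated])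
  then have "u ^ (2 * n) + v ^ (2 * n) = c" by (simp only: mult.commute[of 2 n] power_mult)
  then show ?thesis using 1 by blast
qed

lemma binary_form_product_power:
  "binary_form (2 * n) (\<lambda>u v. \<mu> * (u ^ n * v ^ n)) (monom \<mu> n) (monom \<mu> n)"
  unfolding binary_form_def
proof (intro conjI allI impI)
  fix u v :: 'a
  show "\<mu> * (u ^ n * v ^ n) = u ^ (2 * n) * poly (monom \<mu> n) (v / u)" if "u \<noteq> 0"
    using that by (simp add: poly_monom mult_2 power_add power_divide)
  show "\<mu> * (u ^ n * v ^ n) = v ^ (2 * n) * poly (monom \<mu> n) (u / v)" if "v \<noteq> 0"
    using that by (simp add: poly_monom mult_2 power_add power_divide)
qed

lemma binary_form_power_sum:
  "binary_form N (\<lambda>u v. \<nu> * (u ^ N + v ^ N)) ([:\<nu>:] + monom \<nu> N) ([:\<nu>:] + monom \<nu> N)"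
  unfolding binary_form_def
proof (intro conjI allI impI)
  fix u v :: 'a
  show "\<nu> * (u ^ N + v ^ N) = u ^ N * poly ([:\<nu>:] + monom \<nu> N) (v / u)" if "u \<noteq> 0"
    using that by (simp add: poly_monom power_divide distrib_left mult.commute)
  show "\<nu> * (u ^ N + v ^ N) = v ^ N * poly ([:\<nu>:] + monom \<nu> N) (u / v)" if "v \<noteq> 0"
    using that by (simp add: poly_monom power_divide distrib_left mult.commute)
qed

text \<open>
  Two coordinates of the curve are the invariants of the dihedral group, while the remaining one, \<open>f\<close>, has
  trivial stabiliser.
\<close>

locale dihedral_plane_curve =
  fixes n :: nat and f :: "'k::alg_closed_field \<Rightarrow> 'k \<Rightarrow> 'k" and p r :: "'k poly" and \<mu> \<nu> :: 'k
    and C :: "('k \<times> 'k \<times> 'k) set set"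
  assumes n: "n > 0" and card: "card (unit_roots n :: 'k set) = n" and two: "(2::'k) \<noteq> 0"
    and f: "binary_form (2 * n) f p r" and nz: "\<mu> \<noteq> 0" "\<nu> \<noteq> 0"
    and inj: "inj_on (dihedral_conj p r) (dihedral_index n)"
    and C: "C = {proj_point (f u v) (\<mu> * (u ^ n * v ^ n)) (\<nu> * (u ^ (2 * n) + v ^ (2 * n))) | u v. (u, v) \<noteq> (0, 0)}"
begin

sublocale rational_plane_curve "2 * n" f "\<lambda>u v. \<mu> * (u ^ n * v ^ n)" "\<lambda>u v. \<nu> * (u ^ (2 * n) + v ^ (2 * n))"
  p "monom \<mu> n" "[:\<nu>:] + monom \<nu> (2 * n)" r "monom \<mu> n" "[:\<nu>:] + monom \<nu> (2 * n)" C
proof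
  show "binary_form (2 * n) (\<lambda>u v. \<mu> * (u ^ n * v ^ n)) (monom \<mu> n) (monom \<mu> n)"
    by (rule binary_form_product_power)
  show "binary_form (2 * n) (\<lambda>u v. \<nu> * (u ^ (2 * n) + v ^ (2 * n))) ([:\<nu>:] + monom \<nu> (2 * n)) ([:\<nu>:] + monom \<nu> (2 * n))"
    by (rule binary_form_power_sum)
qed (use f C in auto)

abbreviation cone :: "'k \<Rightarrow> 'k \<Rightarrow> 'k \<times> 'k \<times> 'k" where
  "cone x y \<equiv> (x, \<mu> * y ^ n, \<nu> * (1 + y ^ (2 * n)))"

text \<open>The point of the curve with parameter \<open>(1 : y)\<close>, in the affine chart where the second coordinate is \<open>1\<close>.\<close>

abbreviation chart :: "'k \<Rightarrow> 'k \<times> 'k \<times> 'k" where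
  "chart y \<equiv> (poly p y / (\<mu> * y ^ n), 1, \<nu> * (1 + y ^ (2 * n)) / (\<mu> * y ^ n))"

abbreviation Ind :: "('k \<times> bool) set" where "Ind \<equiv> dihedral_index n"
abbreviation conj_form :: "'k \<times> bool \<Rightarrow> 'k poly" where "conj_form \<equiv> dihedral_conj p r"

lemma finite_Ind: "finite Ind" and card_Ind: "card Ind = 2 * n"
proof -
  have "finite (unit_roots n :: 'k set)" by (rule finite_unit_roots[OF n])
  then show "finite Ind" "card Ind = 2 * n" using card by (auto simp: card_cartesian_product)
qed

text \<open>The norm of \<open>x - f\<close> over the field of invariants, as a polynomial in \<open>x\<close>.\<close>

definition norm_poly :: "'k poly poly" where
  "norm_poly = (\<Prod>i\<in>Ind. [:- conj_form i, 1:])"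

abbreviation norm_value :: "'k \<Rightarrow> 'k \<Rightarrow> 'k" where
  "norm_value x y \<equiv> poly (poly norm_poly [:x:]) y"

lemma poly_norm_poly: "norm_value x y = (\<Prod>i\<in>Ind. x - poly (conj_form i) y)"
  by (simp add: norm_poly_def poly_prod)

lemma degree_norm_poly: "degree norm_poly = 2 * n" "coeff norm_poly (2 * n) = 1"
proof -
  show d: "degree norm_poly = 2 * n"
    unfolding norm_poly_def by (subst degree_prod_eq_sum_degree) (auto simp: card_Ind)
  have "lead_coeff norm_poly = 1" unfolding norm_poly_def lead_coeff_prod by simp
  then show "coeff norm_poly (2 * n) = 1" using d by simp
qed

lemma equation_exists:
  "\<exists>F. homogeneous3 (2 * n) F \<and> degree F \<le> 2 * n \<and>
    (\<forall>x y. eval3 F (cone x y) = norm_value x y) \<and>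
    (\<forall>x. eval3 F (x, 0, 0) = x ^ (2 * n)) \<and> coeff F (2 * n) = 1"
proof -
  have rot: "poly (poly norm_poly [:x:]) (\<zeta> * y) = norm_value x y" if "\<zeta> \<in> unit_roots n" for \<zeta> x y
    unfolding poly_norm_poly dihedral_conj_rot
    by (rule prod.reindex_bij_betw[OF bij_dihedral_index(1)[OF n that], of "\<lambda>i. x - poly (conj_form i) y"])
  have ref: "y ^ (2 * n * (2 * n)) * poly (poly norm_poly [:x / y ^ (2 * n):]) (1 / y) = norm_value x y"
    if y: "y \<noteq> 0" for x y
  proof -
    have "y ^ (2 * n * (2 * n)) = (\<Prod>i\<in>Ind. y ^ (2 * n))" by (simp add: card_Ind flip: power_mult)
    then have "y ^ (2 * n * (2 * n)) * poly (poly norm_poly [:x / y ^ (2 * n):]) (1 / y) =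
        (\<Prod>i\<in>Ind. y ^ (2 * n) * (x / y ^ (2 * n) - poly (conj_form i) (1 / y)))"
      unfolding poly_norm_poly by (simp only: prod.distrib)
    also have "\<dots> = (\<Prod>i\<in>Ind. x - poly (conj_form (map_prod inverse Not i)) y)"
      by (rule prod.cong[OF HOL.refl]) (use y in \<open>simp add: right_diff_distrib dihedral_conj_refl[OF f y _ n]\<close>)
    also have "\<dots> = norm_value x y"
      unfolding poly_norm_poly
      by (rule prod.reindex_bij_betw[OF bij_dihedral_index(2)[OF n], of "\<lambda>i. x - poly (conj_form i) y"])
    finally show ?thesis .
  qed
  show ?thesis
    using dihedral_invariant_descends[OF n card nz order.eq_iff[THEN iffD1, THEN conjunct1, OF degree_norm_poly(1)] rot ref]
      degree_norm_poly(2) by auto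
qed

text \<open>
  Over a point \<open>(b, c)\<close> of the affine cone of the projection, the roots \<open>x\<close> of the norm are the values of
  \<open>f\<close> at the points of the fibre.
\<close>

lemma norm_poly_root:
  assumes "u \<noteq> 0" "poly (poly norm_poly [:a / u ^ (2 * n):]) (v / u) = 0"
  shows "\<exists>u' v'. (u', v') \<noteq> (0, 0) \<and> f u' v' = a \<and> u' ^ n * v' ^ n = u ^ n * v ^ n \<and>
    u' ^ (2 * n) + v' ^ (2 * n) = u ^ (2 * n) + v ^ (2 * n)"
proof -
  obtain \<zeta> e where z: "\<zeta> \<in> unit_roots n" "a / u ^ (2 * n) = poly (conj_form (\<zeta>, e)) (v / u)"
    using assms(2) finite_Ind by (auto simp: poly_norm_poly)
  have zn: "\<zeta> ^ n = 1" "\<zeta> ^ (2 * n) = 1"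
    using unit_rootsD[OF z(1)] by (auto simp: power_mult mult.commute[of 2])
  have a: "a = u ^ (2 * n) * poly (if e then r else p) (\<zeta> * v / u)"
    using z(2) assms(1) unfolding poly_dihedral_conj by (simp add: field_simps)
  show ?thesis
  proof (cases e)
    case False
    then have "f u (\<zeta> * v) = a" using a assms(1) f by (simp add: binary_form_def)
    then show ?thesis using assms(1) zn by (intro exI[of _ u] exI[of _ "\<zeta> * v"]) (simp add: power_mult_distrib)
  next
    case True
    then have "f (\<zeta> * v) u = a" using a assms(1) f by (simp add: binary_form_def)
    then show ?thesis using assms(1) zn
      by (intro exI[of _ "\<zeta> * v"] exI[of _ u]) (simp add: power_mult_distrib mult.commute add.commute)
  qed
qed

lemma pullback_equation:
  assumes "\<And>x y. eval3 F (cone x y) = norm_value x y"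
  shows "pullback F = 0"
proof (rule poly_eqI_cofinite[of "{}"])
  fix y
  have "(1, False) \<in> Ind" by simp
  then have "poly (poly norm_poly [:poly p y:]) y = 0"
    unfolding poly_norm_poly
    by (intro prod_zero finite_Ind bexI[of _ "(1, False)"]) (simp_all add: poly_dihedral_conj)
  then show "poly (pullback F) y = poly 0 y"
    using assms[of "poly p y" y] by (simp add: poly_poly3_subst poly_monom distrib_left)
qed simp

text \<open>
  A point \<open>(a : b : c)\<close> with \<open>(b, c) = (0, 0)\<close> is excluded because the equation is monic in \<open>x\<close>. All other
  pairs \<open>(b, c)\<close> are values of the two invariants at some \<open>(u, v)\<close>, and by the symmetry in \<open>u\<close> and \<open>v\<close> one
  may take \<open>u \<noteq> 0\<close>.
\<close>

lemma zero_locus_equation: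
  assumes hom: "homogeneous3 (2 * n) F"
    and ev: "\<And>x y. eval3 F (cone x y) = norm_value x y"
    and ev0: "\<And>x. eval3 F (x, 0, 0) = x ^ (2 * n)"
  shows "C = zero_locus F"
proof
  have v: "vanishes_on F C" using vanishes_on_iff[OF hom] pullback_equation[OF ev] by blast
  have "C \<subseteq> proj_plane"
  proof
    fix Q assume "Q \<in> C"
    then obtain u v where uv: "(u, v) \<noteq> (0, 0)"
      "Q = proj_point (f u v) (\<mu> * (u ^ n * v ^ n)) (\<nu> * (u ^ (2 * n) + v ^ (2 * n)))" unfolding C by blast
    have "(\<mu> * (u ^ n * v ^ n), \<nu> * (u ^ (2 * n) + v ^ (2 * n))) \<noteq> (0, 0)"
      using uv(1) nz n by (auto simp: power_0_left)
    then show "Q \<in> proj_plane" unfolding proj_plane_def uv(2) by blast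
  qed
  then show "C \<subseteq> zero_locus F" using v unfolding zero_locus_def vanishes_on_def by blast
  show "zero_locus F \<subseteq> C"
  proof
    fix Q assume "Q \<in> zero_locus F"
    then obtain a b c where Q: "Q = proj_point a b c" "(a, b, c) \<noteq> (0, 0, 0)" "\<forall>v\<in>Q. eval3 F v = 0"
      unfolding zero_locus_def proj_plane_def by blast
    have "(a, b, c) \<in> Q" unfolding Q(1) proj_point_def by (auto intro!: exI[of _ 1])
    then have F0: "eval3 F (a, b, c) = 0" using Q(3) by blast
    obtain u0 v0 where uv0: "u0 ^ n * v0 ^ n = b / \<mu>" "u0 ^ (2 * n) + v0 ^ (2 * n) = c / \<nu>"
      using solve_product_and_square_sum[OF n two] by blast
    have "(u0, v0) \<noteq> (0, 0)"
    proof
      assume "(u0, v0) = (0, 0)"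
      then have "b = 0" "c = 0" using uv0 nz n by (auto simp: power_0_left)
      then have "a ^ (2 * n) = 0" using F0 ev0 by simp
      then show False using Q(2) \<open>b = 0\<close> \<open>c = 0\<close> by simp
    qed
    then obtain u v where uv: "u \<noteq> 0" "u ^ n * v ^ n = b / \<mu>" "u ^ (2 * n) + v ^ (2 * n) = c / \<nu>"
      using uv0 by (metis add.commute mult.commute prod.inject)
    have b: "b = u ^ (2 * n) * (\<mu> * (v / u) ^ n)"
    proof -
      have "u ^ (2 * n) * (v / u) ^ n = u ^ n * v ^ n"
        using uv(1) by (simp add: power_divide mult_2 power_add)
      then show ?thesis using uv(2) nz by (simp add: mult.left_commute)
    qed
    have c: "c = u ^ (2 * n) * (\<nu> * (1 + (v / u) ^ (2 * n)))"
    proof -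
      have "u ^ (2 * n) * (1 + (v / u) ^ (2 * n)) = u ^ (2 * n) + v ^ (2 * n)"
        using uv(1) by (simp add: power_divide distrib_left)
      then show ?thesis using uv(3) nz by (simp add: mult.left_commute)
    qed
    have "a = u ^ (2 * n) * (a / u ^ (2 * n))" using uv(1) by simp
    then have "eval3 F (a, b, c) = (u ^ (2 * n)) ^ (2 * n) * eval3 F (a / u ^ (2 * n), \<mu> * (v / u) ^ n, \<nu> * (1 + (v / u) ^ (2 * n)))"
      using eval3_scale[OF hom, of "u ^ (2 * n)" "a / u ^ (2 * n)" "\<mu> * (v / u) ^ n" "\<nu> * (1 + (v / u) ^ (2 * n))"]
      by (simp flip: b c)
    then have "poly (poly norm_poly [:a / u ^ (2 * n):]) (v / u) = 0"
      using F0 uv(1) by (simp add: ev)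
    then obtain u' v' where uv': "(u', v') \<noteq> (0, 0)" "f u' v' = a" "u' ^ n * v' ^ n = b / \<mu>"
      "u' ^ (2 * n) + v' ^ (2 * n) = c / \<nu>"
      using norm_poly_root[OF uv(1)] uv(2,3) by metis
    then have "Q = proj_point (f u' v') (\<mu> * (u' ^ n * v' ^ n)) (\<nu> * (u' ^ (2 * n) + v' ^ (2 * n)))"
      using nz by (simp add: Q(1))
    then show "Q \<in> C" unfolding C using uv'(1) by blast
  qed
qed

text \<open>
  A factor of the equation is not known beforehand to be homogeneous, so it matters which vector represents
  a point. In the affine chart the coordinates are Laurent polynomials in \<open>y\<close>, and a power of \<open>y\<close> clears the
  denominators.
\<close>

lemma eval3_chart_poly:
  obtains G K where "\<And>y. y \<noteq> 0 \<Longrightarrow>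
    poly G y = y ^ K * eval3 A (chart y)"
proof -
  define L where "L = (\<Sum>i\<le>degree A. \<Sum>j\<le>degree (coeff A i). degree (coeff (coeff A i) j))"
  define K where "K = degree A + L"
  let ?q = "[:\<nu>:] + monom \<nu> (2 * n)"
  define G where "G = (\<Sum>i\<le>degree A. \<Sum>j\<le>degree (coeff A i). \<Sum>l\<le>degree (coeff (coeff A i) j).
    smult (coeff (coeff (coeff A i) j) l / \<mu> ^ (i + l)) (p ^ i * ?q ^ l * monom 1 (n * (K - (i + l)))))"
  have "poly G y = y ^ (n * K) * eval3 A (chart y)"
    if y: "y \<noteq> 0" for y
    unfolding G_def eval3_altdef poly_sum sum_distrib_left
  proof (intro sum.cong HOL.refl)
    fix i j l assume i: "i \<in> {..degree A}" and j: "j \<in> {..degree (coeff A i)}" and l: "l \<in> {..degree (coeff (coeff A i) j)}"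
    have "degree (coeff (coeff A i) j) \<le> (\<Sum>j\<le>degree (coeff A i). degree (coeff (coeff A i) j))"
      using j by (intro member_le_sum) auto
    also have "\<dots> \<le> L" unfolding L_def
      using i by (intro member_le_sum[of i _ "\<lambda>i. \<Sum>j\<le>degree (coeff A i). degree (coeff (coeff A i) j)"]) auto
    finally have il: "i + l \<le> K" using i l by (simp add: K_def)
    then have "n * K = n * (i + l) + n * (K - (i + l))" by (simp flip: distrib_left)
    then have "y ^ (n * K) = (y ^ n) ^ i * (y ^ n) ^ l * y ^ (n * (K - (i + l)))"
      by (simp add: power_add power_mult)
    define P where "P = poly p y"
    define Q where "Q = \<nu> * (1 + y ^ (2 * n))"
    define a where "a = y ^ n"
    have a: "a \<noteq> 0" using y by (simp add: a_def)
    have q: "poly ?q y = Q" by (simp add: Q_def poly_monom distrib_left)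
    have aP: "a ^ k * (w / (\<mu> * a)) ^ k = w ^ k / \<mu> ^ k" for w k
      using a by (simp add: power_divide power_mult_distrib)
    have "y ^ (n * K) * (coeff (coeff (coeff A i) j) l * ((P / (\<mu> * a)) ^ i * 1 ^ j * (Q / (\<mu> * a)) ^ l)) =
      coeff (coeff (coeff A i) j) l * y ^ (n * (K - (i + l))) * (a ^ i * (P / (\<mu> * a)) ^ i) * (a ^ l * (Q / (\<mu> * a)) ^ l)"
      unfolding \<open>y ^ (n * K) = _\<close> by (simp only: a_def power_one mult_1_right mult_1_left mult_ac)
    also have "\<dots> = coeff (coeff (coeff A i) j) l / \<mu> ^ (i + l) * (P ^ i * Q ^ l * y ^ (n * (K - (i + l))))"
      unfolding aP by (simp add: power_add)
    finally show "poly (smult (coeff (coeff (coeff A i) j) l / \<mu> ^ (i + l)) (p ^ i * ?q ^ l * monom 1 (n * (K - (i + l))))) y =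
      y ^ (n * K) * (coeff (coeff (coeff A i) j) l * ((poly p y / (\<mu> * y ^ n)) ^ i * 1 ^ j * (\<nu> * (1 + y ^ (2 * n)) / (\<mu> * y ^ n)) ^ l))"
      unfolding poly_smult poly_mult poly_power q by (simp add: poly_monom P_def Q_def a_def)
  qed
  then show ?thesis by (rule that)
qed

lemma conj_poly_separates:
  assumes "finite (E :: 'k set)"
  obtains y where "y \<notin> E" "inj_on (\<lambda>i. poly (conj_form i) y) Ind"
proof -
  define D where "D = (\<Prod>(i, j)\<in>{(i, j) \<in> Ind \<times> Ind. i \<noteq> j}. conj_form i - conj_form j)"
  have fin: "finite {(i, j) \<in> Ind \<times> Ind. i \<noteq> j}"
    using finite_Ind by (rule_tac finite_subset[of _ "Ind \<times> Ind"]) auto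
  have "D \<noteq> 0" unfolding D_def using inj fin by (auto simp: inj_on_def)
  then have "finite (E \<union> {y. poly D y = 0})" using assms poly_roots_finite by blast
  then obtain y where y: "y \<notin> E" "poly D y \<noteq> 0"
    using infinite_UNIV_alg_closed[where 'k = 'k] ex_new_if_finite by blast
  have "inj_on (\<lambda>i. poly (conj_form i) y) Ind"
  proof (rule inj_onI, rule ccontr)
    fix i j assume ij: "i \<in> Ind" "j \<in> Ind" "poly (conj_form i) y = poly (conj_form j) y" "i \<noteq> j"
    then have "poly D y = 0" unfolding D_def poly_prod
      by (intro prod_zero fin bexI[of _ "(i, j)"]) auto
    then show False using y(2) by blast
  qed
  then show ?thesis using that y(1) by blast
qed

text \<open>
  If a polynomial vanishes at the generic point in the chart \<open>f\<^sub>2 = 1\<close>, then so it does at all conjugates of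
  this point, which differ only in the first coordinate.
\<close>

lemma degree_ge_if_vanishes:
  assumes A: "lead_coeff A = [:[:c:]:]" "c \<noteq> 0"
    and van: "\<And>y. y \<noteq> 0 \<Longrightarrow> eval3 A (chart y) = 0"
  shows "2 * n \<le> degree A"
proof -
  obtain y where y: "y \<notin> {0}" "inj_on (\<lambda>i. poly (conj_form i) y) Ind"
    using conj_poly_separates[of "{0}"] by blast
  define z where "z = \<nu> * (1 + y ^ (2 * n)) / (\<mu> * y ^ n)"
  define B where "B = map_poly (\<lambda>a. poly (poly a [:1:]) z) A"
  have B: "poly B x = eval3 A (x, 1, z)" for x
  proof -
    have "poly (poly (poly A [:[:x:]:]) [:1:]) z = poly (map_poly (\<lambda>a. poly (poly a [:1:]) z) A) x"
      by (induction A) (simp_all add: map_poly_pCons)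
    then show ?thesis by (simp add: B_def eval3_def)
  qed
  have "coeff B (degree A) = c" using A(1) by (simp add: B_def coeff_map_poly)
  then have B0: "B \<noteq> 0" using A(2) by auto
  have "degree B \<le> degree A" unfolding B_def by (intro degree_le) (simp add: coeff_map_poly coeff_eq_0)
  have root: "poly B (poly (conj_form i) y / (\<mu> * y ^ n)) = 0" if i: "i \<in> Ind" for i
  proof -
    obtain \<zeta> e where ze: "i = (\<zeta>, e)" "\<zeta> \<in> unit_roots n" using i by auto
    have z0: "\<zeta> \<noteq> 0" using unit_roots_nz[OF n ze(2)] .
    have zn: "\<zeta> ^ n = 1" "\<zeta> ^ (2 * n) = 1"
      using unit_rootsD[OF ze(2)] by (auto simp: power_mult mult.commute[of 2])
    show ?thesis
    proof (cases e)
      case False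
      have "eval3 A (poly p (\<zeta> * y) / (\<mu> * y ^ n), 1, z) = 0"
        using van[of "\<zeta> * y"] y(1) z0 zn by (simp add: power_mult_distrib z_def)
      then show ?thesis using False by (simp add: B ze(1) poly_dihedral_conj)
    next
      case True
      define w where "w = 1 / (\<zeta> * y)"
      have w: "w \<noteq> 0" using y(1) z0 by (simp add: w_def)
      have wn: "w ^ n = 1 / y ^ n" "w ^ (2 * n) = 1 / y ^ (2 * n)"
        using zn by (auto simp: w_def power_divide power_mult_distrib)
      have y2: "y ^ (2 * n) = y ^ n * y ^ n" by (simp add: mult_2 power_add)
      have "poly r (\<zeta> * y) = y ^ (2 * n) * poly p w"
        using binary_form_chart(1)[OF f, of "\<zeta> * y"] y(1) z0 zn by (simp add: w_def power_mult_distrib)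
      then have 1: "poly p w / (\<mu> * w ^ n) = poly r (\<zeta> * y) / (\<mu> * y ^ n)"
        using y(1) nz unfolding wn y2 by (simp add: field_simps)
      have 2: "\<nu> * (1 + w ^ (2 * n)) / (\<mu> * w ^ n) = z"
        using y(1) nz unfolding wn z_def y2 by (simp add: field_simps)
      show ?thesis using van[OF w] True unfolding 1 2 by (simp add: B ze(1) poly_dihedral_conj)
    qed
  qed
  have "2 * n = card ((\<lambda>i. poly (conj_form i) y / (\<mu> * y ^ n)) ` Ind)"
    using y nz card_Ind by (subst card_image) (auto simp: inj_on_def)
  also have "\<dots> \<le> card {x. poly B x = 0}"
    by (rule card_mono[OF poly_roots_finite[OF B0]]) (use root in auto)
  also have "\<dots> \<le> degree B"
    using card_poly_roots_bound[OF B0] .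
  finally show ?thesis using \<open>degree B \<le> degree A\<close> by simp
qed

text \<open>
  One of the two factors vanishes at the generic point of the curve, so it has degree \<open>2n\<close> in \<open>x\<close>. The other
  factor then has degree \<open>0\<close> in \<open>x\<close>, and it is a unit because the equation is monic in \<open>x\<close>.
\<close>

lemma irreducible_equation:
  assumes hom: "homogeneous3 (2 * n) F"
    and ev: "\<And>x y. eval3 F (cone x y) = norm_value x y"
    and deg: "degree F \<le> 2 * n" and lead: "coeff F (2 * n) = 1"
  shows "irreducible F"
proof (rule Factorial_Ring.irreducibleI)
  have degF: "degree F = 2 * n" using deg lead le_degree[of F "2 * n"] by auto
  show "F \<noteq> 0" using lead by auto
  show "\<not> F dvd 1"
  proof
    assume "F dvd 1"
    then obtain G where G: "1 = F * G" by (auto elim: dvdE)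
    then have "F \<noteq> 0" "G \<noteq> 0" by auto
    then have "degree (1 :: 'k poly3) = degree F + degree G" unfolding G by (rule degree_mult_eq)
    then show False using degF n by simp
  qed
  have unit: "B dvd 1"
    if AB: "F = A * B" and van: "\<And>y. y \<noteq> 0 \<Longrightarrow> eval3 A (chart y) = 0"
    for A B
  proof -
    have nz': "A \<noteq> 0" "B \<noteq> 0" using AB \<open>F \<noteq> 0\<close> by auto
    have d: "degree A + degree B = 2 * n" using degree_mult_eq[OF nz'] AB degF by simp
    have l: "lead_coeff A * lead_coeff B = 1"
      using lead_coeff_mult[of A B] lead degF AB by simp
    have c: "\<exists>c. lead_coeff A = [:[:c:]:] \<and> c \<noteq> 0"
    proof -
      have u: "lead_coeff A dvd 1" using l by (metis dvd_triv_left)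
      then obtain a where a: "lead_coeff A = [:a:]" "a dvd 1" unfolding is_unit_poly_iff by blast
      then obtain c where "a = [:c:]" "c dvd 1" unfolding is_unit_poly_iff by blast
      then show ?thesis using a(1) by auto
    qed
    then have "2 * n \<le> degree A" using degree_ge_if_vanishes van by blast
    then have "degree B = 0" using d by simp
    then obtain b where b: "B = [:b:]" by (auto elim: degree_eq_zeroE)
    then have "b dvd 1" using l by (metis dvd_triv_right lead_coeff_pCons(2))
    then show "B dvd 1" unfolding b is_unit_poly_iff by blast
  qed
  fix A B assume AB: "F = A * B"
  obtain G1 K1 where G1: "\<And>y. y \<noteq> 0 \<Longrightarrow> poly G1 y = y ^ K1 * eval3 A (chart y)"
    using eval3_chart_poly[of A] by blast
  obtain G2 K2 where G2: "\<And>y. y \<noteq> 0 \<Longrightarrow> poly G2 y = y ^ K2 * eval3 B (chart y)"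
    using eval3_chart_poly[of B] by blast
  have F0: "eval3 F (chart y) = 0" if "y \<noteq> 0" for y
  proof -
    have "eval3 F (cone (poly p y) y) = poly (pullback F) y"
      by (simp add: poly_poly3_subst poly_monom distrib_left)
    then have "eval3 F (cone (poly p y) y) = 0"
      by (simp add: pullback_equation[OF ev])
    then show ?thesis
      using eval3_scale[OF hom, of "1 / (\<mu> * y ^ n)" "poly p y" "\<mu> * y ^ n" "\<nu> * (1 + y ^ (2 * n))"] that nz by simp
  qed
  have "G1 * G2 = 0"
    by (rule poly_eqI_cofinite[of "{0}"]) (use G1 G2 F0 in \<open>auto simp: AB\<close>)
  then consider "G1 = 0" | "G2 = 0" by auto
  then show "A dvd 1 \<or> B dvd 1"
  proof cases
    case 1
    then have "B dvd 1" using G1 by (intro unit[OF AB]) simp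
    then show ?thesis by blast
  next
    case 2
    then have "A dvd 1" using G2 by (intro unit[of B A]) (simp_all add: AB mult.commute)
    then show ?thesis by blast
  qed
qed

lemma irreducible_curve: "irreducible_plane_curve (2 * n) C"
proof -
  obtain F where F: "homogeneous3 (2 * n) F" "degree F \<le> 2 * n" "coeff F (2 * n) = 1"
    "\<And>x y. eval3 F (cone x y) = norm_value x y"
    "\<And>x. eval3 F (x, 0, 0) = x ^ (2 * n)"
    using equation_exists by blast
  show ?thesis unfolding irreducible_plane_curve_def
    using F(1) irreducible_equation[OF F(1,4,2,3)] zero_locus_equation[OF F(1,4,5)] by blast
qed

end

context rational_plane_curve
begin

text \<open>
  An identity of functions of \<open>y = v/u\<close> extends to the point \<open>u = 0\<close> by passing to the other chart.
\<close>

lemma coordinate_quotient: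
  assumes A: "homogeneous3 d A" and B: "homogeneous3 d B" and AB: "[:0, 1:] * pullback B = pullback A"
    and uv: "(u, v) \<noteq> (0, 0)"
  shows "v * eval3 B (f1 u v, f2 u v, f3 u v) = u * eval3 A (f1 u v, f2 u v, f3 u v)"
proof -
  have 1: "v * eval3 B (f1 u v, f2 u v, f3 u v) = u * eval3 A (f1 u v, f2 u v, f3 u v)" if "u \<noteq> 0" for u v
  proof -
    have "eval3 G (f1 u v, f2 u v, f3 u v) = (u ^ N) ^ d * poly (pullback G) (v / u)" if "homogeneous3 d G" for G
      using f1 f2 f3 \<open>u \<noteq> 0\<close> that by (simp add: poly_poly3_subst binary_form_def eval3_scale)
    then show ?thesis using A B that by (simp flip: AB)
  qed
  have 2: "eval3 G (f1 u v, f2 u v, f3 u v) = (v ^ N) ^ d * poly (poly3_subst G r1 r2 r3) (u / v)"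
    if "homogeneous3 d G" "v \<noteq> 0" for G u v
    using f1 f2 f3 that by (simp add: poly_poly3_subst binary_form_def eval3_scale)
  have "poly3_subst B r1 r2 r3 = [:0, 1:] * poly3_subst A r1 r2 r3"
    by (rule poly_eqI_cofinite[of "{0}"]) (use 1[of _ 1] 2[OF A, of 1] 2[OF B, of 1] in auto)
  then have "eval3 B (f1 0 v, f2 0 v, f3 0 v) = 0" if "v \<noteq> 0" for v
    using 2[OF B that, of 0] by simp
  then show ?thesis using 1 uv by (cases "u = 0") auto
qed

end

context dihedral_plane_curve
begin

text \<open>
  At \<open>x = f\<^sub>i\<close> this polynomial takes the value \<open>g\<^sub>i\<close>, multiplied by the derivative of the norm. As the conjugates
  \<open>f\<^sub>i\<close> and \<open>g\<^sub>i\<close> are permuted simultaneously, its coefficients are invariant.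
\<close>

definition interpolation :: "'k poly \<Rightarrow> 'k poly \<Rightarrow> 'k poly poly" where
  "interpolation g s = (\<Sum>i\<in>Ind. smult (dihedral_conj g s i) (\<Prod>j\<in>Ind - {i}. [:- conj_form j, 1:]))"

lemma poly_interpolation: "poly (poly (interpolation g s) [:x:]) y =
    (\<Sum>i\<in>Ind. poly (dihedral_conj g s i) y * (\<Prod>j\<in>Ind - {i}. x - poly (conj_form j) y))"
  by (simp add: interpolation_def poly_sum poly_prod)

lemma interpolation_descends:
  assumes g: "binary_form (2 * n) h g s"
  shows "\<exists>A. homogeneous3 (2 * n) A \<and>
    (\<forall>x y. eval3 A (cone x y) = poly (poly (interpolation g s) [:x:]) y)"
proof -
  have deg: "degree (interpolation g s) \<le> 2 * n"
    unfolding interpolation_def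
  proof (intro degree_sum_le finite_Ind)
    fix i assume i: "i \<in> Ind"
    have "degree (\<Prod>j\<in>Ind - {i}. [:- conj_form j, 1:]) = card (Ind - {i})"
      by (subst degree_prod_eq_sum_degree) auto
    also have "\<dots> \<le> 2 * n" using card_mono[OF finite_Ind, of "Ind - {i}"] card_Ind by auto
    finally show "degree (smult (dihedral_conj g s i) (\<Prod>j\<in>Ind - {i}. [:- conj_form j, 1:])) \<le> 2 * n"
      using degree_smult_le order.trans by blast
  qed
  have rot: "poly (poly (interpolation g s) [:x:]) (\<zeta> * y) = poly (poly (interpolation g s) [:x:]) y"
    if "\<zeta> \<in> unit_roots n" for \<zeta> x y
    unfolding poly_interpolation dihedral_conj_rot
    by (rule sum_prod_diff_reindex[OF bij_dihedral_index(1)[OF n that] finite_Ind])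
  have ref: "y ^ (2 * n * (2 * n)) * poly (poly (interpolation g s) [:x / y ^ (2 * n):]) (1 / y) =
      poly (poly (interpolation g s) [:x:]) y" if y: "y \<noteq> 0" for x y
  proof -
    let ?\<pi> = "map_prod inverse Not :: 'k \<times> bool \<Rightarrow> 'k \<times> bool"
    have "y ^ (2 * n * (2 * n)) * (poly (dihedral_conj g s i) (1 / y) * (\<Prod>j\<in>Ind - {i}. x / y ^ (2 * n) - poly (conj_form j) (1 / y)))
      = poly (dihedral_conj g s (?\<pi> i)) y * (\<Prod>j\<in>Ind - {i}. x - poly (conj_form (?\<pi> j)) y)" if i: "i \<in> Ind" for i
    proof -
      have "y ^ (2 * n * (2 * n)) = (\<Prod>j\<in>Ind. y ^ (2 * n))" by (simp add: card_Ind flip: power_mult)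
      also have "\<dots> = y ^ (2 * n) * (\<Prod>j\<in>Ind - {i}. y ^ (2 * n))" by (rule prod.remove[OF finite_Ind i])
      finally have "y ^ (2 * n * (2 * n)) * (poly (dihedral_conj g s i) (1 / y) * (\<Prod>j\<in>Ind - {i}. x / y ^ (2 * n) - poly (conj_form j) (1 / y)))
        = (y ^ (2 * n) * poly (dihedral_conj g s i) (1 / y)) *
          (\<Prod>j\<in>Ind - {i}. y ^ (2 * n) * (x / y ^ (2 * n) - poly (conj_form j) (1 / y)))"
        unfolding prod.distrib by (simp only: mult_ac)
      also have "(\<Prod>j\<in>Ind - {i}. y ^ (2 * n) * (x / y ^ (2 * n) - poly (conj_form j) (1 / y))) =
          (\<Prod>j\<in>Ind - {i}. x - poly (conj_form (?\<pi> j)) y)"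
        by (rule prod.cong[OF HOL.refl]) (use y in \<open>simp add: right_diff_distrib dihedral_conj_refl[OF f y _ n]\<close>)
      also have "y ^ (2 * n) * poly (dihedral_conj g s i) (1 / y) = poly (dihedral_conj g s (?\<pi> i)) y"
        by (rule dihedral_conj_refl[OF g y i n])
      finally show ?thesis .
    qed
    then have "y ^ (2 * n * (2 * n)) * poly (poly (interpolation g s) [:x / y ^ (2 * n):]) (1 / y) =
      (\<Sum>i\<in>Ind. poly (dihedral_conj g s (?\<pi> i)) y * (\<Prod>j\<in>Ind - {i}. x - poly (conj_form (?\<pi> j)) y))"
      unfolding poly_interpolation sum_distrib_left by (intro sum.cong HOL.refl)
    also have "\<dots> = poly (poly (interpolation g s) [:x:]) y"
      unfolding poly_interpolation
      by (rule sum_prod_diff_reindex[OF bij_dihedral_index(2)[OF n] finite_Ind])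
    finally show ?thesis .
  qed
  show ?thesis using dihedral_invariant_descends[OF n card nz deg rot ref] by blast
qed

text \<open>
  The derivative with respect to \<open>x\<close> of the norm, evaluated at \<open>x = f\<close>.
\<close>

definition different_poly :: "'k poly" where
  "different_poly = (\<Prod>j\<in>Ind - {(1, False)}. p - conj_form j)"

lemma conj_form_1: "conj_form (1, False) = p"
  by (simp add: dihedral_conj_def pcompose_idR)

lemma different_poly_nz: "different_poly \<noteq> 0"
proof -
  have "conj_form j \<noteq> p" if "j \<in> Ind - {(1, False)}" for j
    using inj_onD[OF inj, of j "(1, False)"] that conj_form_1 by auto
  then show ?thesis unfolding different_poly_def using finite_Ind by (auto simp: eq_commute[of p])
qed

lemma pullback_interpolation:
  assumes "\<And>x y. eval3 A (cone x y) = poly (poly (interpolation g s) [:x:]) y"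
  shows "pullback A = g * different_poly"
proof (rule poly_eqI_cofinite[of "{}"])
  fix y
  have i0: "(1, False) \<in> Ind" by simp
  have "poly (pullback A) y = poly (poly (interpolation g s) [:poly p y:]) y"
    using assms[of "poly p y" y] by (simp add: poly_poly3_subst poly_monom distrib_left)
  also have "\<dots> = (\<Sum>i\<in>{(1, False)}. poly (dihedral_conj g s i) y * (\<Prod>j\<in>Ind - {i}. poly p y - poly (conj_form j) y))"
    unfolding poly_interpolation
  proof (rule sum.mono_neutral_right[OF finite_Ind], use i0 in blast, rule ballI)
    fix i assume i: "i \<in> Ind - {(1, False)}"
    have "(\<Prod>j\<in>Ind - {i}. poly p y - poly (conj_form j) y) = 0"
      using finite_Ind i i0 by (intro prod_zero bexI[of _ "(1, False)"]) (auto simp: conj_form_1)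
    then show "poly (dihedral_conj g s i) y * (\<Prod>j\<in>Ind - {i}. poly p y - poly (conj_form j) y) = 0" by simp
  qed
  also have "\<dots> = poly (g * different_poly) y"
    by (simp add: different_poly_def poly_prod poly_dihedral_conj)
  finally show "poly (pullback A) y = poly (g * different_poly) y" .
qed simp

text \<open>
  The coordinate \<open>v/u\<close> is the quotient of the interpolation polynomials of \<open>u\<^sup>2\<^sup>n\<^sup>-\<^sup>1 v\<close> and \<open>u\<^sup>2\<^sup>n\<close>.
\<close>

lemma coordinate_is_quotient:
  "\<exists>A B d. homogeneous3 d A \<and> homogeneous3 d B \<and> \<not> vanishes_on B C \<and>
    (\<forall>u v. (u, v) \<noteq> (0, 0) \<longrightarrow>
      v * eval3 B (f u v, \<mu> * (u ^ n * v ^ n), \<nu> * (u ^ (2 * n) + v ^ (2 * n))) =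
      u * eval3 A (f u v, \<mu> * (u ^ n * v ^ n), \<nu> * (u ^ (2 * n) + v ^ (2 * n))))"
proof -
  have 1: "binary_form (2 * n) (\<lambda>u v. u ^ (2 * n)) 1 (monom 1 (2 * n))"
    by (auto simp: binary_form_def poly_monom power_divide)
  obtain m where m: "2 * n = Suc m" using n by (cases "2 * n") auto
  have 2: "binary_form (2 * n) (\<lambda>u v. u ^ m * v) [:0, 1:] (monom 1 m)"
    unfolding binary_form_def m by (auto simp: poly_monom power_divide)
  obtain B where B: "homogeneous3 (2 * n) B" "pullback B = 1 * different_poly"
    using interpolation_descends[OF 1] pullback_interpolation by blast
  obtain A where A: "homogeneous3 (2 * n) A" "pullback A = [:0, 1:] * different_poly"
    using interpolation_descends[OF 2] pullback_interpolation by blast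
  have "[:0, 1:] * pullback B = pullback A" using A(2) B(2) by simp
  from coordinate_quotient[OF A(1) B(1) this] show ?thesis
    using A(1) B vanishes_on_iff[OF B(1)] different_poly_nz by (intro exI[of _ A] exI[of _ B] exI[of _ "2 * n"]) auto
qed

end

section \<open>Linear forms\<close>

abbreviation X_form :: "'k::field poly3" where "X_form \<equiv> [:0, 1:]"
abbreviation Y_form :: "'k::field poly3" where "Y_form \<equiv> [:[:0, 1:]:]"
abbreviation Z_form :: "'k::field poly3" where "Z_form \<equiv> [:[:[:0, 1:]:]:]"

lemma eval3_coordinate_forms:
  "eval3 X_form (x, y, z) = x" "eval3 Y_form (x, y, z) = y" "eval3 Z_form (x, y, z) = z"
  by (simp_all add: eval3_def)

lemma homogeneous3_coordinate_forms:
  "homogeneous3 1 X_form" "homogeneous3 1 Y_form" "homogeneous3 1 Z_form"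
  by (auto simp: homogeneous3_def coeff_pCons split: nat.splits if_splits)

lemma eval3_linear_form:
  assumes "homogeneous3 1 L"
  obtains a b c where "\<And>x y z. eval3 L (x, y, z) = a * x + b * y + c * z"
proof -
  define a where "a = coeff (coeff (coeff L 1) 0) 0"
  define b where "b = coeff (coeff (coeff L 0) 1) 0"
  define c where "c = coeff (coeff (coeff L 0) 0) 1"
  have "coeff (coeff (coeff L i) j) l =
    coeff (coeff (coeff (const3 a * X_form + const3 b * Y_form + const3 c * Z_form) i) j) l" for i j l
  proof -
    have "coeff (coeff (coeff L i) j) l = 0" if "i + j + l \<noteq> 1"
      using assms that by (auto simp: homogeneous3_def)
    then show ?thesis
      by (auto simp: const3_def coeff_pCons a_def b_def c_def split: nat.splits)
  qed
  then have "L = const3 a * X_form + const3 b * Y_form + const3 c * Z_form"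
    by (intro poly_eqI)
  then have "eval3 L (x, y, z) = a * x + b * y + c * z" for x y z
    by (simp only: eval3_add eval3_mult eval3_const eval3_coordinate_forms)
  then show ?thesis by (rule that)
qed

lemma projection_forms_100: "projection_forms (proj_point 1 0 0) Y_form (Z_form :: 'k::field poly3)"
  and projection_forms_010: "projection_forms (proj_point 0 1 0) X_form (Z_form :: 'k::field poly3)"
proof -
  have "a = 0 \<and> b = 0" if "const3 a * Y_form + const3 b * Z_form = 0" for a b :: 'k
    using arg_cong[OF that, of "\<lambda>F. eval3 F (0, 1, 0)"] arg_cong[OF that, of "\<lambda>F. eval3 F (0, 0, 1)"]
    by (simp only: eval3_add eval3_mult eval3_const eval3_coordinate_forms eval3_0) simp
  then show "projection_forms (proj_point 1 0 0) Y_form (Z_form :: 'k poly3)"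
    unfolding projection_forms_def proj_point_def using homogeneous3_coordinate_forms
    by (auto simp only: eval3_coordinate_forms mult_zero_right)
  have "a = 0 \<and> b = 0" if "const3 a * X_form + const3 b * Z_form = 0" for a b :: 'k
    using arg_cong[OF that, of "\<lambda>F. eval3 F (1, 0, 0)"] arg_cong[OF that, of "\<lambda>F. eval3 F (0, 0, 1)"]
    by (simp only: eval3_add eval3_mult eval3_const eval3_coordinate_forms eval3_0) simp
  then show "projection_forms (proj_point 0 1 0) X_form (Z_form :: 'k poly3)"
    unfolding projection_forms_def proj_point_def using homogeneous3_coordinate_forms
    by (auto simp only: eval3_coordinate_forms mult_zero_right)
qed

lemma binary_form_linear: "binary_form 1 (\<lambda>u v. a * u + b * v) [:a, b:] [:b, a:]"
  by (auto simp: binary_form_def distrib_left)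

lemma binary_form_mult:
  assumes "binary_form N f p r" "binary_form M g p' r'"
  shows "binary_form (N + M) (\<lambda>u v. f u v * g u v) (p * p') (r * r')"
  using assms by (simp add: binary_form_def power_add mult_ac)

lemma binary_form_power:
  assumes "binary_form N f p r"
  shows "binary_form (N * k) (\<lambda>u v. f u v ^ k) (p ^ k) (r ^ k)"
  using assms by (simp add: binary_form_def power_mult power_mult_distrib poly_power)

lemma binary_form_two_linear_powers:
  "binary_form (2 * n) (\<lambda>u v. (a * u + b * v) ^ n * (c * u + d * v) ^ n)
     ([:a, b:] ^ n * [:c, d:] ^ n) ([:b, a:] ^ n * [:d, c:] ^ n)"
  using binary_form_mult[OF binary_form_power[OF binary_form_linear[of a b], of n]
      binary_form_power[OF binary_form_linear[of c d], of n]]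
  by (simp only: mult_1 mult_2)

text \<open>
  Two conjugates of \<open>f\<close> that coincide have the same zeros. As \<open>f\<close> vanishes exactly at \<open>a\<close> and \<open>b\<close>, this
  means that a nontrivial element of the dihedral group preserves \<open>{a, b}\<close>.
\<close>

lemma inj_on_dihedral_conj:
  assumes n: "n > 0" and p: "\<And>y. poly p y = 0 \<longleftrightarrow> y = a \<or> y = b"
    and r: "\<And>y. poly r y = 0 \<longleftrightarrow> y = 1 / a \<or> y = 1 / b"
    and ab: "a \<noteq> 0" "b \<noteq> 0" "a ^ 2 \<noteq> b ^ 2" "(a * b) ^ n \<noteq> 1"
  shows "inj_on (dihedral_conj p r) (dihedral_index n :: ('k::field \<times> bool) set)"
proof -
  have same: "\<zeta> = \<xi>" if eq: "\<And>y. \<zeta> * y = c \<or> \<zeta> * y = d \<longleftrightarrow> \<xi> * y = c \<or> \<xi> * y = d"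
    and nz: "\<zeta> \<noteq> 0" "\<xi> \<noteq> 0" "c \<noteq> 0" "d \<noteq> 0" "c ^ 2 \<noteq> d ^ 2" for \<zeta> \<xi> c d :: 'k
  proof (rule ccontr)
    assume ne: "\<zeta> \<noteq> \<xi>"
    have 1: "\<xi> * c = d * \<zeta>" using eq[of "c / \<zeta>"] nz ne by (auto simp: divide_eq_eq)
    have 2: "\<xi> * d = c * \<zeta>" using eq[of "d / \<zeta>"] nz ne by (auto simp: divide_eq_eq)
    have "(\<zeta> * \<xi>) * c ^ 2 = (\<xi> * c) * (c * \<zeta>)" by (simp add: power2_eq_square mult_ac)
    also have "\<dots> = (\<zeta> * \<xi>) * d ^ 2" unfolding 1 2[symmetric] by (simp add: power2_eq_square mult_ac)
    finally show False using nz by simp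
  qed
  have diff: False if eq: "\<And>y. \<zeta> * y = a \<or> \<zeta> * y = b \<longleftrightarrow> \<xi> * y = 1 / a \<or> \<xi> * y = 1 / b"
    and z: "\<zeta> \<in> unit_roots n" "\<xi> \<in> unit_roots n" for \<zeta> \<xi> :: 'k
  proof -
    note nz = unit_roots_nz[OF n z(1)] unit_roots_nz[OF n z(2)]
    have ne: "\<xi> * (a * b) \<noteq> \<zeta>"
    proof
      assume "\<xi> * (a * b) = \<zeta>"
      then have "a * b = \<zeta> / \<xi>" using nz by (simp add: eq_divide_eq mult.commute)
      then show False using unit_rootsD[OF unit_roots_closed(3)[OF z]] ab(4) by simp
    qed
    have 1: "\<xi> * b ^ 2 = \<zeta>"
    proof -
      have "\<xi> * (b / \<zeta>) = 1 / a \<or> \<xi> * (b / \<zeta>) = 1 / b" using eq[of "b / \<zeta>"] nz by simp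
      then show ?thesis using ne nz ab by (auto simp: field_simps power2_eq_square)
    qed
    have 2: "\<xi> * a ^ 2 = \<zeta>"
    proof -
      have "\<xi> * (a / \<zeta>) = 1 / a \<or> \<xi> * (a / \<zeta>) = 1 / b" using eq[of "a / \<zeta>"] nz by simp
      then show ?thesis using ne nz ab by (auto simp: field_simps power2_eq_square)
    qed
    have "\<xi> * a ^ 2 = \<xi> * b ^ 2" using 1 2 by simp
    then show False using nz ab(3) by simp
  qed
  have c2: "(1 / a) ^ 2 \<noteq> (1 / b) ^ 2" using ab(1,2,3) by (simp add: power_divide)
  show ?thesis
  proof (rule inj_onI, clarify)
    fix \<zeta> \<xi> :: 'k and e e'
    assume z: "\<zeta> \<in> unit_roots n" "\<xi> \<in> unit_roots n"
      and eq: "dihedral_conj p r (\<zeta>, e) = dihedral_conj p r (\<xi>, e')"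
    have pe: "poly (if e then r else p) (\<zeta> * y) = poly (if e' then r else p) (\<xi> * y)" for y
      using arg_cong[OF eq, of "\<lambda>h. poly h y"] by (simp only: poly_dihedral_conj)
    note nz = unit_roots_nz[OF n z(1)] unit_roots_nz[OF n z(2)]
    show "\<zeta> = \<xi> \<and> e = e'"
    proof (cases e; cases e')
      assume "e" "e'"
      then have "\<zeta> * y = 1 / a \<or> \<zeta> * y = 1 / b \<longleftrightarrow> \<xi> * y = 1 / a \<or> \<xi> * y = 1 / b" for y
        using pe[of y] by (simp flip: r)
      then show ?thesis using same[of \<zeta> "1 / a" "1 / b" \<xi>] nz ab c2 \<open>e\<close> \<open>e'\<close> by simp
    next
      assume "e" "\<not> e'"
      then have "\<xi> * y = a \<or> \<xi> * y = b \<longleftrightarrow> \<zeta> * y = 1 / a \<or> \<zeta> * y = 1 / b" for y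
        using pe[of y] by (simp flip: r p)
      then show ?thesis using diff[OF _ z(2,1)] by blast
    next
      assume "\<not> e" "e'"
      then have "\<zeta> * y = a \<or> \<zeta> * y = b \<longleftrightarrow> \<xi> * y = 1 / a \<or> \<xi> * y = 1 / b" for y
        using pe[of y] by (simp flip: r p)
      then show ?thesis using diff[OF _ z] by blast
    next
      assume "\<not> e" "\<not> e'"
      then have "\<zeta> * y = a \<or> \<zeta> * y = b \<longleftrightarrow> \<xi> * y = a \<or> \<xi> * y = b" for y
        using pe[of y] by (simp flip: p)
      then show ?thesis using same[of \<zeta> a b \<xi>] nz ab \<open>\<not> e\<close> \<open>\<not> e'\<close> by simp
    qed
  qed
qed

section \<open>The parametrised curve and its two projections\<close>

lemma proj_pointD:
  "(1, 0, 0) \<in> proj_point a b c \<Longrightarrow> b = 0" "(1, 0, 0) \<in> proj_point a b c \<Longrightarrow> c = 0"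
  "(0, 1, 0) \<in> proj_point a b c \<Longrightarrow> a = 0" "(0, 1, 0) \<in> proj_point a b c \<Longrightarrow> c = 0"
  by (auto simp: proj_point_def)

text \<open>
  The constants \<open>\<kappa>\<close> and \<open>\<tau>\<close> rescale the coordinates of the projective line for the projections from
  \<open>(1 : 0 : 0)\<close> and \<open>(0 : 1 : 0)\<close>, respectively.
\<close>

locale curve_C4_parameters =
  fixes q n :: nat and \<gamma> \<kappa> \<tau> :: "'k::alg_closed_field"
  assumes q: "q + 1 = 2 * n" and n: "n > 0" and card: "card (unit_roots n :: 'k set) = n"
    and two: "(2::'k) \<noteq> 0" and frobenius: "\<And>x y :: 'k. (x + y) ^ q = x ^ q + y ^ q"
    and gamma: "\<gamma> \<noteq> 0" "\<gamma> \<noteq> 1" "\<gamma> \<noteq> -1" "\<gamma> ^ n = \<gamma>" "\<gamma> ^ q = \<gamma>"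
    and kappa: "\<kappa> ^ (2 * n) = - 1 / \<gamma>" and tau: "\<tau> ^ (2 * n) = - \<gamma>"
begin

lemma kappa_nz: "\<kappa> \<noteq> 0" and tau_nz: "\<tau> \<noteq> 0"
  using kappa tau gamma(1) n by (auto simp: power_0_left)

lemma gamma_1: "\<gamma> - 1 \<noteq> 0" using gamma(2) by simp

lemma curve_C4_eq: "curve_C4 q \<gamma> = {proj_point (s ^ n * t ^ n) ((s + t) ^ n * (s + \<gamma> * t) ^ n)
    (s ^ (2 * n) - \<gamma> * t ^ (2 * n)) | s t. (s, t) \<noteq> (0, 0)}"
proof -
  have "(q + 1) div 2 = n" using q by simp
  then show ?thesis unfolding curve_C4_def q by simp
qed

text \<open>
  Because \<open>\<gamma> ^ q = \<gamma>\<close>, the mixed terms of \<open>(s + t) ^ (q + 1)\<close> and \<open>(s + \<gamma> t) ^ (q + 1)\<close> cancel, so that the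
  third coordinate has the same shape in the coordinates \<open>s + t, s + \<gamma> t\<close> as in \<open>s, t\<close>.
\<close>

lemma third_coordinate:
  "\<gamma> / (\<gamma> - 1) * ((s + t) ^ (2 * n) + (\<kappa> * (s + \<gamma> * t)) ^ (2 * n)) = s ^ (2 * n) - \<gamma> * t ^ (2 * n)"
proof -
  have P: "x ^ (2 * n) = x ^ q * x" for x :: 'k unfolding q[symmetric] by simp
  have "\<gamma> * ((s + t) ^ (2 * n) + (\<kappa> * (s + \<gamma> * t)) ^ (2 * n)) =
      \<gamma> * (s + t) ^ (2 * n) - (s + \<gamma> * t) ^ (2 * n)"
    unfolding power_mult_distrib kappa using gamma(1) by (simp add: field_simps)
  also have "\<dots> = \<gamma> * ((s ^ q + t ^ q) * (s + t)) - (s ^ q + \<gamma> * t ^ q) * (s + \<gamma> * t)"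
    unfolding P frobenius power_mult_distrib gamma(5) ..
  also have "\<dots> = (\<gamma> - 1) * (s ^ q * s - \<gamma> * (t ^ q * t))"
    by (simp add: algebra_simps)
  finally show ?thesis unfolding P[of s] P[of t] using gamma_1 by (simp add: field_simps)
qed

text \<open>Coordinates adapted to the projection from \<open>(1 : 0 : 0)\<close>: \<open>u = s + t\<close> and \<open>v = \<kappa> (s + \<gamma> t)\<close>.\<close>

definition s_of :: "'k \<Rightarrow> 'k \<Rightarrow> 'k" where "s_of u v = \<gamma> / (\<gamma> - 1) * u + - 1 / (\<kappa> * (\<gamma> - 1)) * v"
definition t_of :: "'k \<Rightarrow> 'k \<Rightarrow> 'k" where "t_of u v = - 1 / (\<gamma> - 1) * u + 1 / (\<kappa> * (\<gamma> - 1)) * v"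

lemma s_of_t_of: "s_of u v + t_of u v = u" "\<kappa> * (s_of u v + \<gamma> * t_of u v) = v"
  "s_of (s + t) (\<kappa> * (s + \<gamma> * t)) = s" "t_of (s + t) (\<kappa> * (s + \<gamma> * t)) = t"
proof -
  define d where "d = \<gamma> - 1"
  have d: "d \<noteq> 0" "\<gamma> = d + 1" using gamma_1 by (auto simp: d_def)
  show "s_of u v + t_of u v = u" "\<kappa> * (s_of u v + \<gamma> * t_of u v) = v"
    "s_of (s + t) (\<kappa> * (s + \<gamma> * t)) = s" "t_of (s + t) (\<kappa> * (s + \<gamma> * t)) = t"
    unfolding s_of_def t_of_def d_def[symmetric] unfolding d(2) using d(1) kappa_nz
    by (simp_all add: field_simps)
qed

abbreviation "X\<^sub>2 u v \<equiv> s_of u v ^ n * t_of u v ^ n"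
abbreviation "Y\<^sub>2 u v \<equiv> 1 / \<kappa> ^ n * (u ^ n * v ^ n)"
abbreviation "Z\<^sub>2 u v \<equiv> \<gamma> / (\<gamma> - 1) * (u ^ (2 * n) + v ^ (2 * n))"

lemma frame_nonzero:
  assumes "(s, t) \<noteq> (0, 0)"
  shows "(s + t, \<kappa> * (s + \<gamma> * t)) \<noteq> (0, 0)"
proof
  assume "(s + t, \<kappa> * (s + \<gamma> * t)) = (0, 0)"
  then have "s + t = 0" "\<kappa> * (s + \<gamma> * t) = 0" by simp_all
  then have "s_of 0 0 = s" "t_of 0 0 = t" using s_of_t_of(3,4)[of s t] by (simp_all only:)
  then show False using assms by (simp add: s_of_def t_of_def)
qed

lemma curve_C4_param_100:
  "curve_C4 q \<gamma> = {proj_point (X\<^sub>2 u v) (Y\<^sub>2 u v)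
    (Z\<^sub>2 u v) | u v. (u, v) \<noteq> (0, 0)}" (is "_ = ?R")
proof -
  define \<Phi> where "\<Phi> = (\<lambda>s t. proj_point (s ^ n * t ^ n) ((s + t) ^ n * (s + \<gamma> * t) ^ n) (s ^ (2 * n) - \<gamma> * t ^ (2 * n)))"
  define \<Psi> where "\<Psi> = (\<lambda>u v. proj_point (X\<^sub>2 u v) (Y\<^sub>2 u v) (Z\<^sub>2 u v))"
  have 1: "\<Psi> (s + t) (\<kappa> * (s + \<gamma> * t)) = \<Phi> s t" for s t
    unfolding \<Phi>_def \<Psi>_def third_coordinate s_of_t_of using kappa_nz by (simp add: power_mult_distrib)
  note 2 = frame_nonzero
  have 3: "\<Psi> u v = \<Phi> (s_of u v) (t_of u v)" for u v using 1[of "s_of u v" "t_of u v"] unfolding s_of_t_of by simp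
  have 4: "(s_of u v, t_of u v) \<noteq> (0, 0)" if "(u, v) \<noteq> (0, 0)" for u v
    using that s_of_t_of(1,2)[of u v] by auto
  have "{\<Phi> s t | s t. (s, t) \<noteq> (0, 0)} = {\<Psi> u v | u v. (u, v) \<noteq> (0, 0)}"
  proof (intro equalityI subsetI)
    fix Q assume "Q \<in> {\<Phi> s t | s t. (s, t) \<noteq> (0, 0)}"
    then obtain s t where "(s, t) \<noteq> (0, 0)" "Q = \<Phi> s t" by blast
    then show "Q \<in> {\<Psi> u v | u v. (u, v) \<noteq> (0, 0)}" using 2[of s t] 1[of s t] by (metis (mono_tags, lifting) mem_Collect_eq)
  next
    fix Q assume "Q \<in> {\<Psi> u v | u v. (u, v) \<noteq> (0, 0)}"
    then obtain u v where "(u, v) \<noteq> (0, 0)" "Q = \<Psi> u v" by blast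
    then show "Q \<in> {\<Phi> s t | s t. (s, t) \<noteq> (0, 0)}" using 4[of u v] 3[of u v] by (metis (mono_tags, lifting) mem_Collect_eq)
  qed
  then show ?thesis unfolding curve_C4_eq \<Phi>_def \<Psi>_def .
qed

definition "first_poly = [:\<gamma> / (\<gamma> - 1), - 1 / (\<kappa> * (\<gamma> - 1)):] ^ n * [:- 1 / (\<gamma> - 1), 1 / (\<kappa> * (\<gamma> - 1)):] ^ n"
definition "first_poly' = [:- 1 / (\<kappa> * (\<gamma> - 1)), \<gamma> / (\<gamma> - 1):] ^ n * [:1 / (\<kappa> * (\<gamma> - 1)), - 1 / (\<gamma> - 1):] ^ n"

lemma first_form: "binary_form (2 * n) X\<^sub>2 first_poly first_poly'"
  unfolding s_of_def t_of_def first_poly_def first_poly'_def by (rule binary_form_two_linear_powers)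

text \<open>
  In the coordinate \<open>v/u\<close> the form vanishes at \<open>\<kappa>\<close> and \<open>\<kappa> \<gamma>\<close>. A rotation that exchanges them would give
  \<open>\<gamma>\<^sup>2 = 1\<close>, and so would a reflection that fixes both. A reflection that exchanges them would give
  \<open>(\<kappa>\<^sup>2 \<gamma>)\<^sup>n = 1\<close>, but this power is \<open>\<kappa>\<^sup>2\<^sup>n \<gamma>\<^sup>n = -1\<close>.
\<close>

lemma inj_first_form: "inj_on (dihedral_conj first_poly first_poly') (dihedral_index n)"
proof (rule inj_on_dihedral_conj[OF n, where a = "\<kappa> * \<gamma>" and b = \<kappa>])
  define d where "d = \<gamma> - 1"
  have d: "d \<noteq> 0" using gamma_1 by (auto simp: d_def)
  show "poly first_poly y = 0 \<longleftrightarrow> y = \<kappa> * \<gamma> \<or> y = \<kappa>" for y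
    unfolding first_poly_def d_def[symmetric] using n d kappa_nz
    by (auto simp: poly_power field_simps)
  show "poly first_poly' y = 0 \<longleftrightarrow> y = 1 / (\<kappa> * \<gamma>) \<or> y = 1 / \<kappa>" for y
    unfolding first_poly'_def d_def[symmetric] using n d kappa_nz gamma(1)
    by (auto simp: poly_power field_simps)
  show "\<kappa> * \<gamma> \<noteq> 0" "\<kappa> \<noteq> 0" using kappa_nz gamma(1) by auto
  have "\<gamma> ^ 2 \<noteq> 1" using gamma(2,3) by (simp add: power2_eq_1_iff)
  then show "(\<kappa> * \<gamma>) ^ 2 \<noteq> \<kappa> ^ 2" using kappa_nz by (simp add: power_mult_distrib)
  have "\<kappa> ^ (2 * n) = \<kappa> ^ n * \<kappa> ^ n" by (simp only: mult_2 power_add)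
  then have "(\<kappa> * \<gamma> * \<kappa>) ^ n = \<kappa> ^ (2 * n) * \<gamma> ^ n" by (simp only: power_mult_distrib mult_ac)
  also have "\<dots> = - 1" unfolding kappa gamma(4) using gamma(1) by simp
  finally show "(\<kappa> * \<gamma> * \<kappa>) ^ n \<noteq> 1" using two by (simp add: neg_eq_iff_add_eq_0)
qed

sublocale dihedral_plane_curve n X\<^sub>2 first_poly first_poly' "1 / \<kappa> ^ n" "\<gamma> / (\<gamma> - 1)" "curve_C4 q \<gamma>"
  by unfold_locales (use n card two first_form kappa_nz gamma(1) gamma_1 inj_first_form curve_C4_param_100 in auto)

lemma irreducible_curve_C4: "irreducible_plane_curve (q + 1) (curve_C4 q \<gamma>)"
  using irreducible_curve q by simp

lemma projection_100:
  "dihedral_projection (2 * n) X\<^sub>2 Y\<^sub>2 Z\<^sub>2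
    first_poly (monom (1 / \<kappa> ^ n) n) ([:\<gamma> / (\<gamma> - 1):] + monom (\<gamma> / (\<gamma> - 1)) (2 * n))
    first_poly' (monom (1 / \<kappa> ^ n) n) ([:\<gamma> / (\<gamma> - 1):] + monom (\<gamma> / (\<gamma> - 1)) (2 * n))
    (curve_C4 q \<gamma>) n (proj_point 1 0 0) Y_form Z_form (1 / \<kappa> ^ n) (\<gamma> / (\<gamma> - 1))"
proof unfold_locales
  show "\<exists>A B d. homogeneous3 d A \<and> homogeneous3 d B \<and> \<not> vanishes_on B (curve_C4 q \<gamma>) \<and>
    (\<forall>u v. (u, v) \<noteq> (0, 0) \<longrightarrow>
      v * eval3 B (X\<^sub>2 u v, Y\<^sub>2 u v, Z\<^sub>2 u v) =
      u * eval3 A (X\<^sub>2 u v, Y\<^sub>2 u v, Z\<^sub>2 u v))"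
    by (rule coordinate_is_quotient)
  show "projection_forms (proj_point 1 0 0) Y_form (Z_form :: 'k poly3)" by (rule projection_forms_100)
  show "1 / \<kappa> ^ n \<noteq> 0" "\<gamma> / (\<gamma> - 1) \<noteq> 0" using kappa_nz gamma(1) gamma_1 by auto
  show "poly (pullback Y_form) y = 1 / \<kappa> ^ n * y ^ n" for y
    by (simp only: poly_poly3_subst eval3_coordinate_forms poly_monom)
  show "poly (pullback Z_form) y = \<gamma> / (\<gamma> - 1) * (1 + y ^ (2 * n))" for y
    unfolding poly_poly3_subst eval3_coordinate_forms by (simp add: poly_monom distrib_left)
  fix L :: "'k poly3" assume L: "homogeneous3 1 L" "\<forall>v\<in>proj_point 1 0 0. eval3 L v = 0"
  obtain a b c where abc: "\<And>x y z. eval3 L (x, y, z) = a * x + b * y + c * z"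
    by (rule eval3_linear_form[OF L(1)]) (rule that)
  have "(1, 0, 0) \<in> proj_point 1 0 (0::'k)" unfolding proj_point_def by (auto intro!: exI[of _ 1])
  then have "a = 0" using L(2) abc[of 1 0 0] by force
  then have "poly (pullback L) y = b * (1 / \<kappa> ^ n) * y ^ n + c * (\<gamma> / (\<gamma> - 1)) * (1 + y ^ (2 * n))" for y
    unfolding poly_poly3_subst abc by (simp add: poly_monom distrib_left)
  then show "\<exists>\<alpha> \<beta>. \<forall>y. poly (pullback L) y = \<alpha> * y ^ n + \<beta> * (1 + y ^ (2 * n))" by blast
qed (use n card in auto)

text \<open>Coordinates adapted to the projection from \<open>(0 : 1 : 0)\<close>: \<open>u = s\<close> and \<open>v = \<tau> t\<close>.\<close>

abbreviation "X\<^sub>1 u v \<equiv> 1 / \<tau> ^ n * (u ^ n * v ^ n)"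
abbreviation "Z\<^sub>1 u v \<equiv> 1 * (u ^ (2 * n) + v ^ (2 * n))"
abbreviation "Y\<^sub>1 u v \<equiv> (1 * u + 1 / \<tau> * v) ^ n * (1 * u + \<gamma> / \<tau> * v) ^ n"

lemma forms_010:
  "1 / \<tau> ^ n * (s ^ n * (\<tau> * t) ^ n) = s ^ n * t ^ n"
  "Y\<^sub>1 s (\<tau> * t) = (s + t) ^ n * (s + \<gamma> * t) ^ n"
  "1 * (s ^ (2 * n) + (\<tau> * t) ^ (2 * n)) = s ^ (2 * n) - \<gamma> * t ^ (2 * n)"
  using tau_nz by (simp_all add: power_mult_distrib tau)

lemma curve_C4_param_010:
  "curve_C4 q \<gamma> = {proj_point (X\<^sub>1 u v) (Y\<^sub>1 u v)
    (Z\<^sub>1 u v) | u v. (u, v) \<noteq> (0, 0)}" (is "_ = ?R")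
proof (intro equalityI subsetI)
  fix Q assume "Q \<in> curve_C4 q \<gamma>"
  then obtain s t where st: "(s, t) \<noteq> (0, 0)" "Q = proj_point (s ^ n * t ^ n) ((s + t) ^ n * (s + \<gamma> * t) ^ n)
    (s ^ (2 * n) - \<gamma> * t ^ (2 * n))" unfolding curve_C4_eq by blast
  have "(s, \<tau> * t) \<noteq> (0, 0)" using st(1) tau_nz by auto
  moreover have "Q = proj_point (1 / \<tau> ^ n * (s ^ n * (\<tau> * t) ^ n)) (Y\<^sub>1 s (\<tau> * t))
      (1 * (s ^ (2 * n) + (\<tau> * t) ^ (2 * n)))" unfolding st(2) by (simp only: forms_010)
  ultimately show "Q \<in> ?R" by blast
next
  fix Q assume "Q \<in> ?R"
  then obtain u v where uv: "(u, v) \<noteq> (0, 0)" "Q = proj_point (X\<^sub>1 u v) (Y\<^sub>1 u v)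
    (Z\<^sub>1 u v)" by blast
  have "(u, v / \<tau>) \<noteq> (0, 0)" using uv(1) tau_nz by auto
  moreover have "Q = proj_point (u ^ n * (v / \<tau>) ^ n) ((u + v / \<tau>) ^ n * (u + \<gamma> * (v / \<tau>)) ^ n)
    (u ^ (2 * n) - \<gamma> * (v / \<tau>) ^ (2 * n))"
  proof -
    have "\<tau> * (v / \<tau>) = v" using tau_nz by simp
    then show ?thesis unfolding uv(2) using forms_010[of u "v / \<tau>"] by (simp only:)
  qed
  ultimately show "Q \<in> curve_C4 q \<gamma>" unfolding curve_C4_eq by blast
qed

text \<open>
  Birationality carries over from the other frame: the coordinates \<open>v/u\<close> of the two frames are related by a
  fractional linear transformation, and \<open>A'\<close> and \<open>B'\<close> are its numerator and denominator.
\<close>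

lemma projection_010:
  "dihedral_projection (2 * n) X\<^sub>1 Y\<^sub>1 Z\<^sub>1
    (monom (1 / \<tau> ^ n) n) ([:1, 1 / \<tau>:] ^ n * [:1, \<gamma> / \<tau>:] ^ n) ([:1:] + monom 1 (2 * n))
    (monom (1 / \<tau> ^ n) n) ([:1 / \<tau>, 1:] ^ n * [:\<gamma> / \<tau>, 1:] ^ n) ([:1:] + monom 1 (2 * n))
    (curve_C4 q \<gamma>) n (proj_point 0 1 0) X_form Z_form (1 / \<tau> ^ n) 1"
proof -
  interpret F: rational_plane_curve "2 * n" X\<^sub>1 Y\<^sub>1 Z\<^sub>1
    "monom (1 / \<tau> ^ n) n" "[:1, 1 / \<tau>:] ^ n * [:1, \<gamma> / \<tau>:] ^ n" "[:1:] + monom 1 (2 * n)"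
    "monom (1 / \<tau> ^ n) n" "[:1 / \<tau>, 1:] ^ n * [:\<gamma> / \<tau>, 1:] ^ n" "[:1:] + monom 1 (2 * n)"
    "curve_C4 q \<gamma>"
    by unfold_locales (rule binary_form_product_power binary_form_two_linear_powers binary_form_power_sum curve_C4_param_010)+
  define \<Phi> where "\<Phi> = (\<lambda>u v. (X\<^sub>1 u v, Y\<^sub>1 u v, Z\<^sub>1 u v))"
  show ?thesis
  proof unfold_locales
    obtain A B d where AB: "homogeneous3 d A" "homogeneous3 d B" "\<not> vanishes_on B (curve_C4 q \<gamma>)"
      and q': "\<And>u v. (u, v) \<noteq> (0, 0) \<Longrightarrow>
        v * eval3 B (X\<^sub>2 u v, Y\<^sub>2 u v, Z\<^sub>2 u v) =
        u * eval3 A (X\<^sub>2 u v, Y\<^sub>2 u v, Z\<^sub>2 u v)"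
      using coordinate_is_quotient by blast
    have quot: "\<kappa> * (s + \<gamma> * t) * eval3 B (\<Phi> s (\<tau> * t)) = (s + t) * eval3 A (\<Phi> s (\<tau> * t))"
      if "(s, t) \<noteq> (0, 0)" for s t
    proof -
      have nz: "(s + t, \<kappa> * (s + \<gamma> * t)) \<noteq> (0, 0)" by (rule frame_nonzero[OF that])
      have "1 / \<kappa> ^ n * ((s + t) ^ n * (\<kappa> * (s + \<gamma> * t)) ^ n) = (s + t) ^ n * (s + \<gamma> * t) ^ n"
        using kappa_nz by (simp add: power_mult_distrib)
      then show ?thesis using q'[OF nz] unfolding \<Phi>_def forms_010 third_coordinate s_of_t_of by simp
    qed
    define A' where "A' = const3 \<tau> * (const3 (1 / \<kappa>) * A - B)"
    define B' where "B' = const3 \<gamma> * B - const3 (1 / \<kappa>) * A"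
    have hA: "homogeneous3 d A'"
      unfolding A'_def using homogeneous3_mult[OF homogeneous3_const homogeneous3_diff[OF homogeneous3_mult[OF homogeneous3_const AB(1)]], of B]
        AB(2) by simp
    have hB: "homogeneous3 d B'"
      unfolding B'_def using homogeneous3_diff[OF homogeneous3_mult[OF homogeneous3_const AB(2)] homogeneous3_mult[OF homogeneous3_const AB(1)]]
      by simp
    have quot': "v * eval3 B' (\<Phi> u v) = u * eval3 A' (\<Phi> u v)" if uv: "(u, v) \<noteq> (0, 0)" for u v
    proof -
      define t where "t = v / \<tau>"
      have v: "v = \<tau> * t" using tau_nz by (simp add: t_def)
      define a where "a = eval3 A (\<Phi> u v) / \<kappa>"
      define b where "b = eval3 B (\<Phi> u v)"
      have "(u, t) \<noteq> (0, 0)" using uv v by auto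
      then have "\<kappa> * (u + \<gamma> * t) * b = (u + t) * (\<kappa> * a)"
        using quot[of u t] kappa_nz by (simp add: a_def b_def v)
      then have "\<kappa> * ((u + \<gamma> * t) * b) = \<kappa> * ((u + t) * a)" by (simp only: mult_ac)
      then have "(u + \<gamma> * t) * b = (u + t) * a" using kappa_nz by simp
      then have "t * (\<gamma> * b - a) = u * (a - b)" by (simp add: algebra_simps)
      then have "\<tau> * (t * (\<gamma> * b - a)) = \<tau> * (u * (a - b))" by (rule arg_cong)
      then show ?thesis
        unfolding A'_def B'_def eval3_mult eval3_diff eval3_const
        by (simp add: a_def b_def v mult.left_commute mult.assoc)
    qed
    have "\<not> vanishes_on B' (curve_C4 q \<gamma>)"
    proof
      assume "vanishes_on B' (curve_C4 q \<gamma>)"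
      then have B'0: "eval3 B' (\<Phi> 1 y) = 0" for y
        using F.vanishes_on_iff[OF hB] F.poly_pullback[of B' y] by (simp add: \<Phi>_def)
      have "eval3 B (\<Phi> 1 y) = 0" for y
      proof -
        have "eval3 A' (\<Phi> 1 y) = 0" using quot'[of 1 y] B'0[of y] by simp
        then have 1: "1 / \<kappa> * eval3 A (\<Phi> 1 y) = eval3 B (\<Phi> 1 y)"
          unfolding A'_def eval3_mult eval3_diff eval3_const using tau_nz by simp
        have "(\<gamma> - 1) * eval3 B (\<Phi> 1 y) = 0"
          using B'0[of y] unfolding B'_def eval3_mult eval3_diff eval3_const 1 by (simp add: algebra_simps)
        then show ?thesis using gamma_1 by simp
      qed
      then have "F.pullback B = 0"
        by (intro poly_eqI_cofinite[of "{}"]) (simp_all only: F.poly_pullback \<Phi>_def poly_0 finite.emptyI)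
      then show False using F.vanishes_on_iff[OF AB(2)] AB(3) by blast
    qed
    then show "\<exists>A B d. homogeneous3 d A \<and> homogeneous3 d B \<and> \<not> vanishes_on B (curve_C4 q \<gamma>) \<and>
      (\<forall>u v. (u, v) \<noteq> (0, 0) \<longrightarrow>
        v * eval3 B (X\<^sub>1 u v, Y\<^sub>1 u v, Z\<^sub>1 u v) =
        u * eval3 A (X\<^sub>1 u v, Y\<^sub>1 u v, Z\<^sub>1 u v))"
      using hA hB quot' unfolding \<Phi>_def by blast
    show "projection_forms (proj_point 0 1 0) X_form (Z_form :: 'k poly3)" by (rule projection_forms_010)
    show "1 / \<tau> ^ n \<noteq> 0" "(1::'k) \<noteq> 0" using tau_nz by auto
    show "poly (F.pullback X_form) y = 1 / \<tau> ^ n * y ^ n" for y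
      by (simp only: poly_poly3_subst eval3_coordinate_forms poly_monom)
    show "poly (F.pullback Z_form) y = 1 * (1 + y ^ (2 * n))" for y
      unfolding poly_poly3_subst eval3_coordinate_forms by (simp add: poly_monom)
    fix L :: "'k poly3" assume L: "homogeneous3 1 L" "\<forall>v\<in>proj_point 0 1 0. eval3 L v = 0"
    obtain a b c where abc: "\<And>x y z. eval3 L (x, y, z) = a * x + b * y + c * z"
      by (rule eval3_linear_form[OF L(1)]) (rule that)
    have "(0, 1, 0) \<in> proj_point 0 1 (0::'k)" unfolding proj_point_def by (auto intro!: exI[of _ 1])
    then have "b = 0" using L(2) abc[of 0 1 0] by force
    then have "poly (F.pullback L) y = a * (1 / \<tau> ^ n) * y ^ n + c * (1 + y ^ (2 * n))" for y
      unfolding poly_poly3_subst abc by (simp add: poly_monom)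
    then show "\<exists>\<alpha> \<beta>. \<forall>y. poly (F.pullback L) y = \<alpha> * y ^ n + \<beta> * (1 + y ^ (2 * n))" by blast
  qed (use n card in auto)
qed

lemma centres_not_on_curve:
  "proj_point 1 0 0 \<notin> curve_C4 q \<gamma>" "proj_point 0 1 0 \<notin> curve_C4 q \<gamma>"
proof -
  have zero: "u = 0 \<and> v = 0" if "c \<noteq> 0" "c' \<noteq> 0" "c * (u ^ n * v ^ n) = 0" "c' * (u ^ (2 * n) + v ^ (2 * n)) = 0"
    for c c' u v :: 'k
    using that n by (auto simp: power_0_left)
  show "proj_point 1 0 0 \<notin> curve_C4 q \<gamma>"
  proof
    assume "proj_point 1 0 0 \<in> curve_C4 q \<gamma>"
    then obtain u v where uv: "(u, v) \<noteq> (0, 0)" "proj_point 1 0 0 = proj_point (X\<^sub>2 u v)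
      (Y\<^sub>2 u v) (Z\<^sub>2 u v)"
      unfolding curve_C4_param_100 by blast
    have "(1, 0, 0) \<in> proj_point 1 0 (0::'k)" unfolding proj_point_def by (auto intro!: exI[of _ 1])
    then have "(1, 0, 0) \<in> proj_point (X\<^sub>2 u v)
      (Y\<^sub>2 u v) (Z\<^sub>2 u v)"
      by (simp only: uv(2))
    then have "Y\<^sub>2 u v = 0" "Z\<^sub>2 u v = 0"
      by (rule proj_pointD)+
    moreover have "1 / \<kappa> ^ n \<noteq> 0" "\<gamma> / (\<gamma> - 1) \<noteq> 0" using kappa_nz gamma(1) gamma_1 by auto
    ultimately show False using uv(1) zero by blast
  qed
  show "proj_point 0 1 0 \<notin> curve_C4 q \<gamma>"
  proof
    assume "proj_point 0 1 0 \<in> curve_C4 q \<gamma>"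
    then obtain u v where uv: "(u, v) \<noteq> (0, 0)" "proj_point 0 1 0 = proj_point
      (X\<^sub>1 u v) (Y\<^sub>1 u v) (Z\<^sub>1 u v)"
      unfolding curve_C4_param_010 by blast
    have "(0, 1, 0) \<in> proj_point 0 1 (0::'k)" unfolding proj_point_def by (auto intro!: exI[of _ 1])
    then have "(0, 1, 0) \<in> proj_point (X\<^sub>1 u v) (Y\<^sub>1 u v)
      (Z\<^sub>1 u v)"
      by (simp only: uv(2))
    then have "X\<^sub>1 u v = 0" "Z\<^sub>1 u v = 0"
      by (rule proj_pointD)+
    moreover have "1 / \<tau> ^ n \<noteq> 0" "1 \<noteq> (0::'k)" using tau_nz by auto
    ultimately show False using uv(1) zero by blast
  qed
qed

lemma outer_galois_points:
  fixes z :: 'k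
  assumes "z ^ n = 1" "inj_on (\<lambda>i. z ^ i) {..<n}" "unit_roots n = (\<lambda>i. z ^ i) ` {..<n}"
  shows "outer_galois_point (curve_C4 q \<gamma>) (proj_point 0 1 0)"
    "galois_point_group (curve_C4 q \<gamma>) (proj_point 0 1 0) \<cong> dihedral_group (q + 1)"
    "outer_galois_point (curve_C4 q \<gamma>) (proj_point 1 0 0)"
    "galois_point_group (curve_C4 q \<gamma>) (proj_point 1 0 0) \<cong> dihedral_group (q + 1)"
proof -
  have pl: "proj_point 0 1 (0::'k) \<in> proj_plane" "proj_point 1 0 (0::'k) \<in> proj_plane"
    unfolding proj_plane_def by (rule CollectI, intro exI conjI, rule HOL.refl, simp)+
  show "outer_galois_point (curve_C4 q \<gamma>) (proj_point 0 1 0)" "outer_galois_point (curve_C4 q \<gamma>) (proj_point 1 0 0)"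
    unfolding outer_galois_point_def galois_point_def using pl centres_not_on_curve
      dihedral_projection.galois_extension_projection[OF projection_010]
      dihedral_projection.galois_extension_projection[OF projection_100] by blast+
  show "galois_point_group (curve_C4 q \<gamma>) (proj_point 0 1 0) \<cong> dihedral_group (q + 1)"
    unfolding galois_point_group_def q by (rule dihedral_projection.galois_group_projection[OF projection_010 assms])
  show "galois_point_group (curve_C4 q \<gamma>) (proj_point 1 0 0) \<cong> dihedral_group (q + 1)"
    unfolding galois_point_group_def q by (rule dihedral_projection.galois_group_projection[OF projection_100 assms])
qed

end

theorem theorem4:
  fixes \<gamma> :: "'k::alg_closed_field" and Fq :: "'k set" and p q e :: nat
  assumes "CHAR('k) = p" and "p \<ge> 3"
    and "q = p ^ e" and "q \<ge> 5" and "q + 1 > 6"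
    and "subfield Fq (ring_of_type_algebra :: 'k ring)" and "card Fq = q"
    and "\<gamma> \<in> Fq - {1, -1}" and "\<gamma> ^ ((q - 1) div 2) = 1"
  shows "irreducible_plane_curve (q + 1) (curve_C4 q \<gamma>) \<and>
    (outer_galois_point (curve_C4 q \<gamma>) (proj_point 0 1 0) \<and>
       galois_point_group (curve_C4 q \<gamma>) (proj_point 0 1 0) \<cong> dihedral_group (q + 1)) \<and>
    (outer_galois_point (curve_C4 q \<gamma>) (proj_point 1 0 0) \<and>
       galois_point_group (curve_C4 q \<gamma>) (proj_point 1 0 0) \<cong> dihedral_group (q + 1))"
proof -
  have prime: "prime CHAR('k)" using assms(1,2) by (intro prime_CHAR_semidom) simp
  have "odd p" using prime assms(1,2) prime_odd_nat[of p] by auto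
  have qe: "q = CHAR('k) ^ e" using assms(1,3) by simp
  have "e > 0" using assms(3,4) by (cases e) auto
  have "odd q" using \<open>odd p\<close> assms(3) by simp
  then obtain m where m: "q = 2 * m + 1" by (auto elim: oddE)
  define n where "n = m + 1"
  have qn: "q + 1 = 2 * n" and n: "n > 0" by (auto simp: m n_def)
  have m': "(q - 1) div 2 = m" using m by simp
  have q0: "of_nat q = (0::'k)" unfolding of_nat_eq_0_iff_char_dvd using qe \<open>e > 0\<close> by simp
  have two: "(2::'k) \<noteq> 0"
  proof
    assume "(2::'k) = 0"
    then have "of_nat 2 = (0::'k)" by simp
    then have "p dvd 2" unfolding of_nat_eq_0_iff_char_dvd assms(1) .
    then show False using assms(2) by (auto dest: dvd_imp_le)
  qed
  have "of_nat n \<noteq> (0::'k)"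
  proof
    assume "of_nat n = (0::'k)"
    then have "of_nat (q + 1) = (0::'k)" unfolding qn by simp
    then show False using q0 by simp
  qed
  then have card: "card (unit_roots n :: 'k set) = n" by (rule card_unit_roots)
  \<comment> \<open>The \<open>n\<close>-th roots of unity lie in the field with \<open>q\<^sup>2\<close> elements.\<close>
  have "n dvd q ^ 2 - 1"
  proof -
    have "q ^ 2 - 1 = n * (2 * (q - 1))"
      using m by (simp add: n_def power2_eq_square algebra_simps)
    then show ?thesis by simp
  qed
  moreover have "q ^ 2 = CHAR('k) ^ (e * 2)" unfolding qe by (simp add: power_mult)
  ultimately obtain z :: 'k where z: "z ^ n = 1" "inj_on (\<lambda>i. z ^ i) {..<n}" "unit_roots n = (\<lambda>i. z ^ i) ` {..<n}"
    using primitive_unit_root_exists[OF prime, of "q ^ 2" "e * 2" n] \<open>e > 0\<close> by auto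
  have g1: "\<gamma> ^ m = 1" using assms(9) m' by simp
  have gn: "\<gamma> ^ n = \<gamma>" using g1 by (simp add: n_def)
  have gq: "\<gamma> ^ q = \<gamma>" unfolding m using g1 by (simp add: power_mult mult.commute[of 2])
  have g0: "\<gamma> \<noteq> 0" using g1 assms(4) m by (auto simp: power_0_left)
  obtain \<kappa> where kappa: "\<kappa> ^ (2 * n) = - 1 / \<gamma>" using nth_root_exists[of "2 * n"] n by auto
  obtain \<tau> where tau: "\<tau> ^ (2 * n) = - \<gamma>" using nth_root_exists[of "2 * n"] n by auto
  interpret curve_C4_parameters q n \<gamma> \<kappa> \<tau>
    by unfold_locales
      (use qn n card two freshmans_dream'[OF prime qe] g0 gn gq assms(8) kappa tau in auto)
  show ?thesis using irreducible_curve_C4 outer_galois_points[OF z] by blast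
qed

end
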